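(* If $M,N$ are indecomposable preprojective $k(\Gamma,\Lambda)$-modules, then $[M]\preccurlyeq[N]$ in $\tilde{\mathscr P}(\Gamma,\Lambda)_0$ if and only if $S_M\preccurlyeq S_N$ in $\mathfrak P$.
   Context: $k$ is an arbitrary field and $\Gamma=(\Gamma_0,\Gamma_1)$ is a finite connected graph (multiple edges allowed) without loops and with more than one vertex. An orientation $\Lambda$ on $\Gamma$ chooses for each edge a starting point and an endpoint among its incident vertices, giving a quiver $(\Gamma,\Lambda)$; all orientations are assumed to have no oriented cycles. $\Gamma_0$ is a poset $(\Gamma_0,\Lambda)$ with $x\le y$ iff there is a path (possibly of length $0$) from $x$ to $y$. A sink is a vertex at which no arrow starts. $\sigma_x\Lambda$ is the orientation obtained by reversing all arrows incident with $x$. A finite sequence $S=x_1,\dots,x_s$ of vertices ($s\ge 0$) is (+)-admissible on $(\Gamma,\Lambda)$ if $x_1$ is a sink for $\Lambda$, $x_2$ is a sink for $\sigma_{x_1}\Lambda$, and so on; put $\Lambda^S=\sigma_{x_s}\cdots\sigma_{x_1}\Lambda$. $\mathfrak S$ is the set of (+)-admissible sequences on $(\Gamma,\Lambda)$. $\sim$ is the equivalence relation on $\mathfrak S$ generated by interchanging two consecutive terms $x_i,x_{i+1}$ that are not connected by an edge of $\Gamma$. For $S,T\in\mathfrak S$, $S\preccurlyeq T$ ($S$ is a subsequence of $T$) means $T\sim SU$ (concatenation) for some (+)-admissible sequence $U$ on $(\Gamma,\Lambda^S)$. $\mathrm{Supp}\,S$ is the set of vertices occurring in $S$. $\mathfrak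 P\subset\mathfrak S$ is the set of principal sequences, with the relation $\preccurlyeq$ inherited from $\mathfrak S$: every nonempty $S\in\mathfrak S$ has a canonical form $S\sim S_1\cdots S_r$ with each $S_i$ nonempty, consisting of distinct vertices, and $\mathrm{Supp}\,S_i=\mathrm{Supp}\,S_i\cdots S_r$; $S$ is principal if $\mathrm{Supp}\,S_r=\{y:x\le y\}$ for some $x\in\Gamma_0$ and, for $0<i<r$, $\mathrm{Supp}\,S_i$ is the smallest up-closed subset of $(\Gamma_0,\Lambda)$ containing $\mathrm{Supp}\,S_{i+1}$ and all vertices connected by an edge to a vertex of $\mathrm{Supp}\,S_{i+1}$. $k(\Gamma,\Lambda)$-modules are finite-dimensional left modules over the path algebra, identified with finite-dimensional representations $(V,f)$ of $(\Gamma,\Lambda)$ over $k$. For a sink $x$ of $(\Gamma,\Lambda)$, the positive reflection functor $F_x^+$ from $k(\Gamma,\Lambda)$-modules to $k(\Gamma,\sigma_x\Lambda)$-modules sends $(V,f)$ to $(W,g)$ with $W(z)=V(z)$ for $z\ne x$ and $W(x)=\ker\big(h:\bigoplus_i V(y_i)\to V(x)\big)$, where $a_i:y_i\to x$ are all the arrows ending at $x$ and $h$ is induced by the $f_{a_i}$; $g$ agrees with $f$ on arrows not incident with $x$, and for the reversed arrows $x\to y_i$ the maps $W(x)\to V(y_i)$ are induced by the inclusion $W(x)\subset\bigoplus_i V(y_i)$; on morphisms $F_x^+$ is defined naturally. For $S=x_1,\dots,x_s$ in $\mathfrak S$, $F(S)=F^+_{x_s}\cdots F^+_{x_1}$ (the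 identity if $S=\emptyset$); $S$ annihilates $M$ if $F(S)M=0$. $M$ is preprojective if some $S\in\mathfrak S$ annihilates it. A shortest sequence annihilating $M$ is an $S\in\mathfrak S$ that annihilates $M$ while no proper subsequence of $S$ (no $S'\preccurlyeq S$ with $S'\not\sim S$) annihilates $M$; for each preprojective $M$ such a sequence exists and is unique up to $\sim$, and it is denoted $S_M$; if $M$ is indecomposable, $S_M\in\mathfrak P$. $\tilde{\mathscr P}(\Gamma,\Lambda)_0$ is the set of isomorphism classes $[M]$ of indecomposable preprojective $k(\Gamma,\Lambda)$-modules (the vertices of the preprojective component of the Auslander–Reiten quiver). One writes $[X]\prec[Y]$ if there is a sequence of nonzero nonisomorphisms $X=A_0\to\cdots\to A_m=Y$, $m>0$, between indecomposable $k(\Gamma,\Lambda)$-modules (for preprojective $Y$ this is equivalent to the existence of such a sequence of irreducible morphisms between indecomposable preprojective modules, i.e. a path of positive length in the preprojective component). $[X]\preccurlyeq[Y]$ means $[X]\prec[Y]$ or $[X]=[Y]$; this is a partial order on $\tilde{\mathscr P}(\Gamma,\Lambda)_0$. *)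

theory Defs
  imports "Graph_Theory.Graph_Theory" "HOL-Library.Function_Algebras"
begin

section \<open>Quivers and admissible sequences\<close>

text \<open>
  A multigraph together with an orientation is a directed multigraph \<^typ>\<open>('v, 'e) pre_digraph\<close>;
  the unoriented graph is recovered by forgetting which end of an arc is its tail, and the
  orientations obtained by reflection live on the same \<^const>\<open>verts\<close> and \<^const>\<open>arcs\<close>.
  The \<^const>\<open>connected\<close> of the library is connectedness of the underlying unoriented graph, while
  \<^const>\<open>pre_digraph.cycle\<close> refers to oriented cycles.
\<close>

locale quiver = fin_digraph G + loopfree_digraph G
  for G :: "('v, 'e) pre_digraph" (structure) +
  assumes connected: "connected G"
    and more_than_one_vertex: "card (verts G) > 1"
    and no_oriented_cycle: "\<nexists>p. pre_digraph.cycle G p"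

definition adjacent :: "('v, 'e) pre_digraph \<Rightarrow> 'v \<Rightarrow> 'v \<Rightarrow> bool" where
  "adjacent G x y \<longleftrightarrow> (\<exists>e\<in>arcs G. {tail G e, head G e} = {x, y})"

definition sink :: "('v, 'e) pre_digraph \<Rightarrow> 'v \<Rightarrow> bool" where
  "sink G x \<longleftrightarrow> x \<in> verts G \<and> out_arcs G x = {}"

definition reflect :: "'v \<Rightarrow> ('v, 'e) pre_digraph \<Rightarrow> ('v, 'e) pre_digraph" where
  "reflect x G = G
     \<lparr> tail := (\<lambda>e. if x \<in> {tail G e, head G e} then head G e else tail G e),
       head := (\<lambda>e. if x \<in> {tail G e, head G e} then tail G e else head G e) \<rparr>"

fun admissible :: "('v, 'e) pre_digraph \<Rightarrow> 'v list \<Rightarrow> bool" where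
  "admissible G [] \<longleftrightarrow> True"
| "admissible G (x # S) \<longleftrightarrow> sink G x \<and> admissible (reflect x G) S"

definition interchange :: "('v, 'e) pre_digraph \<Rightarrow> 'v list \<Rightarrow> 'v list \<Rightarrow> bool" where
  "interchange G S T \<longleftrightarrow> admissible G S \<and> admissible G T \<and>
     (\<exists>A x y B. S = A @ [x, y] @ B \<and> T = A @ [y, x] @ B \<and> \<not> adjacent G x y)"

definition seq_equiv :: "('v, 'e) pre_digraph \<Rightarrow> 'v list \<Rightarrow> 'v list \<Rightarrow> bool" where
  "seq_equiv G S T \<longleftrightarrow> admissible G S \<and> admissible G T \<and> equivclp (interchange G) S T"

definition seq_le :: "('v, 'e) pre_digraph \<Rightarrow> 'v list \<Rightarrow> 'v list \<Rightarrow> bool" where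
  "seq_le G S T \<longleftrightarrow> admissible G S \<and> admissible G T \<and>
     (\<exists>U. admissible (fold reflect S G) U \<and> seq_equiv G T (S @ U))"

section \<open>Principal sequences\<close>

definition up_closed :: "('v, 'e) pre_digraph \<Rightarrow> 'v set \<Rightarrow> bool" where
  "up_closed G A \<longleftrightarrow> A \<subseteq> verts G \<and> (\<forall>x\<in>A. \<forall>y. x \<rightarrow>\<^sup>*\<^bsub>G\<^esub> y \<longrightarrow> y \<in> A)"

definition canonical_form :: "('v, 'e) pre_digraph \<Rightarrow> 'v list \<Rightarrow> 'v list list \<Rightarrow> bool" where
  "canonical_form G S Ss \<longleftrightarrow> Ss \<noteq> [] \<and> seq_equiv G S (concat Ss) \<and>
     (\<forall>i<length Ss. Ss ! i \<noteq> [] \<and> distinct (Ss ! i) \<and>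
        set (Ss ! i) = set (concat (drop i Ss)))"

text \<open>
  The canonical form is unique up to \<^const>\<open>seq_equiv\<close> of its pieces, so the supports of the
  pieces, and hence the condition below, do not depend on which one is taken.
\<close>

definition principal :: "('v, 'e) pre_digraph \<Rightarrow> 'v list \<Rightarrow> bool" where
  "principal G S \<longleftrightarrow> admissible G S \<and>
     (\<exists>Ss. canonical_form G S Ss \<and>
        (\<exists>x\<in>verts G. set (last Ss) = {y. x \<rightarrow>\<^sup>*\<^bsub>G\<^esub> y}) \<and>
        (\<forall>i. Suc i < length Ss \<longrightarrow>
           set (Ss ! i) = up_closed G hull
             (set (Ss ! Suc i) \<union> {y. \<exists>x\<in>set (Ss ! Suc i). adjacent G x y})))"

definition principal_le :: "('v, 'e) pre_digraph \<Rightarrow> 'v list \<Rightarrow> 'v list \<Rightarrow> bool" where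
  "principal_le G S T \<longleftrightarrow> principal G S \<and> principal G T \<and> seq_le G S T"

section \<open>Representations\<close>

text \<open>
  All vector spaces are finite-dimensional subspaces of one infinite-dimensional ambient space,
  the space of functions \<^typ>\<open>'e list \<Rightarrow> 'k\<close> on the (always infinite) set of lists of arrows.
  Every finite-dimensional vector space is isomorphic to one of these, and the ambient space contains
  the direct sum of any family of its subspaces indexed by arrows: a tuple \<open>(w\<^sub>e)\<close> is stored as
  the function sending \<open>e # l\<close> to \<open>w\<^sub>e l\<close>. So the reflection functors do not leave the type.
\<close>

type_synonym ('e, 'k) vec = "'e list \<Rightarrow> 'k"

definition vec_scale :: "'k::field \<Rightarrow> ('e, 'k) vec \<Rightarrow> ('e, 'k) vec" where
  "vec_scale c v = (\<lambda>l. c * v l)"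

global_interpretation vec: vector_space "vec_scale :: 'k::field \<Rightarrow> ('e, 'k) vec \<Rightarrow> ('e, 'k) vec"
  by unfold_locales (simp_all add: vec_scale_def fun_eq_iff algebra_simps)

definition finite_dimensional :: "('e, 'k::field) vec set \<Rightarrow> bool" where
  "finite_dimensional V \<longleftrightarrow> (\<exists>B. finite B \<and> V = vec.span B)"

definition linear_between ::
    "('e, 'k::field) vec set \<Rightarrow> ('e, 'k) vec set \<Rightarrow> (('e, 'k) vec \<Rightarrow> ('e, 'k) vec) \<Rightarrow> bool" where
  "linear_between V W f \<longleftrightarrow> f ` V \<subseteq> W \<and>
     (\<forall>u\<in>V. \<forall>v\<in>V. f (u + v) = f u + f v) \<and>
     (\<forall>c. \<forall>v\<in>V. f (vec_scale c v) = vec_scale c (f v))"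

definition component :: "'e \<Rightarrow> ('e, 'k) vec \<Rightarrow> ('e, 'k) vec" where
  "component e w = (\<lambda>l. w (e # l))"

definition direct_sum ::
    "'e set \<Rightarrow> ('e \<Rightarrow> ('e, 'k::field) vec set) \<Rightarrow> ('e, 'k) vec set" where
  "direct_sum I U = {w. w [] = 0 \<and> (\<forall>e\<in>I. component e w \<in> U e) \<and> (\<forall>e. e \<notin> I \<longrightarrow> component e w = 0)}"

record ('v, 'e, 'k) rep =
  rep_space :: "'v \<Rightarrow> ('e, 'k) vec set"
  rep_map :: "'e \<Rightarrow> ('e, 'k) vec \<Rightarrow> ('e, 'k) vec"

text \<open>
  The values of \<^const>\<open>rep_space\<close> off the vertices, and those of \<^const>\<open>rep_map\<close> off the arrows and
  off the space at the tail, carry no information; morphisms ignore them.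
\<close>

definition is_rep :: "('v, 'e) pre_digraph \<Rightarrow> ('v, 'e, 'k::field) rep \<Rightarrow> bool" where
  "is_rep G M \<longleftrightarrow> (\<forall>x\<in>verts G. finite_dimensional (rep_space M x)) \<and>
     (\<forall>e\<in>arcs G. linear_between (rep_space M (tail G e)) (rep_space M (head G e)) (rep_map M e))"

definition zero_rep :: "('v, 'e) pre_digraph \<Rightarrow> ('v, 'e, 'k::field) rep \<Rightarrow> bool" where
  "zero_rep G M \<longleftrightarrow> (\<forall>x\<in>verts G. rep_space M x = {0})"

definition rep_hom :: "('v, 'e) pre_digraph \<Rightarrow> ('v, 'e, 'k::field) rep \<Rightarrow> ('v, 'e, 'k) rep \<Rightarrow>
    ('v \<Rightarrow> ('e, 'k) vec \<Rightarrow> ('e, 'k) vec) \<Rightarrow> bool" where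
  "rep_hom G M N \<phi> \<longleftrightarrow>
     (\<forall>x\<in>verts G. linear_between (rep_space M x) (rep_space N x) (\<phi> x)) \<and>
     (\<forall>e\<in>arcs G. \<forall>v\<in>rep_space M (tail G e).
        \<phi> (head G e) (rep_map M e v) = rep_map N e (\<phi> (tail G e) v))"

definition zero_hom :: "('v, 'e) pre_digraph \<Rightarrow> ('v, 'e, 'k::field) rep \<Rightarrow>
    ('v \<Rightarrow> ('e, 'k) vec \<Rightarrow> ('e, 'k) vec) \<Rightarrow> bool" where
  "zero_hom G M \<phi> \<longleftrightarrow> (\<forall>x\<in>verts G. \<forall>v\<in>rep_space M x. \<phi> x v = 0)"

definition rep_iso :: "('v, 'e) pre_digraph \<Rightarrow> ('v, 'e, 'k::field) rep \<Rightarrow> ('v, 'e, 'k) rep \<Rightarrow>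
    ('v \<Rightarrow> ('e, 'k) vec \<Rightarrow> ('e, 'k) vec) \<Rightarrow> bool" where
  "rep_iso G M N \<phi> \<longleftrightarrow> rep_hom G M N \<phi> \<and>
     (\<forall>x\<in>verts G. bij_betw (\<phi> x) (rep_space M x) (rep_space N x))"

definition subrep :: "('v, 'e) pre_digraph \<Rightarrow> ('v, 'e, 'k::field) rep \<Rightarrow>
    ('v \<Rightarrow> ('e, 'k) vec set) \<Rightarrow> bool" where
  "subrep G M U \<longleftrightarrow> (\<forall>x\<in>verts G. vec.subspace (U x) \<and> U x \<subseteq> rep_space M x) \<and>
     (\<forall>e\<in>arcs G. rep_map M e ` U (tail G e) \<subseteq> U (head G e))"

definition indecomposable :: "('v, 'e) pre_digraph \<Rightarrow> ('v, 'e, 'k::field) rep \<Rightarrow> bool" where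
  "indecomposable G M \<longleftrightarrow> is_rep G M \<and> \<not> zero_rep G M \<and>
     (\<forall>U W. subrep G M U \<and> subrep G M W \<and>
        (\<forall>x\<in>verts G. U x \<inter> W x = {0} \<and> rep_space M x = {u + w |u w. u \<in> U x \<and> w \<in> W x}) \<longrightarrow>
        (\<forall>x\<in>verts G. U x = {0}) \<or> (\<forall>x\<in>verts G. W x = {0}))"

section \<open>Reflection functors and preprojective modules\<close>

text \<open>
  \<open>reflect_rep G x M\<close> is the value of the positive reflection functor at \<open>x\<close> on the object \<open>M\<close>,
  a representation of \<^term>\<open>reflect x G\<close>.
\<close>

definition reflect_rep ::
    "('v, 'e) pre_digraph \<Rightarrow> 'v \<Rightarrow> ('v, 'e, 'k::field) rep \<Rightarrow> ('v, 'e, 'k) rep" where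
  "reflect_rep G x M =
     \<lparr> rep_space = (rep_space M)
         (x := {w \<in> direct_sum (in_arcs G x) (\<lambda>e. rep_space M (tail G e)).
                 (\<Sum>e\<in>in_arcs G x. rep_map M e (component e w)) = 0}),
       rep_map = (\<lambda>e. if e \<in> in_arcs G x then component e else rep_map M e) \<rparr>"

fun reflect_rep_seq ::
    "('v, 'e) pre_digraph \<Rightarrow> 'v list \<Rightarrow> ('v, 'e, 'k::field) rep \<Rightarrow> ('v, 'e, 'k) rep" where
  "reflect_rep_seq G [] M = M"
| "reflect_rep_seq G (x # S) M = reflect_rep_seq (reflect x G) S (reflect_rep G x M)"

definition annihilates ::
    "('v, 'e) pre_digraph \<Rightarrow> 'v list \<Rightarrow> ('v, 'e, 'k::field) rep \<Rightarrow> bool" where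
  "annihilates G S M \<longleftrightarrow> admissible G S \<and> zero_rep (fold reflect S G) (reflect_rep_seq G S M)"

definition preprojective :: "('v, 'e) pre_digraph \<Rightarrow> ('v, 'e, 'k::field) rep \<Rightarrow> bool" where
  "preprojective G M \<longleftrightarrow> is_rep G M \<and> (\<exists>S. annihilates G S M)"

definition shortest_annihilating ::
    "('v, 'e) pre_digraph \<Rightarrow> 'v list \<Rightarrow> ('v, 'e, 'k::field) rep \<Rightarrow> bool" where
  "shortest_annihilating G S M \<longleftrightarrow> annihilates G S M \<and>
     (\<forall>S'. seq_le G S' S \<and> \<not> seq_equiv G S' S \<longrightarrow> \<not> annihilates G S' M)"

section \<open>The preprojective component\<close>

definition iso_class ::
    "('v, 'e) pre_digraph \<Rightarrow> ('v, 'e, 'k::field) rep \<Rightarrow> ('v, 'e, 'k) rep set" where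
  "iso_class G M = {N. is_rep G N \<and> (\<exists>\<phi>. rep_iso G M N \<phi>)}"

definition preprojective_vertices ::
    "('v, 'e) pre_digraph \<Rightarrow> ('v, 'e, 'k::field) rep set set" where
  "preprojective_vertices G = {iso_class G M |M. indecomposable G M \<and> preprojective G M}"

definition nonzero_noniso ::
    "('v, 'e) pre_digraph \<Rightarrow> ('v, 'e, 'k::field) rep \<Rightarrow> ('v, 'e, 'k) rep \<Rightarrow> bool" where
  "nonzero_noniso G A B \<longleftrightarrow> indecomposable G A \<and> indecomposable G B \<and>
     (\<exists>\<phi>. rep_hom G A B \<phi> \<and> \<not> zero_hom G A \<phi> \<and> \<not> rep_iso G A B \<phi>)"

definition class_less ::
    "('v, 'e) pre_digraph \<Rightarrow> ('v, 'e, 'k::field) rep set \<Rightarrow> ('v, 'e, 'k) rep set \<Rightarrow> bool" where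
  "class_less G C D \<longleftrightarrow> (\<exists>X\<in>C. \<exists>Y\<in>D. (nonzero_noniso G)\<^sup>+\<^sup>+ X Y)"

definition class_le ::
    "('v, 'e) pre_digraph \<Rightarrow> ('v, 'e, 'k::field) rep set \<Rightarrow> ('v, 'e, 'k) rep set \<Rightarrow> bool" where
  "class_le G C D \<longleftrightarrow> C \<in> preprojective_vertices G \<and> D \<in> preprojective_vertices G \<and>
     (class_less G C D \<or> C = D)"

end

theory Submission
  imports Defs "HOL-Library.Multiset"
begin

text \<open>
  Admissible sequences up to equivalence are vectors of multiplicities. Along an arrow \<open>t \<rightarrow> h\<close>
  the vertices \<open>h\<close> and \<open>t\<close> have to be reflected alternately, \<open>h\<close> first, so the multiplicities
  \<open>m\<close> of an admissible sequence satisfy \<open>m t \<le> m h \<le> m t + 1\<close> (\<open>heights\<close>); every such \<open>m\<close> occurs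
  (\<open>extend_to\<close>), equivalence is equality of multiplicities (\<open>seq_equiv_iff\<close>) and the subsequence
  relation is the pointwise order (\<open>seq_le_iff\<close>). These vectors are closed under pointwise
  minimum and maximum, so sequences form a distributive lattice.

  On the module side everything rests on one property of the reflection functor \<open>F\<close> at a sink
  \<open>x\<close>: an indecomposable module not killed by \<open>F\<close> is generated at \<open>x\<close> by its neighbours, and on
  modules generated at \<open>x\<close> the functor preserves indecomposability and both preserves and lifts
  nonzero morphisms (\<open>indecomposable_reflect_rep\<close>, \<open>reflect_nonzero_hom\<close>,
  \<open>unreflect_nonzero_hom\<close>). It follows that a sequence annihilating the target of a nonzero
  morphism between indecomposables annihilates the source (\<open>nonzero_hom_annihilates\<close>). The
  annihilating sequences of \<open>M\<close> are closed under meets, because the parts of two sequences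
  beyond their meet involve disjoint sets of vertices; so \<open>S\<^sub>M\<close> is the least sequence
  annihilating \<open>M\<close> (\<open>shortest_is_least\<close>). Together these give \<open>S\<^sub>M \<preceq> S\<^sub>N\<close> whenever \<open>[M] \<preceq> [N]\<close>.
  That \<open>S\<^sub>M\<close> is principal comes from the fact that its last vertex is unique
  (\<open>shortest_unique_peak\<close>): two different last vertices would make an intermediate module
  decompose.

  For the converse, write \<open>S\<^sub>N \<sim> C z y\<close> with \<open>C z\<close> still above \<open>S\<^sub>M\<close>. After reflecting along \<open>C\<close>
  the vertex \<open>z\<close> is a sink at which the image of \<open>N\<close> does not vanish, so the simple module at
  \<open>z\<close> maps to it. The negative reflection functor carries this morphism back to a nonzero
  morphism \<open>X \<rightarrow> N\<close> from an indecomposable \<open>X\<close> (\<open>lift_along_reflections\<close>), which \<open>C z\<close>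
  annihilates and \<open>C\<close> does not. If \<open>z\<close> is chosen suitably (\<open>peak_above_vertex\<close>), then
  \<open>S\<^sub>M \<preceq> S\<^sub>X \<prec> S\<^sub>N\<close>, and one descends from \<open>N\<close> to \<open>X\<close> until the two sequences agree, where \<open>M\<close>
  and the module reached become simple at the same sink. The resulting chain of nonzero
  morphisms from \<open>M\<close> to \<open>N\<close> (\<open>chain_of_seq_le\<close>) gives \<open>[M] \<preceq> [N]\<close>.
\<close>

section \<open>Admissible sequences and their multiplicities\<close>

text \<open>
  The reflected orientations met along an admissible sequence are handled under this condition,
  which depends only on the underlying graph and so survives every reflection.
\<close>

definition loopless_quiver :: "('v, 'e) pre_digraph \<Rightarrow> bool" where
  "loopless_quiver G \<longleftrightarrow> finite (arcs G) \<and>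
     (\<forall>e\<in>arcs G. tail G e \<in> verts G \<and> head G e \<in> verts G \<and> tail G e \<noteq> head G e)"

definition acyclic_quiver :: "('v, 'e) pre_digraph \<Rightarrow> bool" where
  "acyclic_quiver G \<longleftrightarrow> loopless_quiver G \<and> acyclic (arcs_ends G)"

lemma verts_reflect [simp]: "verts (reflect x G) = verts G"
  and arcs_reflect [simp]: "arcs (reflect x G) = arcs G"
  and tail_reflect: "tail (reflect x G) e = (if x \<in> {tail G e, head G e} then head G e else tail G e)"
  and head_reflect: "head (reflect x G) e = (if x \<in> {tail G e, head G e} then tail G e else head G e)"
  by (simp_all add: reflect_def)

lemma verts_fold_reflect [simp]: "verts (fold reflect S G) = verts G"
  and arcs_fold_reflect [simp]: "arcs (fold reflect S G) = arcs G"
  by (induction S arbitrary: G) simp_all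

lemma adjacent_iff: "adjacent G x y \<longleftrightarrow>
    (\<exists>e\<in>arcs G. tail G e = x \<and> head G e = y \<or> tail G e = y \<and> head G e = x)"
  unfolding adjacent_def doubleton_eq_iff by blast

lemma adjacent_commute: "adjacent G x y \<longleftrightarrow> adjacent G y x"
  by (auto simp: adjacent_iff)

lemma adjacent_reflect [simp]: "adjacent (reflect z G) x y \<longleftrightarrow> adjacent G x y"
  unfolding adjacent_iff tail_reflect head_reflect arcs_reflect by auto

lemma adjacent_fold_reflect [simp]: "adjacent (fold reflect S G) x y \<longleftrightarrow> adjacent G x y"
  by (induction S arbitrary: G) simp_all

lemma sink_iff: "sink G x \<longleftrightarrow> x \<in> verts G \<and> (\<forall>e\<in>arcs G. tail G e \<noteq> x)"
  by (auto simp: sink_def out_arcs_def)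

lemma loopless_reflect: "loopless_quiver G \<Longrightarrow> loopless_quiver (reflect x G)"
  by (auto simp: loopless_quiver_def tail_reflect head_reflect)

lemma loopless_fold_reflect: "loopless_quiver G \<Longrightarrow> loopless_quiver (fold reflect S G)"
  by (induction S arbitrary: G) (simp_all add: loopless_reflect)

lemma reflect_commute: "reflect x (reflect y G) = reflect y (reflect x G)"
  unfolding reflect_def by (rule pre_digraph.equality) (auto simp: fun_eq_iff)

lemma admissible_append:
  "admissible G (S @ T) \<longleftrightarrow> admissible G S \<and> admissible (fold reflect S G) T"
  by (induction S arbitrary: G) auto

lemma admissible_subset_verts: "admissible G S \<Longrightarrow> set S \<subseteq> verts G"
proof (induction S arbitrary: G)
  case (Cons x S)
  then show ?case using Cons.IH[of "reflect x G"] by (simp add: sink_iff)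
qed simp

lemma sink_reflect_nonadjacent:
  assumes "\<not> adjacent G x y" "x \<noteq> y"
  shows "sink (reflect x G) y \<longleftrightarrow> sink G y"
  using assms unfolding sink_iff tail_reflect adjacent_iff verts_reflect arcs_reflect by auto

lemma admissible_swap:
  assumes "admissible G (A @ [x, y] @ B)" "\<not> adjacent G x y"
  shows "admissible G (A @ [y, x] @ B)"
proof (cases "x = y")
  case False
  let ?G = "fold reflect A G"
  have n: "\<not> adjacent ?G x y" "\<not> adjacent ?G y x"
    using assms(2) by (simp_all add: adjacent_commute[of _ y x])
  show ?thesis
    using assms(1) False sink_reflect_nonadjacent[OF n(1)] sink_reflect_nonadjacent[OF n(2)]
    by (auto simp: admissible_append reflect_commute[of y x])
qed (use assms in simp)

text \<open>
  Each reflection at an end of an arrow reverses it, and it takes place at the end the arrow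
  currently points to. So the two ends alternate, the original head first, and the two counts
  determine the current orientation.
\<close>

lemma orientation_after_reflections:
  assumes "loopless_quiver G" "admissible G S" "e \<in> arcs G"
  shows "count (mset S) (head G e) = count (mset S) (tail G e)
       \<and> tail (fold reflect S G) e = tail G e \<and> head (fold reflect S G) e = head G e
     \<or> count (mset S) (head G e) = Suc (count (mset S) (tail G e))
       \<and> tail (fold reflect S G) e = head G e \<and> head (fold reflect S G) e = tail G e"
  using assms(2)
proof (induction S rule: rev_induct)
  case (snoc x S)
  have adm: "admissible G S" and s: "sink (fold reflect S G) x"
    using snoc.prems by (auto simp: admissible_append)
  have ne: "tail G e \<noteq> head G e" using assms by (auto simp: loopless_quiver_def)
  have nt: "tail (fold reflect S G) e \<noteq> x" using s assms(3) by (simp add: sink_iff)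
  from snoc.IH[OF adm] show ?case
  proof (elim disjE conjE)
    assume "count (mset S) (head G e) = count (mset S) (tail G e)"
      and "tail (fold reflect S G) e = tail G e" "head (fold reflect S G) e = head G e"
    then show ?thesis
      using nt ne by (cases "x = head G e") (simp_all add: tail_reflect head_reflect)
  next
    assume "count (mset S) (head G e) = Suc (count (mset S) (tail G e))"
      and "tail (fold reflect S G) e = head G e" "head (fold reflect S G) e = tail G e"
    then show ?thesis
      using nt ne by (cases "x = tail G e") (simp_all add: tail_reflect head_reflect)
  qed
qed simp

text \<open>
  These vectors are exactly the multiplicities of admissible sequences: \<open>heights_mset\<close> is one
  direction and \<open>extend_to\<close> the other.
\<close>

definition heights :: "('v, 'e) pre_digraph \<Rightarrow> 'v multiset \<Rightarrow> bool" where
  "heights G m \<longleftrightarrow> set_mset m \<subseteq> verts G \<and>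
     (\<forall>e\<in>arcs G. count m (tail G e) \<le> count m (head G e) \<and>
                 count m (head G e) \<le> Suc (count m (tail G e)))"

lemma heights_mset:
  assumes "loopless_quiver G" "admissible G S"
  shows "heights G (mset S)"
  unfolding heights_def
  using orientation_after_reflections[OF assms] admissible_subset_verts[OF assms(2)] by fastforce

lemma heights_inter:
  assumes "heights G m" "heights G n"
  shows "heights G (m \<inter># n)"
proof -
  have "count (m \<inter># n) (tail G e) \<le> count (m \<inter># n) (head G e) \<and>
      count (m \<inter># n) (head G e) \<le> Suc (count (m \<inter># n) (tail G e))" if "e \<in> arcs G" for e
  proof -
    have "count m (tail G e) \<le> count m (head G e)" "count m (head G e) \<le> Suc (count m (tail G e))"
      "count n (tail G e) \<le> count n (head G e)" "count n (head G e) \<le> Suc (count n (tail G e))"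
      using assms that by (auto simp: heights_def)
    then show ?thesis by (auto simp: min_def max_def)
  qed
  with assms show ?thesis by (auto simp: heights_def)
qed

lemma heights_union:
  assumes "heights G m" "heights G n"
  shows "heights G (m \<union># n)"
proof -
  have "count (m \<union># n) (tail G e) \<le> count (m \<union># n) (head G e) \<and>
      count (m \<union># n) (head G e) \<le> Suc (count (m \<union># n) (tail G e))" if "e \<in> arcs G" for e
  proof -
    have "count m (tail G e) \<le> count m (head G e)" "count m (head G e) \<le> Suc (count m (tail G e))"
      "count n (tail G e) \<le> count n (head G e)" "count n (head G e) \<le> Suc (count n (tail G e))"
      using assms that by (auto simp: heights_def)
    then show ?thesis by (auto simp: min_def max_def)
  qed
  with assms show ?thesis by (auto simp: heights_def)
qed

lemma sink_after_iff:
  assumes "loopless_quiver G" "admissible G S"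
  shows "sink (fold reflect S G) x \<longleftrightarrow> x \<in> verts G \<and>
    (\<forall>e\<in>arcs G. (tail G e = x \<longrightarrow> count (mset S) (head G e) = Suc (count (mset S) x)) \<and>
                (head G e = x \<longrightarrow> count (mset S) x = count (mset S) (tail G e)))"
proof -
  have "tail (fold reflect S G) e \<noteq> x \<longleftrightarrow>
      (tail G e = x \<longrightarrow> count (mset S) (head G e) = Suc (count (mset S) x)) \<and>
      (head G e = x \<longrightarrow> count (mset S) x = count (mset S) (tail G e))" if e: "e \<in> arcs G" for e
  proof -
    have ne: "tail G e \<noteq> head G e" using assms(1) e by (simp add: loopless_quiver_def)
    from orientation_after_reflections[OF assms e] show ?thesis
    proof (elim disjE conjE)
      assume "count (mset S) (head G e) = count (mset S) (tail G e)"
        and "tail (fold reflect S G) e = tail G e"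
      then show ?thesis using ne by (cases "tail G e = x") auto
    next
      assume "count (mset S) (head G e) = Suc (count (mset S) (tail G e))"
        and "tail (fold reflect S G) e = head G e"
      then show ?thesis using ne by (cases "head G e = x") auto
    qed
  qed
  then show ?thesis by (auto simp: sink_iff)
qed

lemma acyclic_extremal:
  assumes "acyclic_quiver G" "finite X" "X \<noteq> {}"
  obtains x y where "x \<in> X" "\<And>e. e \<in> arcs G \<Longrightarrow> tail G e = x \<Longrightarrow> head G e \<notin> X"
    and "y \<in> X" "\<And>e. e \<in> arcs G \<Longrightarrow> head G e = y \<Longrightarrow> tail G e \<notin> X"
proof -
  have fin: "finite (arcs_ends G)" and acyc: "acyclic (arcs_ends G)"
    using assms(1) by (auto simp: acyclic_quiver_def loopless_quiver_def arcs_ends_def)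
  have wf: "wf (arcs_ends G)" "wf ((arcs_ends G)\<inverse>)"
    using fin acyc by (auto intro: finite_acyclic_wf finite_acyclic_wf_converse)
  obtain x where x: "x \<in> X" "\<And>y. (y, x) \<in> (arcs_ends G)\<inverse> \<Longrightarrow> y \<notin> X"
    using wfE_min[OF wf(2)] assms(3) by (metis ex_in_conv)
  obtain y where y: "y \<in> X" "\<And>x. (x, y) \<in> arcs_ends G \<Longrightarrow> x \<notin> X"
    using wfE_min[OF wf(1)] assms(3) by (metis ex_in_conv)
  show ?thesis
    using x y by (intro that[of x y]) (auto simp: arcs_ends_conv)
qed

text \<open>
  Among the vertices that still occur less often in \<open>B\<close> than in \<open>m\<close>, take those with the fewest
  occurrences in \<open>B\<close>, and among these one that no arrow leaves towards another. It is a sink: an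
  arrow directed away from it in the current orientation leads to a vertex which is again short
  and either has fewer occurrences or equally many and comes later.
\<close>

lemma extend_by_sink:
  assumes G: "acyclic_quiver G" and B: "admissible G B" and m: "heights G m" and sub: "mset B \<subset># m"
  obtains x where "admissible G (B @ [x])" "mset (B @ [x]) \<subseteq># m"
proof -
  have lq: "loopless_quiver G" using G by (simp add: acyclic_quiver_def)
  let ?c = "count (mset B)"
  define X where "X = {x. ?c x < count m x}"
  have "X \<subseteq> set_mset m" by (auto simp: X_def count_greater_zero_iff[symmetric] simp del: count_greater_zero_iff)
  then have X: "finite X" "X \<subseteq> verts G"
    using m by (auto simp: heights_def intro: finite_subset)
  have "X \<noteq> {}"
    using sub by (auto simp: X_def subset_mset.less_le_not_le subseteq_mset_def not_le)
  define k where "k = Min (?c ` X)"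
  define Y where "Y = {x \<in> X. ?c x = k}"
  have kmin: "k \<le> ?c x" if "x \<in> X" for x using that X by (simp add: k_def)
  have "k \<in> ?c ` X" unfolding k_def using X \<open>X \<noteq> {}\<close> by (intro Min_in) auto
  then have "Y \<noteq> {}" by (auto simp: Y_def)
  moreover have "finite Y" using X by (auto simp: Y_def)
  ultimately obtain x where x: "x \<in> Y" and xmax: "\<And>e. e \<in> arcs G \<Longrightarrow> tail G e = x \<Longrightarrow> head G e \<notin> Y"
    using acyclic_extremal[OF G] by metis
  have xX: "x \<in> X" "?c x = k" using x by (auto simp: Y_def)
  have hB: "heights G (mset B)" using heights_mset[OF lq B] .
  have "sink (fold reflect B G) x"
  proof (unfold sink_after_iff[OF lq B], intro conjI ballI impI)
    show "x \<in> verts G" using xX X by auto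
  next
    fix e assume e: "e \<in> arcs G" and t: "tail G e = x"
    show "?c (head G e) = Suc (?c x)"
    proof (rule ccontr)
      assume "\<not> ?thesis"
      then have "?c (head G e) = ?c x" using hB e t unfolding heights_def by force
      moreover have "count m x \<le> count m (head G e)" using m e t unfolding heights_def by force
      ultimately have "head G e \<in> Y" using xX by (auto simp: Y_def X_def)
      with xmax[OF e t] show False by blast
    qed
  next
    fix e assume e: "e \<in> arcs G" and t: "head G e = x"
    show "?c x = ?c (tail G e)"
    proof (rule ccontr)
      assume "\<not> ?thesis"
      then have 1: "?c x = Suc (?c (tail G e))" using hB e t unfolding heights_def by force
      moreover have "count m x \<le> Suc (count m (tail G e))" using m e t unfolding heights_def by force
      ultimately have "tail G e \<in> X" using xX by (auto simp: X_def)
      with kmin 1 xX show False by fastforce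
    qed
  qed
  then have "admissible G (B @ [x])" using B by (simp add: admissible_append)
  moreover have "mset (B @ [x]) \<subseteq># m"
    using sub xX by (auto simp: X_def subseteq_mset_def subset_mset.less_le_not_le)
  ultimately show ?thesis using that by blast
qed

text \<open>
  This makes the lattice operations on multiplicities available for sequences: a vector of
  heights is realised by a sequence, and a realised vector below it by an initial segment.
\<close>

lemma extend_to:
  assumes G: "acyclic_quiver G" and B: "admissible G B" and m: "heights G m" and sub: "mset B \<subseteq># m"
  obtains U where "admissible G (B @ U)" "mset (B @ U) = m"
proof -
  have "\<exists>U. admissible G (B @ U) \<and> mset (B @ U) = m"
    using B sub
  proof (induction "size m - length B" arbitrary: B rule: less_induct)
    case less
    show ?case
    proof (cases "mset B = m")
      case True
      then show ?thesis using less.prems by (intro exI[of _ "[]"]) simp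
    next
      case False
      then have "mset B \<subset># m" using less.prems by simp
      then obtain x where x: "admissible G (B @ [x])" "mset (B @ [x]) \<subseteq># m"
        using extend_by_sink[OF G less.prems(1) m] by blast
      have "size (mset (B @ [x])) \<le> size m" using x(2) by (rule size_mset_mono)
      then have "size m - length (B @ [x]) < size m - length B" by simp
      from less.hyps[OF this x] obtain U where "admissible G ((B @ [x]) @ U)" "mset ((B @ [x]) @ U) = m"
        by blast
      then show ?thesis by (intro exI[of _ "x # U"]) simp
    qed
  qed
  then show ?thesis using that by blast
qed

lemma realize:
  assumes "acyclic_quiver G" "heights G m"
  obtains B where "admissible G B" "mset B = m"
  using extend_to[OF assms(1) _ assms(2), of "[]"] by auto

lemma interchange_mset: "interchange G S T \<Longrightarrow> mset S = mset T"
  by (auto simp: interchange_def)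

lemma seq_equiv_mset: "seq_equiv G S T \<Longrightarrow> mset S = mset T"
proof -
  assume "seq_equiv G S T"
  then have "equivclp (interchange G) S T" by (simp add: seq_equiv_def)
  then show ?thesis
    by (induction rule: equivclp_induct) (auto dest: interchange_mset)
qed

lemma interchange_Cons:
  assumes "sink G x" "interchange (reflect x G) S T"
  shows "interchange G (x # S) (x # T)"
proof -
  obtain A y z B where "S = A @ [y, z] @ B" "T = A @ [z, y] @ B" "\<not> adjacent G y z"
    using assms(2) by (auto simp: interchange_def)
  then have "x # S = (x # A) @ [y, z] @ B" "x # T = (x # A) @ [z, y] @ B" "\<not> adjacent G y z"
    by simp_all
  then show ?thesis using assms unfolding interchange_def by (metis admissible.simps(2))
qed

lemma equivclp_interchange_Cons:
  assumes "sink G x" "equivclp (interchange (reflect x G)) S T"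
  shows "equivclp (interchange G) (x # S) (x # T)"
  using assms(2)
proof (induction rule: equivclp_induct)
  case (step y z)
  then have "equivclp (interchange G) (x # y) (x # z)"
    using interchange_Cons[OF assms(1)]
    by (meson equivclp_sym r_into_equivclp)
  with step show ?case by (meson equivclp_trans)
qed simp

text \<open>
  A neighbour of the sink \<open>x\<close> becomes a sink only after \<open>x\<close> has been reflected. Hence everything
  before the first occurrence of \<open>x\<close> is nonadjacent to \<open>x\<close>, and \<open>x\<close> can be moved past it.
\<close>

lemma pull_sink_to_front:
  assumes lq: "loopless_quiver G" and s: "sink G x"
  shows "admissible G (A @ x # B) \<Longrightarrow> x \<notin> set A \<Longrightarrow>
    admissible G (x # A @ B) \<and> equivclp (interchange G) (A @ x # B) (x # A @ B)"
proof (induction A arbitrary: B rule: rev_induct)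
  case (snoc y A)
  have adm: "admissible G (A @ [y, x] @ B)" using snoc.prems(1) by simp
  have admAy: "admissible G (A @ [y])" using adm by (auto simp: admissible_append)
  have "\<not> adjacent G y x"
  proof
    assume "adjacent G y x"
    then obtain e where e: "e \<in> arcs G" "tail G e = y" "head G e = x"
      using s by (auto simp: adjacent_iff sink_iff)
    have "count (mset (A @ [y])) y \<le> count (mset (A @ [y])) x"
      using heights_mset[OF lq admAy] e unfolding heights_def by blast
    moreover have "x \<notin># mset (A @ [y])" using snoc.prems by simp
    ultimately have "count (mset (A @ [y])) y \<le> 0" by (metis not_in_iff)
    then show False by simp
  qed
  then have sw: "admissible G (A @ [x, y] @ B)" "interchange G (A @ [y, x] @ B) (A @ [x, y] @ B)"
    using admissible_swap[OF adm] adm by (auto simp: interchange_def)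
  have IH: "admissible G (x # A @ y # B)" "equivclp (interchange G) (A @ x # y # B) (x # A @ y # B)"
    using snoc.IH[of "y # B"] sw(1) snoc.prems by auto
  have "equivclp (interchange G) (A @ y # x # B) (A @ x # y # B)"
    using sw(2) by (simp add: r_into_equivclp)
  with IH show ?case by (auto intro: equivclp_trans)
qed simp

lemma equal_mset_imp_equivclp:
  assumes "loopless_quiver G" "admissible G S" "admissible G T" "mset S = mset T"
  shows "equivclp (interchange G) S T"
  using assms
proof (induction S arbitrary: G T)
  case (Cons x S)
  have "x \<in> set T" using Cons.prems(4) by (metis list.set_intros(1) mset_eq_setD)
  then obtain A B where T: "T = A @ x # B" "x \<notin> set A" by (meson split_list_first)
  have s: "sink G x" using Cons.prems by simp
  have 1: "admissible G (x # A @ B)" "equivclp (interchange G) T (x # A @ B)"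
    using pull_sink_to_front[OF Cons.prems(1) s] Cons.prems(3) T by auto
  have "equivclp (interchange (reflect x G)) S (A @ B)"
    using Cons.IH[OF loopless_reflect[OF Cons.prems(1)], of x "A @ B"] Cons.prems 1 T by auto
  from equivclp_interchange_Cons[OF s this] 1(2) show ?case
    by (meson equivclp_sym equivclp_trans)
qed simp

lemma seq_equiv_iff:
  assumes "loopless_quiver G"
  shows "seq_equiv G S T \<longleftrightarrow> admissible G S \<and> admissible G T \<and> mset S = mset T"
  using equal_mset_imp_equivclp[OF assms] seq_equiv_mset[of G S T] by (auto simp: seq_equiv_def)

text \<open>
  With \<open>seq_equiv_iff\<close> this turns both relations on sequences into statements about
  multiplicities.
\<close>

lemma seq_le_iff:
  assumes "acyclic_quiver G"
  shows "seq_le G S T \<longleftrightarrow> admissible G S \<and> admissible G T \<and> mset S \<subseteq># mset T"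
proof -
  have lq: "loopless_quiver G" using assms by (simp add: acyclic_quiver_def)
  show ?thesis
  proof
    assume "seq_le G S T"
    then show "admissible G S \<and> admissible G T \<and> mset S \<subseteq># mset T"
      by (auto simp: seq_le_def seq_equiv_iff[OF lq])
  next
    assume *: "admissible G S \<and> admissible G T \<and> mset S \<subseteq># mset T"
    then obtain U where "admissible G (S @ U)" "mset (S @ U) = mset T"
      using extend_to[OF assms _ heights_mset[OF lq]] by metis
    with * show "seq_le G S T"
      by (auto simp: seq_le_def seq_equiv_iff[OF lq] admissible_append)
  qed
qed

section \<open>Tuples of vectors and linear maps between subspaces\<close>

lemma component_simps [simp]:
  "component e (u + v) = component e u + component e v"
  "component e (u - v) = component e u - component e v"
  "component e (vec_scale c v) = vec_scale c (component e v)"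
  "component e 0 = 0"
  by (simp_all add: component_def vec_scale_def fun_eq_iff)

lemma component_sum: "component e (\<Sum>i\<in>I. f i :: ('e, 'k::field) vec) = (\<Sum>i\<in>I. component e (f i))"
  using sum_comp_morphism[of "component e" f I] by (simp add: o_def)

lemma vec_eqI: "w [] = w' [] \<Longrightarrow> (\<And>e. component e w = component e w') \<Longrightarrow> w = w'"
  by (rule ext, rename_tac l, case_tac l) (auto simp: component_def fun_eq_iff)

definition tuple :: "'e set \<Rightarrow> ('e \<Rightarrow> ('e, 'k::field) vec) \<Rightarrow> ('e, 'k) vec" where
  "tuple I g = (\<lambda>l. case l of [] \<Rightarrow> 0 | e # l' \<Rightarrow> if e \<in> I then g e l' else 0)"

lemma component_tuple [simp]: "component e (tuple I g) = (if e \<in> I then g e else 0)"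
  by (auto simp: component_def tuple_def fun_eq_iff)

lemma tuple_Nil [simp]: "tuple I g [] = 0"
  by (simp add: tuple_def)

lemma vec_scale_Nil [simp]: "vec_scale c v [] = c * v []"
  by (simp add: vec_scale_def)

lemma tuple_in_direct_sum: "(\<And>e. e \<in> I \<Longrightarrow> g e \<in> U e) \<Longrightarrow> tuple I g \<in> direct_sum I U"
  by (simp add: direct_sum_def)

lemma single_in_direct_sum:
  "v \<in> U e \<Longrightarrow> (\<And>f. f \<in> I \<Longrightarrow> 0 \<in> U f) \<Longrightarrow> e \<in> I \<Longrightarrow> tuple {e} (\<lambda>_. v) \<in> direct_sum I U"
  by (simp add: direct_sum_def)

lemma direct_sum_componentD: "w \<in> direct_sum I U \<Longrightarrow> e \<in> I \<Longrightarrow> component e w \<in> U e"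
  by (simp add: direct_sum_def)

lemma direct_sum_eqI:
  assumes "w \<in> direct_sum I U" "w' \<in> direct_sum I U'" "\<And>e. e \<in> I \<Longrightarrow> component e w = component e w'"
  shows "w = w'"
proof (rule vec_eqI)
  show "component e w = component e w'" for e
    using assms by (cases "e \<in> I") (auto simp: direct_sum_def)
qed (use assms in \<open>auto simp: direct_sum_def\<close>)

lemma direct_sum_mono: "(\<And>e. e \<in> I \<Longrightarrow> U e \<subseteq> U' e) \<Longrightarrow> direct_sum I U \<subseteq> direct_sum I U'"
  by (auto simp: direct_sum_def)

lemma direct_sum_cong: "(\<And>e. e \<in> I \<Longrightarrow> U e = U' e) \<Longrightarrow> direct_sum I U = direct_sum I U'"
  by (auto simp: direct_sum_def)

lemma tuple_add: "tuple I (\<lambda>e. f e + g e) = tuple I f + tuple I g"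
  by (rule vec_eqI) auto

lemma tuple_scale: "tuple I (\<lambda>e. vec_scale c (f e)) = vec_scale c (tuple I f)"
  by (rule vec_eqI) auto

lemma tuple_zero [simp]: "tuple I (\<lambda>e. 0) = 0"
  by (rule vec_eqI) auto

lemma tuple_cong: "(\<And>e. e \<in> I \<Longrightarrow> f e = g e) \<Longrightarrow> tuple I f = tuple I g"
  by (rule vec_eqI) auto

lemma sum_vec_Nil: "(\<Sum>i\<in>I. f i) [] = (\<Sum>i\<in>I. (f i [] :: 'k::field))"
  using sum_comp_morphism[of "\<lambda>v. v []" f I] by (simp add: o_def)

lemma direct_sum_expand:
  assumes "finite I" "w \<in> direct_sum I U"
  shows "w = (\<Sum>e\<in>I. tuple {e} (\<lambda>_. component e w))"
proof (rule vec_eqI)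
  fix f
  have "component f (\<Sum>e\<in>I. tuple {e} (\<lambda>_. component e w)) = (\<Sum>e\<in>I. if f = e then component f w else 0)"
    unfolding component_sum by (rule sum.cong) auto
  also have "\<dots> = component f w"
    using assms by (auto simp: direct_sum_def)
  finally show "component f w = component f (\<Sum>e\<in>I. tuple {e} (\<lambda>_. component e w))" ..
qed (use assms in \<open>simp add: direct_sum_def sum_vec_Nil\<close>)

lemma direct_sum_inter_zero:
  assumes "w \<in> direct_sum I A" "w \<in> direct_sum I B" "\<And>e. e \<in> I \<Longrightarrow> A e \<inter> B e = {0}"
  shows "w = 0"
proof (rule direct_sum_eqI[OF assms(1)])
  show "0 \<in> direct_sum I (\<lambda>_. {0})" by (simp add: direct_sum_def)
  fix e assume e: "e \<in> I"
  have "component e w \<in> A e \<inter> B e"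
    using direct_sum_componentD[OF assms(1) e] direct_sum_componentD[OF assms(2) e] by blast
  then show "component e w = component e 0" using assms(3)[OF e] by simp
qed

lemma subspace_direct_sum:
  assumes "\<And>e. e \<in> I \<Longrightarrow> vec.subspace (U e)"
  shows "vec.subspace (direct_sum I U)"
  using assms unfolding vec.subspace_def by (auto simp: direct_sum_def)

lemma direct_sum_zero:
  assumes "\<And>e. e \<in> I \<Longrightarrow> U e = {0}"
  shows "direct_sum I U = {0}"
proof -
  have 0: "0 \<in> direct_sum I U" using assms by (auto simp: direct_sum_def)
  moreover have "w = 0" if "w \<in> direct_sum I U" for w
    using direct_sum_eqI[OF that 0] direct_sum_componentD[OF that] assms by auto
  ultimately show ?thesis by blast
qed

lemma finite_dimensional_subspace: "finite_dimensional V \<Longrightarrow> vec.subspace V"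
  by (auto simp: finite_dimensional_def)

lemma finite_dimensional_mono:
  assumes "finite_dimensional W" "vec.subspace V" "V \<subseteq> W"
  shows "finite_dimensional V"
proof -
  obtain B where B: "finite B" "W = vec.span B" using assms(1) by (auto simp: finite_dimensional_def)
  obtain C where C: "C \<subseteq> V" "vec.independent C" "V \<subseteq> vec.span C"
    by (rule vec.maximal_independent_subset)
  have "finite C" using vec.independent_span_bound[OF B(1) C(2)] C(1) assms(3) B(2) by auto
  moreover have "V = vec.span C" using C assms(2) by (simp add: subset_antisym vec.span_minimal)
  ultimately show ?thesis by (auto simp: finite_dimensional_def)
qed

lemma finite_dimensional_direct_sum:
  assumes I: "finite I" and U: "\<And>e. e \<in> I \<Longrightarrow> finite_dimensional (U e)"
  shows "finite_dimensional (direct_sum I U)"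
proof -
  obtain B where B: "\<And>e. e \<in> I \<Longrightarrow> finite (B e) \<and> U e = vec.span (B e)"
    using U unfolding finite_dimensional_def by metis
  define D where "D = (\<Union>e\<in>I. (\<lambda>b. tuple {e} (\<lambda>_. b)) ` B e)"
  have inj: "tuple {e} (\<lambda>_. v) \<in> vec.span D" if e: "e \<in> I" and v: "v \<in> vec.span (B e)" for e v
    using v
  proof (induction rule: vec.span_induct_alt)
    case base
    show ?case using vec.span_zero by (subst tuple_zero)
  next
    case (step c x y)
    have "tuple {e} (\<lambda>_. x) \<in> D" using step e by (auto simp: D_def)
    then have "vec_scale c (tuple {e} (\<lambda>_. x)) + tuple {e} (\<lambda>_. y) \<in> vec.span D"
      using step(2) by (meson vec.span_add vec.span_scale vec.span_base)
    then show ?case by (subst tuple_add, subst tuple_scale)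
  qed
  have "direct_sum I U \<subseteq> vec.span D"
  proof
    fix w assume w: "w \<in> direct_sum I U"
    have "(\<Sum>e\<in>I. tuple {e} (\<lambda>_. component e w)) \<in> vec.span D"
      using w B by (intro vec.span_sum inj) (auto simp: direct_sum_def)
    then show "w \<in> vec.span D" using direct_sum_expand[OF I w] by simp
  qed
  moreover have "finite D" using I B by (auto simp: D_def)
  moreover have "vec.subspace (direct_sum I U)"
    using U by (intro subspace_direct_sum) (simp add: finite_dimensional_subspace)
  ultimately show ?thesis
    using finite_dimensional_mono[of "vec.span D"] unfolding finite_dimensional_def by blast
qed

lemma finite_dimensional_image:
  fixes f :: "('e, 'k::field) vec \<Rightarrow> ('e, 'k) vec"
  assumes "finite_dimensional V" "\<And>u v. f (u + v) = f u + f v"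
    "\<And>c v. f (vec_scale c v) = vec_scale c (f v)"
  shows "finite_dimensional (f ` V)"
proof -
  interpret f: Vector_Spaces.linear "vec_scale :: 'k \<Rightarrow> ('e, 'k) vec \<Rightarrow> _" "vec_scale :: 'k \<Rightarrow> ('e, 'k) vec \<Rightarrow> _" f
    using assms(2,3) vec.vector_space_axioms by (simp add: Vector_Spaces.linear_iff)
  obtain B where "finite B" "V = vec.span B" using assms(1) by (auto simp: finite_dimensional_def)
  then show ?thesis by (auto simp: finite_dimensional_def f.span_image[symmetric])
qed

text \<open>
  Projections are defined on the whole ambient space. Their kernels supply complements of
  subspaces, and the images of \<open>id - g\<close> realise quotients as concrete subspaces.
\<close>

definition projection_onto :: "('e, 'k::field) vec set \<Rightarrow> (('e, 'k) vec \<Rightarrow> ('e, 'k) vec) \<Rightarrow> bool" where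
  "projection_onto A g \<longleftrightarrow> (\<forall>u v. g (u + v) = g u + g v) \<and> (\<forall>c v. g (vec_scale c v) = vec_scale c (g v)) \<and>
     (\<forall>v. g v \<in> A) \<and> (\<forall>v\<in>A. g v = v)"

lemma projection_ontoD:
  assumes "projection_onto A g"
  shows "g (u + v) = g u + g v" "g (vec_scale c v) = vec_scale c (g v)" "g v \<in> A" "v \<in> A \<Longrightarrow> g v = v"
  using assms by (auto simp: projection_onto_def)

lemma subspace_projection:
  fixes A :: "('e, 'k::field) vec set"
  assumes "vec.subspace A"
  shows "\<exists>g. projection_onto A g"
proof -
  interpret p: vector_space_pair "vec_scale :: 'k \<Rightarrow> ('e, 'k) vec \<Rightarrow> ('e, 'k) vec"
    "vec_scale :: 'k \<Rightarrow> ('e, 'k) vec \<Rightarrow> ('e, 'k) vec" ..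
  have "Vector_Spaces.linear vec_scale vec_scale (id :: ('e, 'k) vec \<Rightarrow> _)"
    using vec.linear_id by simp
  from p.linear_exists_left_inverse_on[OF this assms] obtain g where
    "g ` UNIV \<subseteq> A" "Vector_Spaces.linear vec_scale vec_scale g" "\<forall>v\<in>A. g v = v" by auto
  then show ?thesis by (auto simp: projection_onto_def Vector_Spaces.linear_iff)
qed

text \<open>
  Keeping the range inside the line of \<open>w\<close> makes the map land in every subspace containing \<open>w\<close>.
\<close>

lemma linear_map_to_line:
  fixes v w :: "('e, 'k::field) vec"
  assumes "v \<noteq> 0"
  obtains f :: "('e, 'k) vec \<Rightarrow> ('e, 'k) vec"
  where "\<And>u v. f (u + v) = f u + f v" "\<And>c v. f (vec_scale c v) = vec_scale c (f v)"
    "\<And>u. f u \<in> vec.span {w}" "f v = w"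
proof -
  interpret p: vector_space_pair "vec_scale :: 'k \<Rightarrow> ('e, 'k) vec \<Rightarrow> ('e, 'k) vec"
    "vec_scale :: 'k \<Rightarrow> ('e, 'k) vec \<Rightarrow> ('e, 'k) vec" ..
  have "vec.independent {v}" using assms by simp
  from p.linear_independent_extend[OF this, of "\<lambda>_. w"] obtain h where
    h: "Vector_Spaces.linear vec_scale vec_scale h" "h v = w" by auto
  obtain g where "projection_onto (vec.span {w}) g"
    using subspace_projection[of "vec.span {w}"] by auto
  note g = projection_ontoD[OF this]
  show ?thesis
    by (rule that[of "\<lambda>u. g (h u)"]) (use h g in \<open>auto simp: Vector_Spaces.linear_iff vec.span_base\<close>)
qed

lemma linear_betweenD:
  assumes "linear_between V W f"
  shows "v \<in> V \<Longrightarrow> f v \<in> W" "u \<in> V \<Longrightarrow> v \<in> V \<Longrightarrow> f (u + v) = f u + f v"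
    "v \<in> V \<Longrightarrow> f (vec_scale c v) = vec_scale c (f v)"
  using assms by (auto simp: linear_between_def)

lemma linear_betweenI:
  assumes "\<And>v. v \<in> V \<Longrightarrow> f v \<in> W" "\<And>u v. u \<in> V \<Longrightarrow> v \<in> V \<Longrightarrow> f (u + v) = f u + f v"
    "\<And>c v. v \<in> V \<Longrightarrow> f (vec_scale c v) = vec_scale c (f v)"
  shows "linear_between V W f"
  using assms by (auto simp: linear_between_def)

lemma linear_tuple:
  assumes "\<And>e. e \<in> I \<Longrightarrow> linear_between V (U e) (f e)"
  shows "linear_between V (direct_sum I U) (\<lambda>v. tuple I (\<lambda>e. f e v))"
proof (rule linear_betweenI)
  note D = linear_betweenD[OF assms]
  fix u v c assume v: "v \<in> V"
  show "tuple I (\<lambda>e. f e v) \<in> direct_sum I U" by (rule tuple_in_direct_sum) (rule D(1)[OF _ v])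
  show "tuple I (\<lambda>e. f e (vec_scale c v)) = vec_scale c (tuple I (\<lambda>e. f e v))"
    unfolding tuple_scale[symmetric] by (rule tuple_cong) (rule D(3)[OF _ v])
  assume u: "u \<in> V"
  show "tuple I (\<lambda>e. f e (u + v)) = tuple I (\<lambda>e. f e u) + tuple I (\<lambda>e. f e v)"
    unfolding tuple_add[symmetric] by (rule tuple_cong) (rule D(2)[OF _ u v])
qed

lemma linear_component: "e \<in> I \<Longrightarrow> linear_between (direct_sum I U) (U e) (component e)"
  by (rule linear_betweenI) (auto simp: direct_sum_def)

lemma linear_between_zero: "linear_between V W f \<Longrightarrow> 0 \<in> V \<Longrightarrow> f 0 = 0"
  using linear_betweenD(3)[of V W f 0 0] by simp

lemma linear_between_uminus:
  assumes "linear_between V W f" "v \<in> V"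
  shows "f (- v) = - f v"
  using linear_betweenD(3)[OF assms, of "-1"] by simp

lemma linear_between_diff:
  assumes "linear_between V W f" "vec.subspace V" "u \<in> V" "v \<in> V"
  shows "f (u - v) = f u - f v"
  using linear_betweenD(2)[OF assms(1,3), of "- v"] linear_between_uminus[OF assms(1,4)] assms
  by (simp add: vec.subspace_neg)

lemma linear_between_compose:
  "linear_between U V f \<Longrightarrow> linear_between V W g \<Longrightarrow> linear_between U W (g \<circ> f)"
  by (auto simp: linear_between_def image_subset_iff)

lemma subspace_image_between:
  assumes "linear_between V W f" "vec.subspace A" "A \<subseteq> V"
  shows "vec.subspace (f ` A)"
  unfolding vec.subspace_def
proof (intro conjI ballI allI)
  show "0 \<in> f ` A"
    using linear_between_zero[OF assms(1)] assms(2,3) vec.subspace_0[OF assms(2)] by force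
  fix x y assume "x \<in> f ` A" "y \<in> f ` A"
  then obtain u v where "u \<in> A" "v \<in> A" "x = f u" "y = f v" by blast
  then show "x + y \<in> f ` A"
    using linear_betweenD(2)[OF assms(1), of u v] assms(2,3) vec.subspace_add[of A u v] by (metis image_eqI subsetD)
next
  fix c x assume "x \<in> f ` A"
  then obtain u where "u \<in> A" "x = f u" by blast
  then show "vec_scale c x \<in> f ` A"
    using linear_betweenD(3)[OF assms(1), of u c] assms(2,3) vec.subspace_scale[of A u c] by (metis image_eqI subsetD)
qed

lemma subspace_kernel_between:
  assumes "linear_between V W f" "vec.subspace V"
  shows "vec.subspace {v \<in> V. f v = 0}"
  using assms linear_betweenD[OF assms(1)] linear_between_zero[OF assms(1)] unfolding vec.subspace_def
  by auto

lemma linear_between_inv: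
  assumes "linear_between V W f" "vec.subspace V" "bij_betw f V W"
  shows "linear_between W V (the_inv_into V f)"
proof -
  have inj: "inj_on f V" and im: "f ` V = W" using assms(3) by (auto simp: bij_betw_def)
  let ?g = "the_inv_into V f"
  have g: "?g (f v) = v" if "v \<in> V" for v using the_inv_into_f_f[OF inj that] .
  show ?thesis
  proof (rule linear_betweenI)
    fix w assume "w \<in> W"
    then show "?g w \<in> V" using im g by auto
  next
    fix w w' assume "w \<in> W" "w' \<in> W"
    then obtain u v where uv: "u \<in> V" "v \<in> V" "w = f u" "w' = f v" using im by blast
    then have "w + w' = f (u + v)" "u + v \<in> V"
      using linear_betweenD(2)[OF assms(1)] assms(2) by (auto simp: vec.subspace_add)
    then show "?g (w + w') = ?g w + ?g w'" using uv g by simp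
  next
    fix c w assume "w \<in> W"
    then obtain u where u: "u \<in> V" "w = f u" using im by blast
    then have "vec_scale c w = f (vec_scale c u)" "vec_scale c u \<in> V"
      using linear_betweenD(3)[OF assms(1)] assms(2) by (auto simp: vec.subspace_scale)
    then show "?g (vec_scale c w) = vec_scale c (?g w)" using u g by simp
  qed
qed

lemma projection_complement:
  assumes g: "projection_onto A g"
    and V: "vec.subspace V" and sub: "A \<subseteq> V" and A: "vec.subspace A"
  shows "vec.subspace {v \<in> V. g v = 0}" "A \<inter> {v \<in> V. g v = 0} = {0}"
    "V = {u + w |u w. u \<in> A \<and> w \<in> {v \<in> V. g v = 0}}"
proof -
  note add = projection_ontoD(1)[OF g] and scale = projection_ontoD(2)[OF g]
    and ran = projection_ontoD(3)[OF g] and fixed = projection_ontoD(4)[OF g]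
  have g0: "g 0 = 0" using scale[of 0 0] by simp
  have lin: "linear_between V V g" using add scale ran sub by (intro linear_betweenI) auto
  show "vec.subspace {v \<in> V. g v = 0}" by (rule subspace_kernel_between[OF lin V])
  show "A \<inter> {v \<in> V. g v = 0} = {0}"
    using fixed g0 vec.subspace_0[OF A] vec.subspace_0[OF V] by force
  have "\<exists>u w. v = u + w \<and> u \<in> A \<and> w \<in> V \<and> g w = 0" if v: "v \<in> V" for v
  proof (intro exI conjI)
    show "v = g v + (v - g v)" "g v \<in> A" using ran by simp_all
    show "v - g v \<in> V" using v ran sub V by (meson subsetD vec.subspace_diff)
    show "g (v - g v) = 0"
      using linear_between_diff[OF lin V v, of "g v"] ran sub fixed by (metis diff_self subsetD)
  qed
  then show "V = {u + w |u w. u \<in> A \<and> w \<in> {v \<in> V. g v = 0}}"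
    using sub V by (auto simp: vec.subspace_add subset_iff)
qed

section \<open>The positive reflection functor on modules\<close>

lemma sink_arc_cases:
  assumes "loopless_quiver G" "sink G x" "e \<in> arcs G"
  obtains (incoming) "e \<in> in_arcs G x" "head G e = x" "tail G e \<noteq> x"
      "tail (reflect x G) e = x" "head (reflect x G) e = tail G e"
    | (other) "e \<notin> in_arcs G x" "head G e \<noteq> x" "tail G e \<noteq> x"
      "tail (reflect x G) e = tail G e" "head (reflect x G) e = head G e"
  using assms by (cases "head G e = x")
    (auto simp: loopless_quiver_def sink_iff in_arcs_def tail_reflect head_reflect)

lemma in_arcsD:
  assumes "loopless_quiver G" "e \<in> in_arcs G x"
  shows "e \<in> arcs G" "head G e = x" "tail G e \<noteq> x" "tail G e \<in> verts G" "x \<in> verts G"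
  using assms by (auto simp: loopless_quiver_def in_arcs_def)

lemma finite_in_arcs: "loopless_quiver G \<Longrightarrow> finite (in_arcs G x)"
  by (auto simp: loopless_quiver_def in_arcs_def)

lemma is_rep_subspace: "is_rep G M \<Longrightarrow> x \<in> verts G \<Longrightarrow> vec.subspace (rep_space M x)"
  by (simp add: is_rep_def finite_dimensional_subspace)

lemma is_rep_0: "is_rep G M \<Longrightarrow> x \<in> verts G \<Longrightarrow> 0 \<in> rep_space M x"
  by (rule vec.subspace_0[OF is_rep_subspace])

lemma is_rep_map:
  "is_rep G M \<Longrightarrow> e \<in> arcs G \<Longrightarrow> linear_between (rep_space M (tail G e)) (rep_space M (head G e)) (rep_map M e)"
  by (simp add: is_rep_def)

lemma rep_map_0: "loopless_quiver G \<Longrightarrow> is_rep G M \<Longrightarrow> e \<in> arcs G \<Longrightarrow> rep_map M e 0 = 0"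
  by (rule linear_between_zero[OF is_rep_map is_rep_0]) (auto simp: loopless_quiver_def)

lemma rep_hom_linear: "rep_hom G M N \<phi> \<Longrightarrow> x \<in> verts G \<Longrightarrow> linear_between (rep_space M x) (rep_space N x) (\<phi> x)"
  by (simp add: rep_hom_def)

lemma rep_hom_commutes: "rep_hom G M N \<phi> \<Longrightarrow> e \<in> arcs G \<Longrightarrow> v \<in> rep_space M (tail G e) \<Longrightarrow>
    \<phi> (head G e) (rep_map M e v) = rep_map N e (\<phi> (tail G e) v)"
  by (simp add: rep_hom_def)

abbreviation neighbour_sum ::
    "('v, 'e) pre_digraph \<Rightarrow> 'v \<Rightarrow> ('v, 'e, 'k::field) rep \<Rightarrow> ('e, 'k) vec set" where
  "neighbour_sum G x M \<equiv> direct_sum (in_arcs G x) (\<lambda>e. rep_space M (tail G e))"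

text \<open>
  The map whose kernel is the value of the reflection functor at the sink.
\<close>

definition incoming ::
    "('v, 'e) pre_digraph \<Rightarrow> 'v \<Rightarrow> ('v, 'e, 'k::field) rep \<Rightarrow> ('e, 'k) vec \<Rightarrow> ('e, 'k) vec" where
  "incoming G x M w = (\<Sum>e\<in>in_arcs G x. rep_map M e (component e w))"

lemma rep_space_reflect_rep: "rep_space (reflect_rep G x M) z =
    (if z = x then {w \<in> neighbour_sum G x M. incoming G x M w = 0} else rep_space M z)"
  by (simp add: reflect_rep_def incoming_def)

lemma rep_map_reflect_rep:
  "rep_map (reflect_rep G x M) e = (if e \<in> in_arcs G x then component e else rep_map M e)"
  by (simp add: reflect_rep_def)

lemma subspace_neighbour_sum:
  assumes "loopless_quiver G" "is_rep G M"
  shows "vec.subspace (neighbour_sum G x M)"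
  using in_arcsD[OF assms(1)] by (intro subspace_direct_sum is_rep_subspace[OF assms(2)])

lemma linear_incoming:
  assumes lq: "loopless_quiver G" and M: "is_rep G M" and x: "x \<in> verts G"
  shows "linear_between (neighbour_sum G x M) (rep_space M x) (incoming G x M)"
proof (rule linear_betweenI)
  have lin: "linear_between (rep_space M (tail G e)) (rep_space M x) (rep_map M e)" if "e \<in> in_arcs G x" for e
    using is_rep_map[OF M, of e] in_arcsD[OF lq that] by simp
  note D = linear_betweenD[OF lin]
  fix v assume v: "v \<in> neighbour_sum G x M"
  show "incoming G x M v \<in> rep_space M x" unfolding incoming_def
    using direct_sum_componentD[OF v] by (intro vec.subspace_sum is_rep_subspace[OF M x] D(1))
  show "incoming G x M (vec_scale c v) = vec_scale c (incoming G x M v)" for c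
    unfolding incoming_def vec.scale_sum_right
    using direct_sum_componentD[OF v] D(3) by (intro sum.cong) auto
  fix u assume u: "u \<in> neighbour_sum G x M"
  show "incoming G x M (u + v) = incoming G x M u + incoming G x M v"
    unfolding incoming_def sum.distrib[symmetric]
    using direct_sum_componentD[OF v] direct_sum_componentD[OF u] D(2) by (intro sum.cong) auto
qed

lemma single_in_neighbour_sum:
  assumes lq: "loopless_quiver G" and M: "is_rep G M" and e: "e \<in> in_arcs G x"
    and v: "v \<in> rep_space M (tail G e)"
  shows "tuple {e} (\<lambda>_. v) \<in> neighbour_sum G x M"
  using v is_rep_0[OF M in_arcsD(4)[OF lq]] e by (intro single_in_direct_sum)

text \<open>
  The spaces at the neighbours of \<open>x\<close> vanish, and with them the kernel inside their sum.
\<close>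

lemma zero_rep_reflect_concentrated:
  assumes lq: "loopless_quiver G" and s: "sink G x" and M: "is_rep G M"
    and off: "\<And>z. z \<in> verts G \<Longrightarrow> z \<noteq> x \<Longrightarrow> rep_space M z = {0}"
  shows "zero_rep (reflect x G) (reflect_rep G x M)"
proof -
  have "neighbour_sum G x M = {0}"
    using off[OF in_arcsD(4)[OF lq] in_arcsD(3)[OF lq]] by (intro direct_sum_zero)
  moreover have "incoming G x M 0 = 0"
    using linear_between_zero[OF linear_incoming[OF lq M]] subspace_neighbour_sum[OF lq M] s
    by (simp add: vec.subspace_0 sink_iff)
  ultimately show ?thesis using off by (auto simp: zero_rep_def rep_space_reflect_rep)
qed

lemma incoming_tuple:
  "incoming G x M (tuple (in_arcs G x) g) = (\<Sum>e\<in>in_arcs G x. rep_map M e (g e))"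
  by (simp add: incoming_def)

lemma incoming_single:
  assumes lq: "loopless_quiver G" and M: "is_rep G M" and e: "e \<in> in_arcs G x"
  shows "incoming G x M (tuple {e} (\<lambda>_. v)) = rep_map M e v"
proof -
  have "rep_map M f (if f = e then v else 0) = (if f = e then rep_map M e v else 0)" if f: "f \<in> in_arcs G x" for f
  proof -
    have "rep_map M f 0 = 0" by (rule rep_map_0[OF lq M in_arcsD(1)[OF lq f]])
    then show ?thesis by simp
  qed
  then have "incoming G x M (tuple {e} (\<lambda>_. v)) = (\<Sum>f\<in>in_arcs G x. if f = e then rep_map M e v else 0)"
    unfolding incoming_def by (intro sum.cong) simp_all
  then show ?thesis using e finite_in_arcs[OF lq] by simp
qed

lemma is_rep_reflect_rep:
  assumes lq: "loopless_quiver G" and s: "sink G x" and M: "is_rep G M"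
  shows "is_rep (reflect x G) (reflect_rep G x M)"
  unfolding is_rep_def
proof (intro conjI ballI)
  have x: "x \<in> verts G" using s by (simp add: sink_iff)
  let ?F = "reflect_rep G x M"
  fix z assume z: "z \<in> verts (reflect x G)"
  have fd: "finite_dimensional (neighbour_sum G x M)"
  proof (rule finite_dimensional_direct_sum[OF finite_in_arcs[OF lq]])
    show "finite_dimensional (rep_space M (tail G e))" if "e \<in> in_arcs G x" for e
      using M in_arcsD(4)[OF lq that] by (simp add: is_rep_def)
  qed
  have "vec.subspace {w \<in> neighbour_sum G x M. incoming G x M w = 0}"
    using linear_incoming[OF lq M x] subspace_neighbour_sum[OF lq M] by (rule subspace_kernel_between)
  then have "finite_dimensional {w \<in> neighbour_sum G x M. incoming G x M w = 0}"
    by (rule finite_dimensional_mono[OF fd]) auto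
  then show "finite_dimensional (rep_space ?F z)"
    using z M by (simp add: rep_space_reflect_rep is_rep_def)
next
  fix e assume e: "e \<in> arcs (reflect x G)"
  let ?F = "reflect_rep G x M" and ?G = "reflect x G"
  have e: "e \<in> arcs G" using e by simp
  show "linear_between (rep_space ?F (tail ?G e)) (rep_space ?F (head ?G e)) (rep_map ?F e)"
    using lq s e
  proof (cases rule: sink_arc_cases)
    case incoming
    have "component e v \<in> rep_space M (tail G e)" if "v \<in> neighbour_sum G x M" for v
      using direct_sum_componentD[OF that incoming(1)] .
    with incoming show ?thesis
      by (intro linear_betweenI) (simp_all add: rep_space_reflect_rep rep_map_reflect_rep)
  next
    case other
    then show ?thesis using is_rep_map[OF M e] by (simp add: rep_space_reflect_rep rep_map_reflect_rep)
  qed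
qed

text \<open>
  Surjectivity of \<open>incoming\<close> says that no nonzero direct summand of \<open>M\<close> is concentrated at the
  sink \<open>x\<close>. These are the modules on which the reflection functor loses no information.
\<close>

definition generated_at :: "('v, 'e) pre_digraph \<Rightarrow> 'v \<Rightarrow> ('v, 'e, 'k::field) rep \<Rightarrow> bool" where
  "generated_at G x M \<longleftrightarrow> incoming G x M ` neighbour_sum G x M = rep_space M x"

lemma indecomposableD:
  assumes "indecomposable G M"
  shows "is_rep G M" "\<not> zero_rep G M"
  using assms by (auto simp: indecomposable_def)

lemma indecomposable_split:
  assumes "indecomposable G M" "subrep G M U" "subrep G M W"
    "\<And>x. x \<in> verts G \<Longrightarrow> U x \<inter> W x = {0}"
    "\<And>x. x \<in> verts G \<Longrightarrow> rep_space M x = {u + w |u w. u \<in> U x \<and> w \<in> W x}"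
  shows "(\<forall>x\<in>verts G. U x = {0}) \<or> (\<forall>x\<in>verts G. W x = {0})"
  using assms unfolding indecomposable_def by blast

lemma indecomposableI:
  assumes "is_rep G M" "\<not> zero_rep G M"
    and split: "\<And>U W. subrep G M U \<Longrightarrow> subrep G M W \<Longrightarrow> (\<And>x. x \<in> verts G \<Longrightarrow> U x \<inter> W x = {0}) \<Longrightarrow>
      (\<And>x. x \<in> verts G \<Longrightarrow> rep_space M x = {u + w |u w. u \<in> U x \<and> w \<in> W x}) \<Longrightarrow>
      (\<forall>x\<in>verts G. U x = {0}) \<or> (\<forall>x\<in>verts G. W x = {0})"
  shows "indecomposable G M"
  unfolding indecomposable_def
proof (intro conjI allI impI assms(1,2))
  fix U W
  assume "subrep G M U \<and> subrep G M W \<and> (\<forall>x\<in>verts G. U x \<inter> W x = {0} \<and>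
    rep_space M x = {u + w |u w. u \<in> U x \<and> w \<in> W x})"
  then show "(\<forall>x\<in>verts G. U x = {0}) \<or> (\<forall>x\<in>verts G. W x = {0})"
    by (elim conjE) (rule split, simp_all)
qed

lemma sum_with_zero: "V = {u + w |u w. u \<in> V \<and> w \<in> {0 :: ('e, 'k::field) vec}}"
  "V = {u + w |u w. u \<in> {0 :: ('e, 'k::field) vec} \<and> w \<in> V}"
  by auto

lemma sum_of_sets_commute:
  "{u + w |u w. u \<in> A \<and> w \<in> B} = {u + w |u w. u \<in> B \<and> w \<in> (A :: ('e, 'k::field) vec set)}"
proof -
  have "{u + w |u w. u \<in> A \<and> w \<in> B} \<subseteq> {u + w |u w. u \<in> B \<and> w \<in> A}" for A B :: "('e, 'k) vec set"
    by clarify (intro exI conjI, rule add.commute)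
  from this[of A B] this[of B A] show ?thesis by (rule equalityI)
qed

text \<open>
  The summand \<open>C\<close> at \<open>x\<close> is a subrepresentation because nothing leaves it, and \<open>A\<close> together with
  all other spaces is one because every arrow into \<open>x\<close> lands in \<open>A\<close>. This is how direct summands
  concentrated at a single vertex are recognised below.
\<close>

lemma indecomposable_split_at_vertex:
  assumes lq: "loopless_quiver G" and M: "indecomposable G M" and x: "x \<in> verts G"
    and A: "vec.subspace A" and C: "vec.subspace C" and AC: "A \<inter> C = {0}"
    and sum: "rep_space M x = {u + w |u w. u \<in> A \<and> w \<in> C}"
    and into: "\<And>e v. e \<in> arcs G \<Longrightarrow> head G e = x \<Longrightarrow> v \<in> rep_space M (tail G e) \<Longrightarrow> rep_map M e v \<in> A"
    and out: "\<And>e v. e \<in> arcs G \<Longrightarrow> tail G e = x \<Longrightarrow> v \<in> C \<Longrightarrow> rep_map M e v = 0"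
  shows "C = {0} \<or> A = {0} \<and> (\<forall>z\<in>verts G. z \<noteq> x \<longrightarrow> rep_space M z = {0})"
proof -
  note rep = indecomposableD(1)[OF M]
  note sub = is_rep_subspace[OF rep]
  have "u + w \<in> rep_space M x" if "u \<in> A" "w \<in> C" for u w using that unfolding sum by blast
  from this[OF _ vec.subspace_0[OF C]] this[OF vec.subspace_0[OF A]]
  have le: "A \<subseteq> rep_space M x" "C \<subseteq> rep_space M x" by auto
  define U where "U = (rep_space M)(x := A)"
  define W where "W = (\<lambda>_. {0})(x := C)"
  have "subrep G M U"
    unfolding subrep_def
  proof (intro conjI ballI)
    fix z assume "z \<in> verts G"
    then show "vec.subspace (U z)" "U z \<subseteq> rep_space M z" using sub A le(1) by (auto simp: U_def)
  next
    fix e assume e: "e \<in> arcs G"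
    have "U (tail G e) \<subseteq> rep_space M (tail G e)" using le(1) by (auto simp: U_def)
    then show "rep_map M e ` U (tail G e) \<subseteq> U (head G e)"
      using into[OF e] linear_betweenD(1)[OF is_rep_map[OF rep e]] unfolding U_def by auto
  qed
  moreover have "subrep G M W"
    unfolding subrep_def
  proof (intro conjI ballI)
    fix z assume "z \<in> verts G"
    then show "vec.subspace (W z)" "W z \<subseteq> rep_space M z"
      using is_rep_0[OF rep] C le(2) by (auto simp: W_def vec.subspace_single_0)
  next
    fix e assume e: "e \<in> arcs G"
    have "rep_map M e v = 0" if "v \<in> W (tail G e)" for v
      using that out[OF e, of v] rep_map_0[OF lq rep e] by (cases "tail G e = x") (simp_all add: W_def)
    moreover have "0 \<in> W (head G e)" using vec.subspace_0[OF C] by (simp add: W_def)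
    ultimately show "rep_map M e ` W (tail G e) \<subseteq> W (head G e)" by auto
  qed
  moreover have "U z \<inter> W z = {0}" "rep_space M z = {u + w |u w. u \<in> U z \<and> w \<in> W z}" if "z \<in> verts G" for z
    using is_rep_0[OF rep that] AC sum sum_with_zero(1)[of "rep_space M z"] by (auto simp: U_def W_def)
  ultimately have "(\<forall>z\<in>verts G. U z = {0}) \<or> (\<forall>z\<in>verts G. W z = {0})"
    by (rule indecomposable_split[OF M])
  then show ?thesis
  proof
    assume U0: "\<forall>z\<in>verts G. U z = {0}"
    then have "U x = {0}" using x by blast
    moreover have "rep_space M z = {0}" if "z \<in> verts G" "z \<noteq> x" for z
      using U0[rule_format, OF that(1)] that(2) by (simp add: U_def)
    ultimately show ?thesis by (simp add: U_def)
  next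
    assume "\<forall>z\<in>verts G. W z = {0}"
    then have "W x = {0}" using x by blast
    then show ?thesis by (simp add: W_def)
  qed
qed

text \<open>
  If the image of \<open>incoming\<close> had a nonzero complement at \<open>x\<close>, this complement would split off,
  so \<open>M\<close> would be concentrated at \<open>x\<close> and the reflection would kill it.
\<close>

lemma indecomposable_generated_at:
  assumes lq: "loopless_quiver G" and s: "sink G x" and M: "indecomposable G M"
    and nz: "\<not> zero_rep (reflect x G) (reflect_rep G x M)"
  shows "generated_at G x M"
proof (rule ccontr)
  assume ng: "\<not> generated_at G x M"
  have x: "x \<in> verts G" using s by (simp add: sink_iff)
  note rep = indecomposableD(1)[OF M]
  note sub = is_rep_subspace[OF rep]
  let ?I = "incoming G x M ` neighbour_sum G x M"
  note lin = linear_incoming[OF lq rep x]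
  have I: "vec.subspace ?I"
    using subspace_image_between[OF lin subspace_neighbour_sum[OF lq rep]] by simp
  have sub_I: "?I \<subseteq> rep_space M x" using linear_betweenD(1)[OF lin] by blast
  obtain g where g: "projection_onto ?I g"
    using subspace_projection[OF I] by blast
  note compl = projection_complement[OF g sub[OF x] sub_I I]
  let ?K = "{v \<in> rep_space M x. g v = 0}"
  have "?K = {0} \<or> ?I = {0} \<and> (\<forall>z\<in>verts G. z \<noteq> x \<longrightarrow> rep_space M z = {0})"
  proof (rule indecomposable_split_at_vertex[OF lq M x I compl])
    fix e v assume e: "e \<in> arcs G" "head G e = x" and v: "v \<in> rep_space M (tail G e)"
    have ein: "e \<in> in_arcs G x" using e by simp
    show "rep_map M e v \<in> ?I"
      using imageI[OF single_in_neighbour_sum[OF lq rep ein v], of "incoming G x M"] incoming_single[OF lq rep ein, of v]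
      by simp
  next
    fix e v assume "e \<in> arcs G" "tail G e = x"
    then show "rep_map M e v = 0" using s by (auto simp: sink_iff)
  qed
  then show False
  proof
    assume "?K = {0}"
    then have "rep_space M x = ?I" using compl(3) sum_with_zero(1)[of ?I] by simp
    then show False using ng by (simp add: generated_at_def)
  next
    assume "?I = {0} \<and> (\<forall>z\<in>verts G. z \<noteq> x \<longrightarrow> rep_space M z = {0})"
    then show False using nz zero_rep_reflect_concentrated[OF lq s rep] by blast
  qed
qed

lemma subrepD:
  assumes "subrep G M U"
  shows "z \<in> verts G \<Longrightarrow> vec.subspace (U z)" "z \<in> verts G \<Longrightarrow> v \<in> U z \<Longrightarrow> v \<in> rep_space M z"
    "e \<in> arcs G \<Longrightarrow> v \<in> U (tail G e) \<Longrightarrow> rep_map M e v \<in> U (head G e)"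
  using assms unfolding subrep_def by blast+

lemma direct_sum_of_sums:
  assumes "w \<in> direct_sum I V" "\<And>e. e \<in> I \<Longrightarrow> V e = {u + w |u w. u \<in> A e \<and> w \<in> B e}"
  obtains a b where "w = a + b" "a \<in> direct_sum I A" "b \<in> direct_sum I (B :: 'e \<Rightarrow> ('e, 'k::field) vec set)"
proof -
  have "\<exists>p. component e w = fst p + snd p \<and> fst p \<in> A e \<and> snd p \<in> B e" if e: "e \<in> I" for e
  proof -
    have "component e w \<in> {u + w |u w. u \<in> A e \<and> w \<in> B e}"
      using direct_sum_componentD[OF assms(1) e] assms(2)[OF e] by simp
    then obtain u v where "component e w = u + v" "u \<in> A e" "v \<in> B e" by blast
    then show ?thesis by (intro exI[of _ "(u, v)"]) simp
  qed
  then obtain p where p: "\<And>e. e \<in> I \<Longrightarrow> component e w = fst (p e) + snd (p e) \<and> fst (p e) \<in> A e \<and> snd (p e) \<in> B e"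
    by metis
  show ?thesis
  proof (rule that)
    show a: "tuple I (\<lambda>e. fst (p e)) \<in> direct_sum I A" and b: "tuple I (\<lambda>e. snd (p e)) \<in> direct_sum I B"
      using p by (auto intro: tuple_in_direct_sum)
    have "tuple I (\<lambda>e. fst (p e) + snd (p e)) \<in> direct_sum I V"
      using p assms(2) by (intro tuple_in_direct_sum) blast
    then have "w = tuple I (\<lambda>e. fst (p e) + snd (p e))"
      by (rule direct_sum_eqI[OF assms(1)]) (simp add: p)
    then show "w = tuple I (\<lambda>e. fst (p e)) + tuple I (\<lambda>e. snd (p e))" by (simp only: tuple_add)
  qed
qed

text \<open>
  A decomposition of the reflected module yields one of \<open>M\<close> by letting each part generate its
  share at \<open>x\<close>. The shares span because \<open>M\<close> is generated at \<open>x\<close>. They meet in zero: if tuples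
  \<open>u\<close> and \<open>w\<close> of neighbours from the two parts have the same image, then \<open>u - w\<close> lies in the
  kernel, which is itself the sum of its two parts, so \<open>u\<close> and \<open>w\<close> lie in the kernel as well.
\<close>

lemma indecomposable_reflect_rep:
  assumes lq: "loopless_quiver G" and s: "sink G x" and M: "indecomposable G M"
    and nz: "\<not> zero_rep (reflect x G) (reflect_rep G x M)"
  shows "indecomposable (reflect x G) (reflect_rep G x M)"
proof -
  note rep = indecomposableD(1)[OF M]
  note sub = is_rep_subspace[OF rep]
  have x: "x \<in> verts G" using s by (simp add: sink_iff)
  note lin = linear_incoming[OF lq rep x]
  let ?G = "reflect x G" and ?F = "reflect_rep G x M"
  have gen: "incoming G x M ` neighbour_sum G x M = rep_space M x"
    using indecomposable_generated_at[OF assms] by (simp add: generated_at_def)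
  have split: "(\<forall>z\<in>verts ?G. U z = {0}) \<or> (\<forall>z\<in>verts ?G. W z = {0})"
    if U: "subrep ?G ?F U" and W: "subrep ?G ?F W"
      and UW0: "\<And>z. z \<in> verts ?G \<Longrightarrow> U z \<inter> W z = {0}"
      and UW: "\<And>z. z \<in> verts ?G \<Longrightarrow> rep_space ?F z = {u + w |u w. u \<in> U z \<and> w \<in> W z}" for U W
  proof -
    define N where "N A = direct_sum (in_arcs G x) (\<lambda>e. A (tail G e))" for A :: "'a \<Rightarrow> ('b, 'c) vec set"
    \<comment> \<open>The extension of a part \<open>A\<close> of the reflected module to \<open>M\<close>.\<close>
    define ext where "ext A = A(x := incoming G x M ` N A)" for A
    have off: "rep_space M z = {u + w |u w. u \<in> U z \<and> w \<in> W z}" if "z \<in> verts G" "z \<noteq> x" for z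
      using UW[of z] that by (simp add: rep_space_reflect_rep)
    have N_sub: "N A \<subseteq> neighbour_sum G x M" if "subrep ?G ?F A" for A
      unfolding N_def
    proof (intro direct_sum_mono subsetI)
      fix e v assume e: "e \<in> in_arcs G x" and v: "v \<in> A (tail G e)"
      then show "v \<in> rep_space M (tail G e)"
        using subrepD(2)[OF that _ v] in_arcsD(3,4)[OF lq e] by (simp add: rep_space_reflect_rep)
    qed
    have N_subspace: "vec.subspace (N A)" if "subrep ?G ?F A" for A
      unfolding N_def using subrepD(1)[OF that] in_arcsD(4)[OF lq] by (intro subspace_direct_sum) simp
    have A_sub_N: "A x \<subseteq> N A" if A: "subrep ?G ?F A" for A
    proof
      fix v assume v: "v \<in> A x"
      have vF: "v \<in> neighbour_sum G x M" using subrepD(2)[OF A, of x v] v x by (simp add: rep_space_reflect_rep)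
      have "component e v \<in> A (tail G e)" if e: "e \<in> in_arcs G x" for e
      proof -
        have "tail ?G e = x" "head ?G e = tail G e" using in_arcsD[OF lq e] by (simp_all add: tail_reflect head_reflect)
        then show ?thesis using subrepD(3)[OF A, of e v] v e in_arcsD[OF lq e] by (simp add: rep_map_reflect_rep)
      qed
      then show "v \<in> N A" using vF by (simp add: N_def direct_sum_def)
    qed
    have sub_ext: "subrep G M (ext A)" if A: "subrep ?G ?F A" for A
      unfolding subrep_def
    proof (intro conjI ballI)
      fix z assume z: "z \<in> verts G"
      show "vec.subspace (ext A z)"
        using z subrepD(1)[OF A] subspace_image_between[OF lin N_subspace[OF A] N_sub[OF A]] by (simp add: ext_def)
      show "ext A z \<subseteq> rep_space M z"
        using z subrepD(2)[OF A, of z] N_sub[OF A] linear_betweenD(1)[OF lin]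
        by (auto simp: ext_def rep_space_reflect_rep)
    next
      fix e assume e: "e \<in> arcs G"
      show "rep_map M e ` ext A (tail G e) \<subseteq> ext A (head G e)"
        using lq s e
      proof (cases rule: sink_arc_cases)
        case incoming
        have "rep_map M e v \<in> incoming G x M ` N A" if v: "v \<in> A (tail G e)" for v
        proof
          show "tuple {e} (\<lambda>_. v) \<in> N A"
            unfolding N_def using v vec.subspace_0[OF subrepD(1)[OF A]] in_arcsD(4)[OF lq] incoming(1)
            by (intro single_in_direct_sum) simp_all
          show "rep_map M e v = incoming G x M (tuple {e} (\<lambda>_. v))"
            using incoming_single[OF lq rep incoming(1)] by simp
        qed
        then show ?thesis using incoming by (auto simp: ext_def)
      next
        case other
        then show ?thesis using subrepD(3)[OF A, of e] e by (auto simp: ext_def rep_map_reflect_rep)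
      qed
    qed
    have inter: "ext U z \<inter> ext W z = {0}" if z: "z \<in> verts G" for z
    proof (cases "z = x")
      case False
      then show ?thesis using UW0 z by (simp add: ext_def)
    next
      case True
      have "h = 0" if h: "h \<in> incoming G x M ` N U" "h \<in> incoming G x M ` N W" for h
      proof -
        obtain u w where uw: "u \<in> N U" "w \<in> N W" "h = incoming G x M u" "h = incoming G x M w"
          using h by blast
        have mem: "u \<in> neighbour_sum G x M" "w \<in> neighbour_sum G x M" using uw N_sub U W by auto
        have "incoming G x M (u - w) = 0" "u - w \<in> neighbour_sum G x M"
          using linear_between_diff[OF lin subspace_neighbour_sum[OF lq rep] mem] uw mem
            subspace_neighbour_sum[OF lq rep] by (simp_all add: vec.subspace_diff)
        then have "u - w \<in> rep_space ?F x" by (simp add: rep_space_reflect_rep)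
        then obtain u1 w1 where 1: "u - w = u1 + w1" "u1 \<in> U x" "w1 \<in> W x" using UW[of x] x by auto
        have N1: "u1 \<in> N U" "w1 \<in> N W" using 1 A_sub_N U W by auto
        have "u - u1 = w + w1" using 1(1) by (simp add: algebra_simps)
        then have "u - u1 \<in> N W" using uw N1 N_subspace[OF W] by (simp add: vec.subspace_add)
        moreover have "u - u1 \<in> N U" using uw N1 N_subspace[OF U] by (simp add: vec.subspace_diff)
        ultimately have "u - u1 = 0"
          unfolding N_def by (rule direct_sum_inter_zero) (use UW0 in_arcsD(4)[OF lq] in \<open>simp add: Int_commute\<close>)
        then have "u \<in> rep_space ?F x" using subrepD(2)[OF U, of x u1] 1(2) x by simp
        then show "h = 0" using uw by (simp add: rep_space_reflect_rep)
      qed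
      moreover have "0 \<in> ext U x \<inter> ext W x"
        using subrepD(1)[OF sub_ext[OF U] x] subrepD(1)[OF sub_ext[OF W] x] by (simp add: vec.subspace_0)
      ultimately show ?thesis using True by (auto simp: ext_def)
    qed
    have span: "rep_space M z = {u + w |u w. u \<in> ext U z \<and> w \<in> ext W z}" if z: "z \<in> verts G" for z
    proof (cases "z = x")
      case False
      then show ?thesis using off z by (simp add: ext_def)
    next
      case True
      have "\<exists>u w. v = u + w \<and> u \<in> ext U x \<and> w \<in> ext W x" if v: "v \<in> rep_space M x" for v
      proof -
        obtain n where n: "n \<in> neighbour_sum G x M" "v = incoming G x M n" using v gen by blast
        have off': "rep_space M (tail G e) = {u + w |u w. u \<in> U (tail G e) \<and> w \<in> W (tail G e)}"
          if "e \<in> in_arcs G x" for e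
          using off[OF in_arcsD(4)[OF lq that] in_arcsD(3)[OF lq that]] .
        obtain a b where ab: "n = a + b" "a \<in> N U" "b \<in> N W"
          unfolding N_def using direct_sum_of_sums[OF n(1) off'] by blast
        have "v = incoming G x M a + incoming G x M b"
          using linear_betweenD(2)[OF lin subsetD[OF N_sub[OF U] ab(2)] subsetD[OF N_sub[OF W] ab(3)]]
          by (simp add: n(2) ab(1))
        then show ?thesis using ab by (auto simp: ext_def)
      qed
      moreover have "u + w \<in> rep_space M x" if "u \<in> ext U x" "w \<in> ext W x" for u w
        using subrepD(2)[OF sub_ext[OF U] x] subrepD(2)[OF sub_ext[OF W] x] that sub[OF x]
        by (simp add: vec.subspace_add)
      ultimately show ?thesis using True by blast
    qed
    have zero: "\<forall>z\<in>verts ?G. A z = {0}" if A: "subrep ?G ?F A" and z: "\<forall>z\<in>verts G. ext A z = {0}" for A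
    proof -
      have off0: "A z = {0}" if "z \<in> verts G" "z \<noteq> x" for z using z that by (auto simp: ext_def)
      then have "N A = {0}" unfolding N_def using in_arcsD(3,4)[OF lq] by (intro direct_sum_zero) blast
      moreover have "0 \<in> A x" using subrepD(1)[OF A, of x] x by (simp add: vec.subspace_0)
      ultimately have "A x = {0}" using A_sub_N[OF A] by auto
      with off0 show ?thesis by fastforce
    qed
    from indecomposable_split[OF M sub_ext[OF U] sub_ext[OF W] inter span] zero U W
    show ?thesis by blast
  qed
  show ?thesis by (rule indecomposableI[OF is_rep_reflect_rep[OF lq s rep] nz split])
qed

section \<open>The positive reflection functor on morphisms\<close>

definition nonzero_hom ::
    "('v, 'e) pre_digraph \<Rightarrow> ('v, 'e, 'k::field) rep \<Rightarrow> ('v, 'e, 'k) rep \<Rightarrow> bool" where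
  "nonzero_hom G M N \<longleftrightarrow> (\<exists>\<phi>. rep_hom G M N \<phi> \<and> \<not> zero_hom G M \<phi>)"

lemma rep_hom_into: "rep_hom G M N \<phi> \<Longrightarrow> x \<in> verts G \<Longrightarrow> v \<in> rep_space M x \<Longrightarrow> \<phi> x v \<in> rep_space N x"
  by (rule linear_betweenD(1)[OF rep_hom_linear])

lemma rep_hom_zero: "rep_hom G M N \<phi> \<Longrightarrow> is_rep G M \<Longrightarrow> x \<in> verts G \<Longrightarrow> \<phi> x 0 = 0"
  by (rule linear_between_zero[OF rep_hom_linear is_rep_0])

lemma rep_hom_compose:
  assumes "loopless_quiver G" "rep_hom G L M \<phi>" "rep_hom G M N \<psi>"
  shows "rep_hom G L N (\<lambda>x. \<psi> x \<circ> \<phi> x)"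
  unfolding rep_hom_def
proof (intro conjI ballI)
  fix x assume "x \<in> verts G"
  then show "linear_between (rep_space L x) (rep_space N x) (\<psi> x \<circ> \<phi> x)"
    using assms by (intro linear_between_compose[of _ "rep_space M x"]) (simp_all add: rep_hom_linear)
next
  fix e v assume e: "e \<in> arcs G" and v: "v \<in> rep_space L (tail G e)"
  have "tail G e \<in> verts G" using assms(1) e by (simp add: loopless_quiver_def)
  then have "\<phi> (tail G e) v \<in> rep_space M (tail G e)" using rep_hom_into[OF assms(2)] v by simp
  then show "(\<psi> (head G e) \<circ> \<phi> (head G e)) (rep_map L e v) = rep_map N e ((\<psi> (tail G e) \<circ> \<phi> (tail G e)) v)"
    using rep_hom_commutes[OF assms(2) e v] rep_hom_commutes[OF assms(3) e] by simp
qed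

definition neighbour_map ::
    "('v, 'e) pre_digraph \<Rightarrow> 'v \<Rightarrow> ('v \<Rightarrow> ('e, 'k::field) vec \<Rightarrow> ('e, 'k) vec) \<Rightarrow> ('e, 'k) vec \<Rightarrow> ('e, 'k) vec" where
  "neighbour_map G x \<phi> w = tuple (in_arcs G x) (\<lambda>e. \<phi> (tail G e) (component e w))"

lemma linear_neighbour_map:
  assumes lq: "loopless_quiver G"
    and \<phi>: "\<And>z. z \<in> verts G \<Longrightarrow> z \<noteq> x \<Longrightarrow> linear_between (rep_space M z) (rep_space N z) (\<phi> z)"
  shows "linear_between (neighbour_sum G x M) (neighbour_sum G x N) (neighbour_map G x \<phi>)"
  unfolding neighbour_map_def
proof (rule linear_tuple)
  fix e assume e: "e \<in> in_arcs G x"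
  show "linear_between (neighbour_sum G x M) (rep_space N (tail G e)) (\<lambda>w. \<phi> (tail G e) (component e w))"
    using linear_between_compose[OF linear_component[OF e, of "\<lambda>e. rep_space M (tail G e)"] \<phi>[OF in_arcsD(4,3)[OF lq e]]] by (simp add: o_def)
qed

lemma neighbour_map_zero:
  assumes lq: "loopless_quiver G" and w: "w \<in> neighbour_sum G x M"
    and off: "\<And>z v. z \<in> verts G \<Longrightarrow> z \<noteq> x \<Longrightarrow> v \<in> rep_space M z \<Longrightarrow> \<phi> z v = 0"
  shows "neighbour_map G x \<phi> w = 0"
proof -
  have "neighbour_map G x \<phi> w = tuple (in_arcs G x) (\<lambda>e. 0)"
    unfolding neighbour_map_def
    using off[OF in_arcsD(4,3)[OF lq] direct_sum_componentD[OF w]] by (intro tuple_cong)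
  then show ?thesis by (simp only: tuple_zero)
qed

text \<open>
  Naturality of the incoming map.
\<close>

lemma incoming_neighbour_map:
  assumes lq: "loopless_quiver G" and \<phi>: "rep_hom G M N \<phi>" and M: "is_rep G M"
    and x: "x \<in> verts G" and w: "w \<in> neighbour_sum G x M"
  shows "incoming G x N (neighbour_map G x \<phi> w) = \<phi> x (incoming G x M w)"
proof -
  have x': "linear_between (rep_space M x) (rep_space N x) (\<phi> x)" using rep_hom_linear[OF \<phi> x] .
  have in_x: "rep_map M e (component e w) \<in> rep_space M x" if e: "e \<in> in_arcs G x" for e
    using linear_betweenD(1)[OF is_rep_map[OF M in_arcsD(1)[OF lq e]] direct_sum_componentD[OF w e]]
      in_arcsD(2)[OF lq e] by simp
  have sums: "\<phi> x (\<Sum>e\<in>I. rep_map M e (component e w)) = (\<Sum>e\<in>I. \<phi> x (rep_map M e (component e w)))"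
    if "finite I" "I \<subseteq> in_arcs G x" for I
    using that
  proof (induction I rule: finite_induct)
    case empty
    show ?case unfolding sum.empty by (rule rep_hom_zero[OF \<phi> M x])
  next
    case (insert e I)
    have "(\<Sum>e\<in>I. rep_map M e (component e w)) \<in> rep_space M x"
      using insert.prems in_x by (intro vec.subspace_sum is_rep_subspace[OF M x]) auto
    then have "\<phi> x (rep_map M e (component e w) + (\<Sum>e\<in>I. rep_map M e (component e w)))
       = \<phi> x (rep_map M e (component e w)) + \<phi> x (\<Sum>e\<in>I. rep_map M e (component e w))"
      using insert.prems in_x by (intro linear_betweenD(2)[OF x']) auto
    moreover have "\<phi> x (\<Sum>e\<in>I. rep_map M e (component e w)) = (\<Sum>e\<in>I. \<phi> x (rep_map M e (component e w)))"
      using insert.IH insert.prems by blast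
    ultimately show ?case
      unfolding sum.insert[OF insert.hyps(1,2)] by (rule trans[OF _ arg_cong])
  qed
  have "incoming G x N (neighbour_map G x \<phi> w) = (\<Sum>e\<in>in_arcs G x. rep_map N e (\<phi> (tail G e) (component e w)))"
    by (simp add: neighbour_map_def incoming_tuple)
  also have "\<dots> = (\<Sum>e\<in>in_arcs G x. \<phi> x (rep_map M e (component e w)))"
  proof (rule sum.cong[OF refl])
    fix e assume e: "e \<in> in_arcs G x"
    show "rep_map N e (\<phi> (tail G e) (component e w)) = \<phi> x (rep_map M e (component e w))"
      using rep_hom_commutes[OF \<phi> in_arcsD(1)[OF lq e] direct_sum_componentD[OF w e]] in_arcsD(2)[OF lq e] by simp
  qed
  also have "\<dots> = \<phi> x (incoming G x M w)"
    unfolding incoming_def using sums[OF finite_in_arcs[OF lq]] by simp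
  finally show ?thesis .
qed

text \<open>
  A morphism whose reflection vanishes is zero away from \<open>x\<close>, hence also on everything at \<open>x\<close>
  that is generated by the neighbours.
\<close>

lemma reflect_nonzero_hom:
  assumes lq: "loopless_quiver G" and s: "sink G x" and M: "is_rep G M" and N: "is_rep G N"
    and gen: "generated_at G x M" and hom: "nonzero_hom G M N"
  shows "nonzero_hom (reflect x G) (reflect_rep G x M) (reflect_rep G x N)"
proof -
  obtain \<phi> where \<phi>: "rep_hom G M N \<phi>" and nz: "\<not> zero_hom G M \<phi>" using hom by (auto simp: nonzero_hom_def)
  have x: "x \<in> verts G" using s by (simp add: sink_iff)
  let ?G = "reflect x G" and ?M = "reflect_rep G x M" and ?N = "reflect_rep G x N"
  define \<psi> where "\<psi> = \<phi>(x := neighbour_map G x \<phi>)"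
  have lin: "linear_between (neighbour_sum G x M) (neighbour_sum G x N) (neighbour_map G x \<phi>)"
    using linear_neighbour_map[OF lq, of x M N \<phi>] rep_hom_linear[OF \<phi>] by blast
  have "rep_hom ?G ?M ?N \<psi>"
    unfolding rep_hom_def
  proof (intro conjI ballI)
    fix z assume z: "z \<in> verts ?G"
    show "linear_between (rep_space ?M z) (rep_space ?N z) (\<psi> z)"
    proof (cases "z = x")
      case True
      have "incoming G x N (neighbour_map G x \<phi> w) = 0"
        if "w \<in> neighbour_sum G x M" "incoming G x M w = 0" for w
        using incoming_neighbour_map[OF lq \<phi> M x that(1)] that(2) rep_hom_zero[OF \<phi> M x] by simp
      then show ?thesis
        using True linear_betweenD[OF lin]
        by (intro linear_betweenI) (simp_all add: \<psi>_def rep_space_reflect_rep)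
    next
      case False
      then show ?thesis using rep_hom_linear[OF \<phi>, of z] z by (simp add: \<psi>_def rep_space_reflect_rep)
    qed
  next
    fix e v assume "e \<in> arcs ?G" and v: "v \<in> rep_space ?M (tail ?G e)"
    then have e: "e \<in> arcs G" by simp
    show "\<psi> (head ?G e) (rep_map ?M e v) = rep_map ?N e (\<psi> (tail ?G e) v)"
      using lq s e
    proof (cases rule: sink_arc_cases)
      case incoming
      then show ?thesis by (simp add: \<psi>_def rep_map_reflect_rep neighbour_map_def)
    next
      case other
      then show ?thesis
        using rep_hom_commutes[OF \<phi> e] v by (simp add: \<psi>_def rep_map_reflect_rep rep_space_reflect_rep)
    qed
  qed
  moreover have "\<not> zero_hom ?G ?M \<psi>"
  proof
    assume "zero_hom ?G ?M \<psi>"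
    then have off: "\<phi> z v = 0" if "z \<in> verts G" "z \<noteq> x" "v \<in> rep_space M z" for z v
      using that unfolding zero_hom_def by (auto simp: \<psi>_def rep_space_reflect_rep dest!: bspec[where x = z])
    have "\<phi> x v = 0" if v: "v \<in> rep_space M x" for v
    proof -
      obtain w where w: "w \<in> neighbour_sum G x M" "v = incoming G x M w"
        using v gen unfolding generated_at_def by blast
      have "neighbour_map G x \<phi> w = 0" by (rule neighbour_map_zero[OF lq w(1) off])
      moreover have "incoming G x N 0 = 0"
        using linear_between_zero[OF linear_incoming[OF lq N x]] subspace_neighbour_sum[OF lq N]
        by (simp add: vec.subspace_0)
      ultimately show ?thesis using incoming_neighbour_map[OF lq \<phi> M x w(1)] w(2) by simp
    qed
    with off have "zero_hom G M \<phi>" by (auto simp: zero_hom_def)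
    with nz show False by blast
  qed
  ultimately show ?thesis by (auto simp: nonzero_hom_def)
qed

text \<open>
  The functor is full on modules generated at \<open>x\<close>. A morphism \<open>\<psi>\<close> between the reflected modules
  is kept away from \<open>x\<close>; at \<open>x\<close> the value of the lift on the image of a tuple \<open>w\<close> has to be the
  image of the tuple of values of \<open>\<psi>\<close>. This is well defined because \<open>\<psi>\<close> at \<open>x\<close> acts
  componentwise and maps kernel to kernel.
\<close>

lemma unreflect_nonzero_hom:
  assumes lq: "loopless_quiver G" and s: "sink G x" and M: "is_rep G M" and N: "is_rep G N"
    and gen: "generated_at G x M"
    and hom: "nonzero_hom (reflect x G) (reflect_rep G x M) (reflect_rep G x N)"
  shows "nonzero_hom G M N"
proof -
  let ?G = "reflect x G" and ?M = "reflect_rep G x M" and ?N = "reflect_rep G x N"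
  obtain \<psi> where \<psi>: "rep_hom ?G ?M ?N \<psi>" and nz: "\<not> zero_hom ?G ?M \<psi>" using hom by (auto simp: nonzero_hom_def)
  have x: "x \<in> verts G" using s by (simp add: sink_iff)
  have off: "linear_between (rep_space M z) (rep_space N z) (\<psi> z)" if "z \<in> verts G" "z \<noteq> x" for z
    using rep_hom_linear[OF \<psi>, of z] that by (simp add: rep_space_reflect_rep)
  let ?P = "neighbour_map G x \<psi>"
  let ?h = "incoming G x M" and ?k = "incoming G x N"
  have linP: "linear_between (neighbour_sum G x M) (neighbour_sum G x N) ?P"
    using linear_neighbour_map[OF lq off] .
  note linh = linear_incoming[OF lq M x] and link = linear_incoming[OF lq N x]
  note subM = subspace_neighbour_sum[OF lq M, of x]
  have \<psi>x: "\<psi> x w = ?P w" if w: "w \<in> neighbour_sum G x M" "?h w = 0" for w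
  proof (rule direct_sum_eqI)
    have wM: "w \<in> rep_space ?M x" using w by (simp add: rep_space_reflect_rep)
    show "\<psi> x w \<in> neighbour_sum G x N" using rep_hom_into[OF \<psi>, of x w] wM x by (simp add: rep_space_reflect_rep)
    show "?P w \<in> neighbour_sum G x N" using linear_betweenD(1)[OF linP w(1)] .
    fix e assume e: "e \<in> in_arcs G x"
    have "tail ?G e = x" "head ?G e = tail G e" "e \<in> arcs ?G"
      using in_arcsD[OF lq e] by (simp_all add: tail_reflect head_reflect)
    then show "component e (\<psi> x w) = component e (?P w)"
      using rep_hom_commutes[OF \<psi>, of e w] wM e by (simp add: rep_map_reflect_rep neighbour_map_def)
  qed
  have ker: "?k (?P w) = 0" if w: "w \<in> neighbour_sum G x M" "?h w = 0" for w
  proof -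
    have "\<psi> x w \<in> rep_space ?N x" using rep_hom_into[OF \<psi>, of x w] w x by (simp add: rep_space_reflect_rep)
    then show ?thesis using \<psi>x[OF w] by (simp add: rep_space_reflect_rep)
  qed
  have welldef: "?k (?P w) = ?k (?P w')" if w: "w \<in> neighbour_sum G x M" "w' \<in> neighbour_sum G x M" "?h w = ?h w'" for w w'
  proof -
    have d: "w - w' \<in> neighbour_sum G x M" using w subM by (simp add: vec.subspace_diff)
    have "?h (w - w') = 0" using linear_between_diff[OF linh subM w(1,2)] w(3) by simp
    then have "?k (?P (w - w')) = 0" using ker d by blast
    moreover have "?P (w - w') = ?P w - ?P w'" using linear_between_diff[OF linP subM w(1,2)] .
    moreover have "?k (?P w - ?P w') = ?k (?P w) - ?k (?P w')"
      using linear_between_diff[OF link subspace_neighbour_sum[OF lq N]] linear_betweenD(1)[OF linP] w by blast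
    ultimately show ?thesis by simp
  qed
  \<comment> \<open>A preimage under the incoming map; by \<open>welldef\<close> its choice does not matter.\<close>
  define sec where "sec v = (SOME w. w \<in> neighbour_sum G x M \<and> ?h w = v)" for v
  have sec: "sec v \<in> neighbour_sum G x M" "?h (sec v) = v" if v: "v \<in> rep_space M x" for v
  proof -
    have "v \<in> ?h ` neighbour_sum G x M" using v gen by (simp add: generated_at_def)
    then have "\<exists>w. w \<in> neighbour_sum G x M \<and> ?h w = v" by blast
    then have "sec v \<in> neighbour_sum G x M \<and> ?h (sec v) = v" unfolding sec_def by (rule someI_ex)
    then show "sec v \<in> neighbour_sum G x M" "?h (sec v) = v" by blast+
  qed
  define \<phi> where "\<phi> = \<psi>(x := \<lambda>v. ?k (?P (sec v)))"
  have \<phi>h: "\<phi> x (?h w) = ?k (?P w)" if w: "w \<in> neighbour_sum G x M" for w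
  proof -
    have hw: "?h w \<in> rep_space M x" using linear_betweenD(1)[OF linh w] .
    show ?thesis using welldef[OF sec(1)[OF hw] w sec(2)[OF hw]] by (simp add: \<phi>_def)
  qed
  have lin: "linear_between (neighbour_sum G x M) (rep_space N x) (?k \<circ> ?P)"
    using linear_between_compose[OF linP link] .
  have linx: "linear_between (rep_space M x) (rep_space N x) (\<phi> x)"
  proof (rule linear_betweenI)
    fix v assume v: "v \<in> rep_space M x"
    then obtain w where w: "w \<in> neighbour_sum G x M" "v = ?h w" using sec by metis
    show "\<phi> x v \<in> rep_space N x" using \<phi>h[OF w(1)] linear_betweenD(1)[OF lin w(1)] w(2) by simp
    show "\<phi> x (vec_scale c v) = vec_scale c (\<phi> x v)" for c
    proof -
      have "vec_scale c w \<in> neighbour_sum G x M" using w(1) subM by (simp add: vec.subspace_scale)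
      moreover have "vec_scale c v = ?h (vec_scale c w)" using linear_betweenD(3)[OF linh w(1)] w(2) by simp
      ultimately show ?thesis using \<phi>h w linear_betweenD(3)[OF lin w(1)] by simp
    qed
    fix u assume "u \<in> rep_space M x"
    then obtain w' where w': "w' \<in> neighbour_sum G x M" "u = ?h w'" using sec by metis
    have "w' + w \<in> neighbour_sum G x M" using w(1) w'(1) subM by (simp add: vec.subspace_add)
    moreover have "u + v = ?h (w' + w)" using linear_betweenD(2)[OF linh w'(1) w(1)] w(2) w'(2) by simp
    ultimately show "\<phi> x (u + v) = \<phi> x u + \<phi> x v" using \<phi>h w w' linear_betweenD(2)[OF lin w'(1) w(1)] by simp
  qed
  have "rep_hom G M N \<phi>"
    unfolding rep_hom_def
  proof (intro conjI ballI)
    fix z assume z: "z \<in> verts G"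
    show "linear_between (rep_space M z) (rep_space N z) (\<phi> z)"
      using linx off[OF z] by (cases "z = x") (simp_all add: \<phi>_def)
  next
    fix e v assume e: "e \<in> arcs G" and v: "v \<in> rep_space M (tail G e)"
    show "\<phi> (head G e) (rep_map M e v) = rep_map N e (\<phi> (tail G e) v)"
      using lq s e
    proof (cases rule: sink_arc_cases)
      case incoming
      have w: "tuple {e} (\<lambda>_. v) \<in> neighbour_sum G x M"
        by (rule single_in_neighbour_sum[OF lq M incoming(1) v])
      have "?P (tuple {e} (\<lambda>_. v)) = tuple {e} (\<lambda>_. \<psi> (tail G e) v)"
      proof (rule direct_sum_eqI)
        show "?P (tuple {e} (\<lambda>_. v)) \<in> neighbour_sum G x N" using linear_betweenD(1)[OF linP w] .
        show "tuple {e} (\<lambda>_. \<psi> (tail G e) v) \<in> neighbour_sum G x N"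
          using linear_betweenD(1)[OF off v] in_arcsD(3,4)[OF lq incoming(1)]
          by (intro single_in_neighbour_sum[OF lq N incoming(1)])
        fix f assume f: "f \<in> in_arcs G x"
        have "\<psi> (tail G f) 0 = 0"
          using linear_between_zero[OF off] in_arcsD(3,4)[OF lq f] is_rep_0[OF M] by blast
        then show "component f (?P (tuple {e} (\<lambda>_. v))) = component f (tuple {e} (\<lambda>_. \<psi> (tail G e) v))"
          using f by (simp add: neighbour_map_def)
      qed
      then show ?thesis
        using \<phi>h[OF w] incoming_single[OF lq M incoming(1), of v]
          incoming_single[OF lq N incoming(1), of "\<psi> (tail G e) v"] incoming by (simp add: \<phi>_def)
    next
      case other
      then show ?thesis
        using rep_hom_commutes[OF \<psi>, of e v] e v by (simp add: \<phi>_def rep_map_reflect_rep rep_space_reflect_rep)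
    qed
  qed
  moreover have "\<not> zero_hom G M \<phi>"
  proof
    assume z: "zero_hom G M \<phi>"
    have off0: "\<psi> z v = 0" if "z \<in> verts G" "z \<noteq> x" "v \<in> rep_space M z" for z v
      using z that unfolding zero_hom_def \<phi>_def by (metis fun_upd_apply)
    have "\<psi> x w = 0" if w: "w \<in> neighbour_sum G x M" "?h w = 0" for w
      using \<psi>x[OF w] neighbour_map_zero[OF lq w(1) off0] by simp
    with off0 have "zero_hom ?G ?M \<psi>" by (simp add: zero_hom_def rep_space_reflect_rep)
    with nz show False by blast
  qed
  ultimately show ?thesis by (auto simp: nonzero_hom_def)
qed

lemma zero_rep_target: "zero_rep G N \<Longrightarrow> \<not> nonzero_hom G M N"
  unfolding zero_rep_def nonzero_hom_def zero_hom_def rep_hom_def linear_between_def by blast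

lemma rep_iso_inverse:
  assumes lq: "loopless_quiver G" and M: "is_rep G M" and iso: "rep_iso G M N \<phi>"
  shows "rep_iso G N M (\<lambda>x. the_inv_into (rep_space M x) (\<phi> x))"
proof -
  have \<phi>: "rep_hom G M N \<phi>" and bij: "\<And>x. x \<in> verts G \<Longrightarrow> bij_betw (\<phi> x) (rep_space M x) (rep_space N x)"
    using iso by (auto simp: rep_iso_def)
  let ?i = "\<lambda>x. the_inv_into (rep_space M x) (\<phi> x)"
  have inv: "?i x (\<phi> x v) = v" if "x \<in> verts G" "v \<in> rep_space M x" for x v
    using the_inv_into_f_f bij[OF that(1)] that(2) by (metis bij_betw_def)
  have "rep_hom G N M ?i"
    unfolding rep_hom_def
  proof (intro conjI ballI)
    fix x assume x: "x \<in> verts G"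
    show "linear_between (rep_space N x) (rep_space M x) (?i x)"
      using linear_between_inv[OF rep_hom_linear[OF \<phi> x] is_rep_subspace[OF M x] bij[OF x]] .
  next
    fix e n assume e: "e \<in> arcs G" and n: "n \<in> rep_space N (tail G e)"
    have vs: "tail G e \<in> verts G" "head G e \<in> verts G" using lq e by (auto simp: loopless_quiver_def)
    obtain m where m: "m \<in> rep_space M (tail G e)" "n = \<phi> (tail G e) m"
      using bij[OF vs(1)] n unfolding bij_betw_def by blast
    have "rep_map N e n = \<phi> (head G e) (rep_map M e m)"
      using rep_hom_commutes[OF \<phi> e m(1)] m(2) by simp
    moreover have "rep_map M e m \<in> rep_space M (head G e)"
      using linear_betweenD(1)[OF is_rep_map[OF M e] m(1)] .
    ultimately show "?i (head G e) (rep_map N e n) = rep_map M e (?i (tail G e) n)"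
      using inv vs m by simp
  qed
  moreover have "bij_betw (?i x) (rep_space N x) (rep_space M x)" if "x \<in> verts G" for x
    using bij_betw_the_inv_into[OF bij[OF that]] .
  ultimately show ?thesis by (simp add: rep_iso_def)
qed

lemma rep_iso_nonzero_hom:
  assumes M: "is_rep G M" "\<not> zero_rep G M" and iso: "rep_iso G M N \<phi>"
  shows "nonzero_hom G M N"
proof -
  have \<phi>: "rep_hom G M N \<phi>" using iso by (simp add: rep_iso_def)
  obtain x where x: "x \<in> verts G" "rep_space M x \<noteq> {0}" using M(2) by (auto simp: zero_rep_def)
  have 0: "0 \<in> rep_space M x" using is_rep_subspace[OF M(1) x(1)] by (rule vec.subspace_0)
  then obtain v where v: "v \<in> rep_space M x" "v \<noteq> 0" using x(2) by blast
  have "inj_on (\<phi> x) (rep_space M x)" using iso x(1) by (auto simp: rep_iso_def bij_betw_def)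
  then have "\<phi> x v \<noteq> \<phi> x 0" using v 0 by (auto dest: inj_onD)
  then have "\<phi> x v \<noteq> 0" using rep_hom_zero[OF \<phi> M(1) x(1)] by simp
  then show ?thesis using \<phi> v x by (auto simp: nonzero_hom_def zero_hom_def)
qed

lemma rep_iso_nonzero_homs:
  assumes lq: "loopless_quiver G" and M: "is_rep G M" "\<not> zero_rep G M" and N: "is_rep G N" and iso: "rep_iso G M N \<phi>"
  shows "nonzero_hom G M N" "nonzero_hom G N M"
proof -
  show 1: "nonzero_hom G M N" by (rule rep_iso_nonzero_hom[OF M iso])
  then have "\<not> zero_rep G N" using zero_rep_target by blast
  then show "nonzero_hom G N M" using rep_iso_nonzero_hom[OF N] rep_iso_inverse[OF lq M(1) iso] by blast
qed

lemma nonzero_after_iso: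
  assumes iso: "rep_iso G L M \<theta>" and "\<not> zero_hom G M \<phi>"
  shows "\<not> zero_hom G L (\<lambda>x. \<phi> x \<circ> \<theta> x)"
proof -
  obtain x v where xv: "x \<in> verts G" "v \<in> rep_space M x" "\<phi> x v \<noteq> 0" using assms(2) by (auto simp: zero_hom_def)
  then obtain u where "u \<in> rep_space L x" "v = \<theta> x u" using iso unfolding rep_iso_def bij_betw_def by blast
  then show ?thesis using xv by (auto simp: zero_hom_def)
qed

section \<open>Inverting the reflection functor\<close>

lemma reflected_in_arcs:
  assumes "loopless_quiver G" "e \<in> in_arcs G x"
  shows "e \<in> arcs (reflect x G)" "tail (reflect x G) e = x" "head (reflect x G) e = tail G e"
  using in_arcsD[OF assms] by (simp_all add: tail_reflect head_reflect)

text \<open>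
  The dual of \<open>incoming\<close>: after the reflection the arrows at \<open>x\<close> start there, and the structure
  maps combine into one map to the sum over the neighbours.
\<close>

definition outgoing ::
    "('v, 'e) pre_digraph \<Rightarrow> 'v \<Rightarrow> ('v, 'e, 'k::field) rep \<Rightarrow> ('e, 'k) vec \<Rightarrow> ('e, 'k) vec" where
  "outgoing G x V v = tuple (in_arcs G x) (\<lambda>e. rep_map V e v)"

lemma linear_outgoing:
  assumes lq: "loopless_quiver G" and V: "is_rep (reflect x G) V"
  shows "linear_between (rep_space V x) (neighbour_sum G x V) (outgoing G x V)"
  unfolding outgoing_def
proof (rule linear_tuple)
  fix e assume e: "e \<in> in_arcs G x"
  show "linear_between (rep_space V x) (rep_space V (tail G e)) (rep_map V e)"
    using is_rep_map[OF V, of e] reflected_in_arcs[OF lq e] by simp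
qed

text \<open>
  The kernel of \<open>outgoing\<close> is a direct summand of \<open>V\<close> concentrated at the source \<open>x\<close>, so if it
  is nonzero it is all of \<open>V\<close>. But elements of a reflected module at \<open>x\<close> are determined by their
  components, so every morphism to such a module vanishes on the kernel.
\<close>

lemma outgoing_injective:
  assumes lq: "loopless_quiver G" and s: "sink G x" and V: "indecomposable (reflect x G) V"
    and hom: "nonzero_hom (reflect x G) V (reflect_rep G x N)"
  shows "inj_on (outgoing G x V) (rep_space V x)"
proof -
  let ?G = "reflect x G" and ?N = "reflect_rep G x N"
  have x: "x \<in> verts G" using s by (simp add: sink_iff)
  note rep = indecomposableD(1)[OF V]
  have sub: "vec.subspace (rep_space V z)" if "z \<in> verts G" for z using is_rep_subspace[OF rep, of z] that by simp
  obtain \<psi> where \<psi>: "rep_hom ?G V ?N \<psi>" and nz: "\<not> zero_hom ?G V \<psi>" using hom by (auto simp: nonzero_hom_def)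
  note lin = linear_outgoing[OF lq rep]
  define K where "K = {v \<in> rep_space V x. outgoing G x V v = 0}"
  have K: "vec.subspace K" "K \<subseteq> rep_space V x"
    unfolding K_def using subspace_kernel_between[OF lin sub[OF x]] by auto
  have map0: "rep_map V e v = 0" if v: "v \<in> K" and e: "e \<in> in_arcs G x" for e v
  proof -
    have "component e (outgoing G x V v) = 0" using v by (simp add: K_def)
    then show ?thesis using e by (simp add: outgoing_def)
  qed
  \<comment> \<open>The components of \<open>\<psi> x v\<close> are the images of the outgoing values of \<open>v\<close>.\<close>
  have \<psi>K: "\<psi> x v = 0" if v: "v \<in> K" for v
  proof (rule direct_sum_eqI)
    have vV: "v \<in> rep_space V x" using v by (simp add: K_def)
    show "\<psi> x v \<in> neighbour_sum G x N"
      using rep_hom_into[OF \<psi>, of x v] vV x by (simp add: rep_space_reflect_rep)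
    show "0 \<in> direct_sum (in_arcs G x) (\<lambda>_. {0})" by (simp add: direct_sum_def)
    fix e assume e: "e \<in> in_arcs G x"
    have "component e (\<psi> x v) = \<psi> (tail G e) (rep_map V e v)"
      using rep_hom_commutes[OF \<psi>, of e v] reflected_in_arcs[OF lq e] vV e by (simp add: rep_map_reflect_rep)
    also have "\<dots> = 0" using map0[OF v e] rep_hom_zero[OF \<psi> rep, of "tail G e"] in_arcsD(4)[OF lq e] by simp
    finally show "component e (\<psi> x v) = component e 0" by simp
  qed
  obtain g where g: "projection_onto K g" using subspace_projection[OF K(1)] by blast
  note compl = projection_complement[OF g sub[OF x] K(2) K(1)]
  let ?C = "{v \<in> rep_space V x. g v = 0}"
  have CK: "?C \<inter> K = {0}" using compl(2) by blast
  have VCK: "rep_space V x = {u + w |u w. u \<in> ?C \<and> w \<in> K}"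
    by (rule trans[OF compl(3) sum_of_sets_commute])
  have "K = {0} \<or> ?C = {0} \<and> (\<forall>z\<in>verts ?G. z \<noteq> x \<longrightarrow> rep_space V z = {0})"
  proof (rule indecomposable_split_at_vertex[OF loopless_reflect[OF lq] V _ compl(1) K(1) CK VCK])
    show "x \<in> verts ?G" using x by simp
  next
    fix e v assume "e \<in> arcs ?G" and h: "head ?G e = x"
    then have "e \<in> arcs G" by simp
    with lq s have "head ?G e \<noteq> x" by (cases rule: sink_arc_cases) auto
    then show "rep_map V e v \<in> ?C" using h by blast
  next
    fix e v assume "e \<in> arcs ?G" and t: "tail ?G e = x" and v: "v \<in> K"
    then have "e \<in> arcs G" by simp
    with lq s have "e \<in> in_arcs G x" using t by (cases rule: sink_arc_cases) auto
    then show "rep_map V e v = 0" by (rule map0[OF v])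
  qed
  then have "K = {0}"
  proof
    assume *: "?C = {0} \<and> (\<forall>z\<in>verts ?G. z \<noteq> x \<longrightarrow> rep_space V z = {0})"
    then have VK: "rep_space V x = K" using compl(3) sum_with_zero(1)[of K] by simp
    have "\<psi> z v = 0" if z: "z \<in> verts G" "v \<in> rep_space V z" for z v
    proof (cases "z = x")
      case True
      then show ?thesis using \<psi>K VK z by simp
    next
      case False
      then have "v = 0" using * z by simp
      then show ?thesis using rep_hom_zero[OF \<psi> rep, of z] z(1) by simp
    qed
    then have "zero_hom ?G V \<psi>" by (simp add: zero_hom_def)
    with nz show ?thesis by blast
  qed
  then have K0: "v = 0" if "v \<in> rep_space V x" "outgoing G x V v = 0" for v
    using that by (auto simp: K_def)
  show ?thesis
  proof (rule inj_onI)
    fix u v assume uv: "u \<in> rep_space V x" "v \<in> rep_space V x" "outgoing G x V u = outgoing G x V v"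
    have "u - v = 0"
      using K0[of "u - v"] linear_between_diff[OF lin sub[OF x] uv(1,2)] uv sub[OF x]
      by (simp add: vec.subspace_diff)
    then show "u = v" by simp
  qed
qed

text \<open>
  The negative reflection functor on objects. At \<open>x\<close> it takes the cokernel of \<open>outgoing\<close>; when
  \<open>g\<close> projects onto the image of \<open>outgoing\<close>, the map \<open>w \<mapsto> w - g w\<close> has that image as its kernel,
  so its range is a copy of the cokernel.
\<close>

definition coreflect_rep ::
    "('v, 'e) pre_digraph \<Rightarrow> 'v \<Rightarrow> (('e, 'k) vec \<Rightarrow> ('e, 'k) vec) \<Rightarrow> ('v, 'e, 'k::field) rep \<Rightarrow> ('v, 'e, 'k) rep" where
  "coreflect_rep G x g V =
     \<lparr> rep_space = (rep_space V)(x := (\<lambda>w. w - g w) ` neighbour_sum G x V),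
       rep_map = (\<lambda>e. if e \<in> in_arcs G x then (\<lambda>v. tuple {e} (\<lambda>_. v) - g (tuple {e} (\<lambda>_. v)))
                      else rep_map V e) \<rparr>"

lemma rep_space_coreflect_rep: "rep_space (coreflect_rep G x g V) z =
    (if z = x then (\<lambda>w. w - g w) ` neighbour_sum G x V else rep_space V z)"
  by (simp add: coreflect_rep_def)

lemma rep_map_coreflect_rep: "rep_map (coreflect_rep G x g V) e =
    (if e \<in> in_arcs G x then (\<lambda>v. tuple {e} (\<lambda>_. v) - g (tuple {e} (\<lambda>_. v))) else rep_map V e)"
  by (simp add: coreflect_rep_def)

lemma neighbour_sum_coreflect_rep:
  assumes "loopless_quiver G"
  shows "neighbour_sum G x (coreflect_rep G x g V) = neighbour_sum G x V"
  using in_arcsD(3)[OF assms] by (intro direct_sum_cong) (metis rep_space_coreflect_rep)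

lemma incoming_coreflect_rep:
  assumes lq: "loopless_quiver G" and g: "projection_onto A g" and w: "w \<in> neighbour_sum G x V"
  shows "incoming G x (coreflect_rep G x g V) w = w - g w"
proof -
  let ?\<pi> = "\<lambda>w. w - g w"
  have "g 0 = 0" using projection_ontoD(2)[OF g, of 0 0] by simp
  then have "sum (?\<pi> \<circ> (\<lambda>e. tuple {e} (\<lambda>_. component e w))) (in_arcs G x)
      = ?\<pi> (\<Sum>e\<in>in_arcs G x. tuple {e} (\<lambda>_. component e w))"
    by (intro sum_comp_morphism) (simp_all only: projection_ontoD(1)[OF g] diff_zero add_diff_add)
  moreover have "incoming G x (coreflect_rep G x g V) w
      = sum (?\<pi> \<circ> (\<lambda>e. tuple {e} (\<lambda>_. component e w))) (in_arcs G x)"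
    unfolding incoming_def by (rule sum.cong) (simp_all add: rep_map_coreflect_rep)
  ultimately show ?thesis using direct_sum_expand[OF finite_in_arcs[OF lq] w] by simp
qed

lemma is_rep_coreflect_rep:
  assumes lq: "loopless_quiver G" and s: "sink G x" and V: "is_rep (reflect x G) V" and g: "projection_onto A g"
  shows "is_rep G (coreflect_rep G x g V)"
  unfolding is_rep_def
proof (intro conjI ballI)
  have fd: "finite_dimensional (rep_space V z)" if "z \<in> verts G" for z using V that by (simp add: is_rep_def)
  fix z assume z: "z \<in> verts G"
  have "finite_dimensional (neighbour_sum G x V)"
    by (rule finite_dimensional_direct_sum[OF finite_in_arcs[OF lq] fd[OF in_arcsD(4)[OF lq]]])
  then have "finite_dimensional ((\<lambda>w. w - g w) ` neighbour_sum G x V)"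
    using projection_ontoD(1,2)[OF g] by (intro finite_dimensional_image) (simp_all add: vec.scale_right_diff_distrib)
  then show "finite_dimensional (rep_space (coreflect_rep G x g V) z)"
    using fd[OF z] by (simp add: rep_space_coreflect_rep)
next
  fix e assume e: "e \<in> arcs G"
  let ?U = "coreflect_rep G x g V"
  show "linear_between (rep_space ?U (tail G e)) (rep_space ?U (head G e)) (rep_map ?U e)"
    using lq s e
  proof (cases rule: sink_arc_cases)
    case incoming
    have 0: "0 \<in> rep_space V (tail G f)" if "f \<in> in_arcs G x" for f
      using is_rep_0[OF V] in_arcsD(4)[OF lq that] by simp
    have "linear_between (rep_space V (tail G e)) ((\<lambda>w. w - g w) ` neighbour_sum G x V)
        (\<lambda>v. tuple {e} (\<lambda>_. v) - g (tuple {e} (\<lambda>_. v)))"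
    proof (rule linear_betweenI)
      fix v assume "v \<in> rep_space V (tail G e)"
      then show "tuple {e} (\<lambda>_. v) - g (tuple {e} (\<lambda>_. v)) \<in> (\<lambda>w. w - g w) ` neighbour_sum G x V"
        using 0 incoming(1) by (intro imageI single_in_direct_sum)
    next
      fix c and v :: "'b list \<Rightarrow> 'c"
      show "tuple {e} (\<lambda>_. vec_scale c v) - g (tuple {e} (\<lambda>_. vec_scale c v))
          = vec_scale c (tuple {e} (\<lambda>_. v) - g (tuple {e} (\<lambda>_. v)))"
        unfolding tuple_scale projection_ontoD(2)[OF g] vec.scale_right_diff_distrib ..
    next
      fix u v :: "'b list \<Rightarrow> 'c"
      show "tuple {e} (\<lambda>_. u + v) - g (tuple {e} (\<lambda>_. u + v))
          = tuple {e} (\<lambda>_. u) - g (tuple {e} (\<lambda>_. u)) + (tuple {e} (\<lambda>_. v) - g (tuple {e} (\<lambda>_. v)))"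
        unfolding tuple_add projection_ontoD(1)[OF g] by (rule add_diff_add)
    qed
    then show ?thesis using incoming by (simp add: rep_space_coreflect_rep rep_map_coreflect_rep)
  next
    case other
    then show ?thesis using is_rep_map[OF V, of e] e by (simp add: rep_space_coreflect_rep rep_map_coreflect_rep)
  qed
qed

lemma generated_at_coreflect_rep:
  assumes "loopless_quiver G" "projection_onto A g"
  shows "generated_at G x (coreflect_rep G x g V)"
proof -
  have "incoming G x (coreflect_rep G x g V) ` neighbour_sum G x V = (\<lambda>w. w - g w) ` neighbour_sum G x V"
    by (rule image_cong[OF refl incoming_coreflect_rep[OF assms]])
  moreover have "rep_space (coreflect_rep G x g V) x = (\<lambda>w. w - g w) ` neighbour_sum G x V"
    by (simp add: rep_space_coreflect_rep)
  ultimately show ?thesis by (simp only: generated_at_def neighbour_sum_coreflect_rep[OF assms(1)])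
qed

text \<open>
  Reflecting the cokernel at \<open>x\<close> returns the kernel of the quotient map, which is the image of
  \<open>outgoing\<close>.
\<close>

lemma reflect_coreflect_iso:
  assumes lq: "loopless_quiver G" and s: "sink G x" and V: "is_rep (reflect x G) V"
    and inj: "inj_on (outgoing G x V) (rep_space V x)"
    and g: "projection_onto (outgoing G x V ` rep_space V x) g"
  shows "rep_iso (reflect x G) V (reflect_rep G x (coreflect_rep G x g V)) ((\<lambda>z v. v)(x := outgoing G x V))"
proof -
  let ?G = "reflect x G" and ?U = "coreflect_rep G x g V"
  let ?F = "reflect_rep G x ?U" and ?\<chi> = "(\<lambda>z v. v)(x := outgoing G x V)"
  have x: "x \<in> verts G" using s by (simp add: sink_iff)
  note lin = linear_outgoing[OF lq V]
  have "w \<in> outgoing G x V ` rep_space V x" if "w = g w" for w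
    using projection_ontoD(3)[OF g, of w] that by simp
  moreover have "w = g w" if "w \<in> outgoing G x V ` rep_space V x" for w
    using projection_ontoD(4)[OF g that] by simp
  moreover have "outgoing G x V ` rep_space V x \<subseteq> neighbour_sum G x V"
    using linear_betweenD(1)[OF lin] by blast
  ultimately have Fx: "rep_space ?F x = outgoing G x V ` rep_space V x"
    using incoming_coreflect_rep[OF lq g, of _ x V]
    by (auto simp: rep_space_reflect_rep neighbour_sum_coreflect_rep[OF lq])
  have Fz: "rep_space ?F z = rep_space V z" if "z \<noteq> x" for z
    using that by (simp add: rep_space_reflect_rep rep_space_coreflect_rep)
  have "rep_hom ?G V ?F ?\<chi>"
    unfolding rep_hom_def
  proof (intro conjI ballI)
    fix z assume "z \<in> verts ?G"
    show "linear_between (rep_space V z) (rep_space ?F z) (?\<chi> z)"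
    proof (cases "z = x")
      case True
      then show ?thesis using linear_betweenD(2,3)[OF lin] Fx by (intro linear_betweenI) simp_all
    next
      case False
      then show ?thesis using Fz by (intro linear_betweenI) simp_all
    qed
  next
    fix e v assume "e \<in> arcs ?G"
    then have e: "e \<in> arcs G" by simp
    show "?\<chi> (head ?G e) (rep_map V e v) = rep_map ?F e (?\<chi> (tail ?G e) v)"
      using lq s e
    proof (cases rule: sink_arc_cases)
      case incoming
      then show ?thesis by (simp add: rep_map_reflect_rep outgoing_def)
    next
      case other
      then show ?thesis by (simp add: rep_map_reflect_rep rep_map_coreflect_rep)
    qed
  qed
  moreover have "bij_betw (?\<chi> z) (rep_space V z) (rep_space ?F z)" for z
    using inj Fx Fz by (cases "z = x") (simp_all add: bij_betw_def)
  ultimately show ?thesis by (simp add: rep_iso_def)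
qed

text \<open>
  A decomposition of the new module restricts to one of \<open>V\<close>: at \<open>x\<close> take the vectors whose tuple
  of outgoing values lies in the given part. These parts span, since the two components of such
  a tuple have opposite images at \<open>x\<close>, which lie in different parts and therefore vanish, so
  that each component comes from \<open>V\<close> at \<open>x\<close> again.
\<close>

lemma indecomposable_coreflect_rep:
  assumes lq: "loopless_quiver G" and s: "sink G x" and V: "indecomposable (reflect x G) V"
    and inj: "inj_on (outgoing G x V) (rep_space V x)"
    and g: "projection_onto (outgoing G x V ` rep_space V x) g"
  shows "indecomposable G (coreflect_rep G x g V)"
proof -
  let ?G = "reflect x G" and ?U = "coreflect_rep G x g V"
  have x: "x \<in> verts G" using s by (simp add: sink_iff)
  note rep = indecomposableD(1)[OF V]
  have sub: "vec.subspace (rep_space V z)" if "z \<in> verts G" for z using is_rep_subspace[OF rep, of z] that by simp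
  note lin = linear_outgoing[OF lq rep]
  note repU = is_rep_coreflect_rep[OF lq s rep g]
  let ?N = "neighbour_sum G x V"
  have linU: "linear_between ?N (rep_space ?U x) (incoming G x ?U)"
    using linear_incoming[OF lq repU x] by (simp only: neighbour_sum_coreflect_rep[OF lq])
  have genU: "rep_space ?U x = incoming G x ?U ` ?N"
    using generated_at_coreflect_rep[OF lq g, of x V]
    by (simp add: generated_at_def neighbour_sum_coreflect_rep[OF lq])
  have ker: "w \<in> outgoing G x V ` rep_space V x" if "w \<in> ?N" "incoming G x ?U w = 0" for w
    using incoming_coreflect_rep[OF lq g that(1)] that(2) projection_ontoD(3)[OF g, of w] by simp
  have out0: "v = 0" if "v \<in> rep_space V x" "outgoing G x V v = 0" for v
    using inj_onD[OF inj, of v 0] linear_between_zero[OF lin] vec.subspace_0[OF sub[OF x]] that by simp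
  have nz: "\<not> zero_rep G ?U"
  proof
    assume z: "zero_rep G ?U"
    have off: "rep_space V z = {0}" if "z \<in> verts G" "z \<noteq> x" for z
      using z that by (auto simp: zero_rep_def rep_space_coreflect_rep split: if_splits)
    have "?N = {0}" using off[OF in_arcsD(4)[OF lq] in_arcsD(3)[OF lq]] by (intro direct_sum_zero)
    then have "rep_space V x \<subseteq> {0}" using out0 linear_betweenD(1)[OF lin] by blast
    then have "rep_space V x = {0}" using vec.subspace_0[OF sub[OF x]] by blast
    with off have "zero_rep ?G V" unfolding zero_rep_def by (metis verts_reflect)
    then show False using indecomposableD(2)[OF V] by blast
  qed
  have split: "(\<forall>z\<in>verts G. A z = {0}) \<or> (\<forall>z\<in>verts G. B z = {0})"
    if A: "subrep G ?U A" and B: "subrep G ?U B"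
      and AB0: "\<And>z. z \<in> verts G \<Longrightarrow> A z \<inter> B z = {0}"
      and AB: "\<And>z. z \<in> verts G \<Longrightarrow> rep_space ?U z = {u + w |u w. u \<in> A z \<and> w \<in> B z}" for A B
  proof -
    define S where "S C = direct_sum (in_arcs G x) (\<lambda>e. C (tail G e))" for C :: "'a \<Rightarrow> ('b, 'c) vec set"
    \<comment> \<open>The restriction of a part \<open>C\<close> of the new module to \<open>V\<close>.\<close>
    define res where "res C = C(x := {v \<in> rep_space V x. outgoing G x V v \<in> S C})" for C
    have off: "rep_space V z = {u + w |u w. u \<in> A z \<and> w \<in> B z}" if "z \<in> verts G" "z \<noteq> x" for z
      using AB[of z] that by (simp add: rep_space_coreflect_rep)
    have C_sub: "C z \<subseteq> rep_space V z" if "subrep G ?U C" "z \<in> verts G" "z \<noteq> x" for C z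
      using subrepD(2)[OF that(1,2)] that(3) by (auto simp: rep_space_coreflect_rep)
    have S_sub: "S C \<subseteq> ?N" if "subrep G ?U C" for C
      unfolding S_def using C_sub[OF that in_arcsD(4)[OF lq] in_arcsD(3)[OF lq]] by (intro direct_sum_mono)
    have S_subspace: "vec.subspace (S C)" if "subrep G ?U C" for C
      unfolding S_def using subrepD(1)[OF that in_arcsD(4)[OF lq]] by (intro subspace_direct_sum)
    have inc_S: "incoming G x ?U w \<in> C x" if C: "subrep G ?U C" and w: "w \<in> S C" for C w
      unfolding incoming_def
    proof (rule vec.subspace_sum[OF subrepD(1)[OF C x]])
      fix e assume e: "e \<in> in_arcs G x"
      show "rep_map ?U e (component e w) \<in> C x"
        using subrepD(3)[OF C in_arcsD(1)[OF lq e]] direct_sum_componentD[OF w[unfolded S_def] e] in_arcsD(2)[OF lq e]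
        by simp
    qed
    have res: "subrep ?G V (res C)" if C: "subrep G ?U C" for C
      unfolding subrep_def
    proof (intro conjI ballI)
      fix z assume "z \<in> verts ?G"
      then have z: "z \<in> verts G" by simp
      have "vec.subspace {v \<in> rep_space V x. outgoing G x V v \<in> S C}"
        using S_subspace[OF C] sub[OF x] linear_betweenD(2,3)[OF lin] linear_between_zero[OF lin]
        unfolding vec.subspace_def by auto
      then show "vec.subspace (res C z)" "res C z \<subseteq> rep_space V z"
        using subrepD(1)[OF C z] C_sub[OF C z] by (auto simp: res_def)
    next
      fix e assume "e \<in> arcs ?G"
      then have e: "e \<in> arcs G" by simp
      show "rep_map V e ` res C (tail ?G e) \<subseteq> res C (head ?G e)"
        using lq s e
      proof (cases rule: sink_arc_cases)
        case incoming
        have "rep_map V e v \<in> C (tail G e)" if "outgoing G x V v \<in> S C" for v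
          using direct_sum_componentD[OF that[unfolded S_def] incoming(1)] incoming(1) by (simp add: outgoing_def)
        then show ?thesis using incoming by (auto simp: res_def)
      next
        case other
        then show ?thesis
          using subrepD(3)[OF C e] by (auto simp: res_def rep_map_coreflect_rep)
      qed
    qed
    have SAB0: "w = 0" if "w \<in> S A" "w \<in> S B" for w
      using that unfolding S_def by (rule direct_sum_inter_zero) (rule AB0[OF in_arcsD(4)[OF lq]])
    have SAB: "\<exists>a b. w = a + b \<and> a \<in> S A \<and> b \<in> S B" if "w \<in> ?N" for w
    proof -
      have "rep_space V (tail G e) = {u + w |u w. u \<in> A (tail G e) \<and> w \<in> B (tail G e)}"
        if "e \<in> in_arcs G x" for e
        using off[OF in_arcsD(4)[OF lq that] in_arcsD(3)[OF lq that]] .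
      from direct_sum_of_sums[OF that this] show ?thesis unfolding S_def by blast
    qed
    have inter: "res A z \<inter> res B z = {0}" if "z \<in> verts ?G" for z
    proof (cases "z = x")
      case True
      have "v = 0" if "v \<in> res A x" "v \<in> res B x" for v
        using that out0 SAB0[of "outgoing G x V v"] by (simp add: res_def)
      moreover have "0 \<in> res A x" "0 \<in> res B x"
        using vec.subspace_0[OF subrepD(1)[OF res[OF A]]] vec.subspace_0[OF subrepD(1)[OF res[OF B]]] x by simp_all
      ultimately show ?thesis using True by blast
    next
      case False
      then show ?thesis using AB0 that by (simp add: res_def)
    qed
    have span: "rep_space V z = {u + w |u w. u \<in> res A z \<and> w \<in> res B z}" if "z \<in> verts ?G" for z
    proof (cases "z = x")
      case False
      then show ?thesis using off that by (simp add: res_def)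
    next
      case True
      have "\<exists>u w. v = u + w \<and> u \<in> res A x \<and> w \<in> res B x" if v: "v \<in> rep_space V x" for v
      proof -
        let ?w = "outgoing G x V v"
        have wN: "?w \<in> ?N" using linear_betweenD(1)[OF lin v] .
        obtain a b where ab: "?w = a + b" "a \<in> S A" "b \<in> S B" using SAB[OF wN] by blast
        have mem: "a \<in> ?N" "b \<in> ?N" using ab S_sub[OF A] S_sub[OF B] by auto
        have "incoming G x ?U ?w = 0"
          using incoming_coreflect_rep[OF lq g wN] projection_ontoD(4)[OF g, of ?w] v by simp
        then have sum0: "incoming G x ?U a + incoming G x ?U b = 0"
          using linear_betweenD(2)[OF linU mem] ab(1) by simp
        then have "incoming G x ?U a = - incoming G x ?U b" by (simp add: eq_neg_iff_add_eq_0)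
        then have "incoming G x ?U a \<in> A x \<inter> B x"
          using inc_S[OF A ab(2)] inc_S[OF B ab(3)] subrepD(1)[OF B x] by (simp add: vec.subspace_neg)
        then have a0: "incoming G x ?U a = 0" using AB0[OF x] by simp
        then have b0: "incoming G x ?U b = 0" using sum0 by simp
        obtain u where u: "u \<in> rep_space V x" "a = outgoing G x V u" using ker[OF mem(1) a0] by blast
        obtain u' where u': "u' \<in> rep_space V x" "b = outgoing G x V u'" using ker[OF mem(2) b0] by blast
        have "outgoing G x V v = outgoing G x V (u + u')"
          using ab(1) u(2) u'(2) linear_betweenD(2)[OF lin u(1) u'(1)] by simp
        moreover have "u + u' \<in> rep_space V x" using vec.subspace_add[OF sub[OF x] u(1) u'(1)] .
        ultimately have "v = u + u'" using inj_onD[OF inj _ v] by blast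
        moreover have "u \<in> res A x" "u' \<in> res B x" using u u' ab by (simp_all add: res_def)
        ultimately show ?thesis by blast
      qed
      moreover have "u + w \<in> rep_space V x" if "u \<in> res A x" "w \<in> res B x" for u w
        using that vec.subspace_add[OF sub[OF x]] by (simp add: res_def)
      ultimately show ?thesis using True by blast
    qed
    have zero: "\<forall>z\<in>verts G. C z = {0}"
      if C: "subrep G ?U C" and D: "subrep G ?U D" and CD0: "C x \<inter> D x = {0}"
        and CD: "\<And>w. w \<in> ?N \<Longrightarrow> \<exists>a b. w = a + b \<and> a \<in> S C \<and> b \<in> S D"
        and z: "\<forall>z\<in>verts ?G. res C z = {0}" for C D
    proof -
      have off0: "C z = {0}" if "z \<in> verts G" "z \<noteq> x" for z
        using z[rule_format, of z] that by (simp add: res_def)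
      then have SC: "S C = {0}"
        unfolding S_def using in_arcsD(3,4)[OF lq] by (intro direct_sum_zero) blast
      have "rep_space ?U x \<subseteq> D x"
      proof
        fix v assume "v \<in> rep_space ?U x"
        then obtain w where w: "w \<in> ?N" "v = incoming G x ?U w" using genU by blast
        then have "w \<in> S D" using CD[OF w(1)] SC by auto
        then show "v \<in> D x" using inc_S[OF D] w(2) by simp
      qed
      then have "C x \<subseteq> {0}" using subrepD(2)[OF C x] CD0 by blast
      then have "C x = {0}" using vec.subspace_0[OF subrepD(1)[OF C x]] by blast
      with off0 show ?thesis by metis
    qed
    have "(\<forall>z\<in>verts ?G. res A z = {0}) \<or> (\<forall>z\<in>verts ?G. res B z = {0})"
      by (rule indecomposable_split[OF V res[OF A] res[OF B] inter span])
    then show ?thesis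
    proof
      assume "\<forall>z\<in>verts ?G. res A z = {0}"
      then show ?thesis using zero[OF A B AB0[OF x] SAB] by blast
    next
      assume *: "\<forall>z\<in>verts ?G. res B z = {0}"
      have "\<exists>a b. w = a + b \<and> a \<in> S B \<and> b \<in> S A" if "w \<in> ?N" for w
        using SAB[OF that] by (metis add.commute)
      moreover have "B x \<inter> A x = {0}" using AB0[OF x] by blast
      ultimately show ?thesis using zero[OF B A _ _ *] by blast
    qed
  qed
  show ?thesis by (rule indecomposableI[OF repU nz split])
qed

text \<open>
  The functor reaches every indecomposable module that maps nontrivially to a reflected one, and
  the morphism can be lifted along with the module.
\<close>

lemma lift_along_reflection:
  assumes lq: "loopless_quiver G" and s: "sink G x" and N: "is_rep G N"
    and V: "indecomposable (reflect x G) V"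
    and hom: "nonzero_hom (reflect x G) V (reflect_rep G x N)"
  shows "\<exists>U. indecomposable G U \<and> nonzero_hom G U N \<and> indecomposable (reflect x G) (reflect_rep G x U) \<and>
    nonzero_hom (reflect x G) V (reflect_rep G x U) \<and> nonzero_hom (reflect x G) (reflect_rep G x U) V"
proof -
  let ?G = "reflect x G"
  have x: "x \<in> verts G" using s by (simp add: sink_iff)
  note rep = indecomposableD[OF V]
  have inj: "inj_on (outgoing G x V) (rep_space V x)" by (rule outgoing_injective[OF lq s V hom])
  have "vec.subspace (rep_space V x)" using is_rep_subspace[OF rep(1), of x] x by simp
  then have "vec.subspace (outgoing G x V ` rep_space V x)"
    using subspace_image_between[OF linear_outgoing[OF lq rep(1)]] by blast
  then obtain g where g: "projection_onto (outgoing G x V ` rep_space V x) g"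
    using subspace_projection by blast
  let ?U = "coreflect_rep G x g V"
  have U: "indecomposable G ?U" by (rule indecomposable_coreflect_rep[OF lq s V inj g])
  note repU = indecomposableD(1)[OF U]
  note iso = reflect_coreflect_iso[OF lq s rep(1) inj g]
  note lq' = loopless_reflect[OF lq, of x]
  note repFU = is_rep_reflect_rep[OF lq s repU]
  note homs = rep_iso_nonzero_homs[OF lq' rep repFU iso]
  have ind: "indecomposable ?G (reflect_rep G x ?U)"
    using indecomposable_reflect_rep[OF lq s U] zero_rep_target homs(1) by blast
  obtain \<phi> where \<phi>: "rep_hom ?G V (reflect_rep G x N) \<phi>" "\<not> zero_hom ?G V \<phi>"
    using hom by (auto simp: nonzero_hom_def)
  obtain \<chi> where \<chi>: "rep_iso ?G (reflect_rep G x ?U) V \<chi>" using rep_iso_inverse[OF lq' rep(1) iso] by blast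
  have "nonzero_hom ?G (reflect_rep G x ?U) (reflect_rep G x N)"
    unfolding nonzero_hom_def
  proof (intro exI conjI)
    show "rep_hom ?G (reflect_rep G x ?U) (reflect_rep G x N) (\<lambda>z. \<phi> z \<circ> \<chi> z)"
      using rep_hom_compose[OF lq' _ \<phi>(1)] \<chi> by (simp add: rep_iso_def)
    show "\<not> zero_hom ?G (reflect_rep G x ?U) (\<lambda>z. \<phi> z \<circ> \<chi> z)" by (rule nonzero_after_iso[OF \<chi> \<phi>(2)])
  qed
  then have "nonzero_hom G ?U N"
    by (rule unreflect_nonzero_hom[OF lq s repU N generated_at_coreflect_rep[OF lq g]])
  then show ?thesis using U ind homs by blast
qed

section \<open>Reflections along an admissible sequence\<close>

lemma reflect_rep_seq_append:
  "reflect_rep_seq G (S @ T) M = reflect_rep_seq (fold reflect S G) T (reflect_rep_seq G S M)"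
  by (induction S arbitrary: G M) simp_all

lemma in_arcs_reflect_nonadjacent:
  assumes "\<not> adjacent G x y" "x \<noteq> y"
  shows "in_arcs (reflect x G) y = in_arcs G y" "e \<in> in_arcs G y \<Longrightarrow> tail (reflect x G) e = tail G e"
    "e \<in> in_arcs G y \<Longrightarrow> tail G e \<noteq> x" "e \<in> in_arcs G y \<Longrightarrow> e \<notin> in_arcs G x"
  using assms by (auto simp: in_arcs_def adjacent_iff head_reflect tail_reflect)

text \<open>
  The right-hand side is symmetric in \<open>x\<close> and \<open>y\<close>, so the two reflections commute on the nose,
  not merely up to isomorphism.
\<close>

lemma reflect_rep_nonadjacent:
  assumes "\<not> adjacent G x y" "x \<noteq> y"
  shows "reflect_rep (reflect x G) y (reflect_rep G x M) =
    \<lparr> rep_space = (rep_space M)(x := rep_space (reflect_rep G x M) x, y := rep_space (reflect_rep G y M) y),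
      rep_map = (\<lambda>e. if e \<in> in_arcs G x \<union> in_arcs G y then component e else rep_map M e) \<rparr>"
proof -
  note A = in_arcs_reflect_nonadjacent[OF assms]
  have "direct_sum (in_arcs G y) (\<lambda>e. rep_space (reflect_rep G x M) (tail (reflect x G) e)) = neighbour_sum G y M"
    using A(2,3) by (intro direct_sum_cong) (simp add: rep_space_reflect_rep del: in_in_arcs_conv)
  moreover have "incoming (reflect x G) y (reflect_rep G x M) w = incoming G y M w" for w
    unfolding incoming_def A(1) using A(4) by (intro sum.cong) (simp_all add: rep_map_reflect_rep del: in_in_arcs_conv)
  ultimately have "rep_space (reflect_rep (reflect x G) y (reflect_rep G x M)) y = rep_space (reflect_rep G y M) y"
    by (simp add: rep_space_reflect_rep A(1))
  then have "rep_space (reflect_rep (reflect x G) y (reflect_rep G x M)) z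
      = ((rep_space M)(x := rep_space (reflect_rep G x M) x, y := rep_space (reflect_rep G y M) y)) z" for z
    using assms(2) by (cases "z = y") (simp_all add: rep_space_reflect_rep)
  moreover have "rep_map (reflect_rep (reflect x G) y (reflect_rep G x M)) e
      = (if e \<in> in_arcs G x \<union> in_arcs G y then component e else rep_map M e)" for e
    by (simp add: rep_map_reflect_rep A(1))
  ultimately show ?thesis by (intro rep.equality) auto
qed

lemma reflect_rep_commute:
  assumes "\<not> adjacent G x y"
  shows "reflect_rep (reflect x G) y (reflect_rep G x M) = reflect_rep (reflect y G) x (reflect_rep G y M)"
proof (cases "x = y")
  case False
  have n: "\<not> adjacent G y x" using assms by (simp add: adjacent_commute[of G y])
  show ?thesis
    unfolding reflect_rep_nonadjacent[OF assms False] reflect_rep_nonadjacent[OF n False[symmetric]]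
      fun_upd_twist[OF False, of "rep_space M"] Un_commute[of "in_arcs G x"] ..
qed simp

lemma interchange_reflect_rep_seq:
  assumes "interchange G S T"
  shows "fold reflect S G = fold reflect T G" "reflect_rep_seq G S M = reflect_rep_seq G T M"
proof -
  obtain A x y B where ST: "S = A @ [x, y] @ B" "T = A @ [y, x] @ B" and n: "\<not> adjacent G x y"
    using assms by (auto simp: interchange_def)
  have n': "\<not> adjacent (fold reflect A G) x y" using n by simp
  show "fold reflect S G = fold reflect T G"
    by (simp add: ST reflect_commute[of x y])
  show "reflect_rep_seq G S M = reflect_rep_seq G T M"
    unfolding ST reflect_rep_seq_append by (simp add: reflect_commute[of x y] reflect_rep_commute[OF n'])
qed

lemma reflect_rep_seq_cong_mset:
  assumes "loopless_quiver G" "admissible G S" "admissible G T" "mset S = mset T"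
  shows "fold reflect S G = fold reflect T G \<and> reflect_rep_seq G S M = reflect_rep_seq G T M"
  using equal_mset_imp_equivclp[OF assms]
proof (induction rule: equivclp_induct)
  case (step y z)
  have "fold reflect y G = fold reflect z G \<and> reflect_rep_seq G y M = reflect_rep_seq G z M"
    using step.hyps(2) by (metis interchange_reflect_rep_seq)
  then show ?case using step.IH by simp
qed simp

lemma annihilates_cong_mset:
  assumes "loopless_quiver G" "admissible G S" "admissible G T" "mset S = mset T"
  shows "annihilates G S M \<longleftrightarrow> annihilates G T M"
  using reflect_rep_seq_cong_mset[OF assms, of M] assms by (simp add: annihilates_def)

lemma annihilates_append:
  "annihilates G (S @ T) M \<longleftrightarrow> admissible G S \<and> annihilates (fold reflect S G) T (reflect_rep_seq G S M)"
  by (auto simp: annihilates_def admissible_append reflect_rep_seq_append)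

lemma annihilates_Nil: "annihilates G [] M \<longleftrightarrow> zero_rep G M"
  by (simp add: annihilates_def)

lemma annihilates_Cons:
  "annihilates G (x # S) M \<longleftrightarrow> sink G x \<and> annihilates (reflect x G) S (reflect_rep G x M)"
  by (auto simp: annihilates_def)

lemma is_rep_reflect_rep_seq:
  "loopless_quiver G \<Longrightarrow> admissible G S \<Longrightarrow> is_rep G M \<Longrightarrow> is_rep (fold reflect S G) (reflect_rep_seq G S M)"
  by (induction S arbitrary: G M) (simp_all add: loopless_reflect is_rep_reflect_rep)

lemma zero_rep_reflect_rep:
  "loopless_quiver G \<Longrightarrow> sink G x \<Longrightarrow> is_rep G M \<Longrightarrow> zero_rep G M \<Longrightarrow> zero_rep (reflect x G) (reflect_rep G x M)"
  by (rule zero_rep_reflect_concentrated) (simp_all add: zero_rep_def)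

lemma zero_rep_annihilates:
  "loopless_quiver G \<Longrightarrow> admissible G S \<Longrightarrow> is_rep G M \<Longrightarrow> zero_rep G M \<Longrightarrow> annihilates G S M"
  by (induction S arbitrary: G M)
    (simp_all add: annihilates_Nil annihilates_Cons loopless_reflect is_rep_reflect_rep zero_rep_reflect_rep)

lemma annihilates_mono:
  assumes G: "acyclic_quiver G" and M: "is_rep G M" and S: "annihilates G S M"
    and T: "admissible G T" and sub: "mset S \<subseteq># mset T"
  shows "annihilates G T M"
proof -
  have lq: "loopless_quiver G" using G by (simp add: acyclic_quiver_def)
  have admS: "admissible G S" using S by (simp add: annihilates_def)
  obtain U where U: "admissible G (S @ U)" "mset (S @ U) = mset T"
    using extend_to[OF G admS heights_mset[OF lq T] sub] by blast
  have "zero_rep (fold reflect S G) (reflect_rep_seq G S M)" using S by (simp add: annihilates_def)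
  then have "annihilates (fold reflect S G) U (reflect_rep_seq G S M)"
    using U(1) by (intro zero_rep_annihilates loopless_fold_reflect is_rep_reflect_rep_seq lq admS M)
      (auto simp: admissible_append)
  then have "annihilates G (S @ U) M" using admS by (simp add: annihilates_append)
  then show ?thesis using annihilates_cong_mset[OF lq U(1) T U(2), of M] by blast
qed

lemma indecomposable_reflect_rep_seq:
  assumes "loopless_quiver G" "admissible G S" "indecomposable G M" "\<not> annihilates G S M"
  shows "indecomposable (fold reflect S G) (reflect_rep_seq G S M)"
  using assms
proof (induction S arbitrary: G M)
  case (Cons x S)
  have s: "sink G x" and S: "admissible (reflect x G) S" using Cons.prems by simp_all
  note lq' = loopless_reflect[OF Cons.prems(1), of x]
  have rep: "is_rep (reflect x G) (reflect_rep G x M)"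
    by (rule is_rep_reflect_rep[OF Cons.prems(1) s indecomposableD(1)[OF Cons.prems(3)]])
  have na: "\<not> annihilates (reflect x G) S (reflect_rep G x M)" using Cons.prems s by (simp add: annihilates_Cons)
  then have "\<not> zero_rep (reflect x G) (reflect_rep G x M)"
    using zero_rep_annihilates[OF lq' S rep] by blast
  then have "indecomposable (reflect x G) (reflect_rep G x M)"
    by (rule indecomposable_reflect_rep[OF Cons.prems(1) s Cons.prems(3)])
  then show ?case using Cons.IH[OF lq' S _ na] by simp
qed simp

text \<open>
  As long as the source survives, the reflected morphism stays nonzero, and then its target
  survives too.
\<close>

lemma nonzero_hom_annihilates:
  assumes "loopless_quiver G" "indecomposable G M" "indecomposable G N" "nonzero_hom G M N" "annihilates G S N"
  shows "annihilates G S M"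
  using assms
proof (induction S arbitrary: G M N)
  case Nil
  then show ?case using indecomposableD(2)[OF Nil.prems(3)] by (simp add: annihilates_Nil)
next
  case (Cons x S)
  let ?G = "reflect x G" and ?M = "reflect_rep G x M" and ?N = "reflect_rep G x N"
  note lq = Cons.prems(1) and M = Cons.prems(2) and N = Cons.prems(3)
  have s: "sink G x" and S: "annihilates ?G S ?N" using Cons.prems(5) by (simp_all add: annihilates_Cons)
  note lq' = loopless_reflect[OF lq, of x]
  show ?case
  proof (cases "zero_rep ?G ?M")
    case True
    have "admissible ?G S" using S by (simp add: annihilates_def)
    then have "annihilates ?G S ?M"
      using zero_rep_annihilates[OF lq' _ is_rep_reflect_rep[OF lq s indecomposableD(1)[OF M]] True] by blast
    then show ?thesis using s by (simp add: annihilates_Cons)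
  next
    case False
    have hom: "nonzero_hom ?G ?M ?N"
      by (rule reflect_nonzero_hom[OF lq s indecomposableD(1)[OF M] indecomposableD(1)[OF N]
            indecomposable_generated_at[OF lq s M False] Cons.prems(4)])
    then have "\<not> zero_rep ?G ?N" using zero_rep_target by blast
    then have "indecomposable ?G ?N" by (rule indecomposable_reflect_rep[OF lq s N])
    then have "annihilates ?G S ?M"
      using Cons.IH[OF lq' indecomposable_reflect_rep[OF lq s M False] _ hom S] by blast
    then show ?thesis using s by (simp add: annihilates_Cons)
  qed
qed

lemma unreflect_nonzero_hom_seq:
  assumes "loopless_quiver G" "admissible G A" "indecomposable G M" "is_rep G N" "\<not> annihilates G A M"
    "nonzero_hom (fold reflect A G) (reflect_rep_seq G A M) (reflect_rep_seq G A N)"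
  shows "nonzero_hom G M N"
  using assms
proof (induction A arbitrary: G M N)
  case (Cons x A)
  let ?G = "reflect x G" and ?M = "reflect_rep G x M" and ?N = "reflect_rep G x N"
  note lq = Cons.prems(1) and M = Cons.prems(3) and N = Cons.prems(4)
  have s: "sink G x" and A: "admissible ?G A" using Cons.prems(2) by simp_all
  note lq' = loopless_reflect[OF lq, of x]
  have na: "\<not> annihilates ?G A ?M" using Cons.prems(5) s by (simp add: annihilates_Cons)
  have nz: "\<not> zero_rep ?G ?M"
    using na zero_rep_annihilates[OF lq' A is_rep_reflect_rep[OF lq s indecomposableD(1)[OF M]]] by blast
  have "nonzero_hom ?G ?M ?N"
    using Cons.IH[OF lq' A indecomposable_reflect_rep[OF lq s M nz] is_rep_reflect_rep[OF lq s N] na]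
      Cons.prems(6) by simp
  then show ?case
    by (rule unreflect_nonzero_hom[OF lq s indecomposableD(1)[OF M] N indecomposable_generated_at[OF lq s M nz]])
qed simp

text \<open>
  Each step of the lifting recovers the given module only up to isomorphism. That is enough to
  keep track of annihilating sequences, because an isomorphism is a nonzero morphism in both
  directions.
\<close>

lemma lift_along_reflections:
  assumes "loopless_quiver G" "admissible G C" "is_rep G N" "indecomposable (fold reflect C G) V"
    "nonzero_hom (fold reflect C G) V (reflect_rep_seq G C N)"
  shows "\<exists>X. indecomposable G X \<and> nonzero_hom G X N \<and>
    (\<forall>D. annihilates G (C @ D) X \<longleftrightarrow> annihilates (fold reflect C G) D V)"
  using assms
proof (induction C arbitrary: G N)
  case (Cons x C)
  let ?G = "reflect x G" and ?N = "reflect_rep G x N"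
  note lq = Cons.prems(1)
  have s: "sink G x" and C: "admissible ?G C" using Cons.prems(2) by simp_all
  note lq' = loopless_reflect[OF lq, of x]
  obtain W where W: "indecomposable ?G W" "nonzero_hom ?G W ?N"
      and ann: "\<And>D. annihilates ?G (C @ D) W \<longleftrightarrow> annihilates (fold reflect C ?G) D V"
    using Cons.IH[OF lq' C is_rep_reflect_rep[OF lq s Cons.prems(3)]] Cons.prems(4,5) by auto
  obtain X where X: "indecomposable G X" "nonzero_hom G X N" "indecomposable ?G (reflect_rep G x X)"
      "nonzero_hom ?G W (reflect_rep G x X)" "nonzero_hom ?G (reflect_rep G x X) W"
    using lift_along_reflection[OF lq s Cons.prems(3) W] by blast
  have "annihilates ?G T (reflect_rep G x X) \<longleftrightarrow> annihilates ?G T W" for T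
    using nonzero_hom_annihilates[OF lq' W(1) X(3,4)] nonzero_hom_annihilates[OF lq' X(3) W(1) X(5)] by blast
  then have "annihilates G ((x # C) @ D) X \<longleftrightarrow> annihilates (fold reflect (x # C) G) D V" for D
    using ann[of D] s by (simp add: annihilates_Cons)
  then show ?case using X(1,2) by blast
qed auto

lemma rep_space_reflect_rep_seq:
  "z \<notin> set S \<Longrightarrow> rep_space (reflect_rep_seq G S M) z = rep_space M z"
  by (induction S arbitrary: G M) (simp_all add: rep_space_reflect_rep)

section \<open>Shortest annihilating sequences\<close>

lemma annihilates_supported:
  assumes "annihilates G S M" "z \<in> verts G" "z \<notin> set S"
  shows "rep_space M z = {0}"
  using assms rep_space_reflect_rep_seq[of z S G M] by (simp add: annihilates_def zero_rep_def)

text \<open>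
  Let \<open>R\<close> be the meet of \<open>S\<close> and \<open>T\<close>. What remains of \<open>S\<close> and of \<open>T\<close> after \<open>R\<close> has no vertex in
  common, and a sequence changes the spaces only at its own vertices. So the reflection of \<open>M\<close>
  along \<open>R\<close> is zero at every vertex, and \<open>R\<close> annihilates \<open>M\<close>.
\<close>

lemma shortest_is_least:
  assumes G: "acyclic_quiver G" and M: "is_rep G M"
    and S: "shortest_annihilating G S M" and T: "annihilates G T M"
  shows "mset S \<subseteq># mset T"
proof -
  have lq: "loopless_quiver G" using G by (simp add: acyclic_quiver_def)
  have annS: "annihilates G S M" using S by (simp add: shortest_annihilating_def)
  have adm: "admissible G S" "admissible G T" using annS T by (simp_all add: annihilates_def)
  let ?m = "mset S \<inter># mset T"
  obtain R where R: "admissible G R" "mset R = ?m"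
    using realize[OF G heights_inter[OF heights_mset[OF lq adm(1)] heights_mset[OF lq adm(2)]]] by blast
  obtain S1 where S1: "admissible G (R @ S1)" "mset (R @ S1) = mset S"
    using extend_to[OF G R(1) heights_mset[OF lq adm(1)]] R(2) by auto
  obtain T1 where T1: "admissible G (R @ T1)" "mset (R @ T1) = mset T"
    using extend_to[OF G R(1) heights_mset[OF lq adm(2)]] R(2) by auto
  have disj: "z \<notin> set S1 \<or> z \<notin> set T1" for z
  proof -
    have "count (mset S) z = min (count (mset S) z) (count (mset T) z) + count (mset S1) z"
      "count (mset T) z = min (count (mset S) z) (count (mset T) z) + count (mset T1) z"
      using arg_cong[OF S1(2), of "\<lambda>m. count m z"] arg_cong[OF T1(2), of "\<lambda>m. count m z"] R(2) by auto
    then have "count (mset S1) z = 0 \<or> count (mset T1) z = 0" by linarith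
    then show ?thesis by (metis count_mset_0_iff)
  qed
  have "annihilates G (R @ S1) M" "annihilates G (R @ T1) M"
    using annihilates_cong_mset[OF lq S1(1) adm(1) S1(2), of M]
      annihilates_cong_mset[OF lq T1(1) adm(2) T1(2), of M] annS T by blast+
  then have "annihilates (fold reflect R G) S1 (reflect_rep_seq G R M)"
    "annihilates (fold reflect R G) T1 (reflect_rep_seq G R M)" by (simp_all add: annihilates_append)
  note zero = this[THEN annihilates_supported]
  have "rep_space (reflect_rep_seq G R M) z = {0}" if z: "z \<in> verts (fold reflect R G)" for z
    using disj[of z] zero[OF z] by blast
  then have "zero_rep (fold reflect R G) (reflect_rep_seq G R M)"
    by (simp add: zero_rep_def)
  then have "annihilates G R M" using R(1) by (simp add: annihilates_def)
  moreover have "seq_le G R S" using R adm by (simp add: seq_le_iff[OF G])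
  ultimately have "seq_equiv G R S" using S by (auto simp: shortest_annihilating_def)
  then have "mset R = mset S" by (rule seq_equiv_mset)
  then show ?thesis using R(2) by (metis subset_mset.inf.cobounded2)
qed

lemma shortest_annihilating_exists:
  assumes G: "acyclic_quiver G" and T: "annihilates G T M"
  shows "\<exists>S. shortest_annihilating G S M"
proof -
  obtain S where S: "annihilates G S M" and min: "\<And>R. annihilates G R M \<Longrightarrow> length S \<le> length R"
    using arg_min_nat_lemma[of "\<lambda>S. annihilates G S M" T length] T by metis
  have "\<not> annihilates G R M" if "seq_le G R S" "\<not> seq_equiv G R S" for R
  proof
    assume R: "annihilates G R M"
    have lq: "loopless_quiver G" using G by (simp add: acyclic_quiver_def)
    have "mset R \<subset># mset S"
      using that by (auto simp: seq_le_iff[OF G] seq_equiv_iff[OF lq] subset_mset.less_le)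
    then have "size (mset R) < size (mset S)" by (rule mset_subset_size)
    then show False using min[OF R] by simp
  qed
  then show ?thesis using S by (auto simp: shortest_annihilating_def)
qed

lemma proper_not_annihilates:
  assumes G: "acyclic_quiver G" and M: "is_rep G M" and S: "shortest_annihilating G S M"
    and T: "mset T \<subset># mset S"
  shows "\<not> annihilates G T M"
  using shortest_is_least[OF G M S, of T] T subset_mset.less_le_not_le by blast

text \<open>
  The vertices that can be moved to the end of a sequence with multiplicities \<open>m\<close>. In the order
  of all occurrences of vertices these are the ones whose last occurrence is maximal.
\<close>

definition peak :: "('v, 'e) pre_digraph \<Rightarrow> 'v multiset \<Rightarrow> 'v \<Rightarrow> bool" where
  "peak G m x \<longleftrightarrow> x \<in># m \<and> heights G (m - {#x#})"

lemma peak_last: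
  assumes "loopless_quiver G" "admissible G (A @ [x])" "mset (A @ [x]) = m"
  shows "peak G m x"
proof -
  have "admissible G A" using assms(2) by (simp add: admissible_append)
  moreover have "m - {#x#} = mset A" "x \<in># m" using assms(3) by auto
  ultimately show ?thesis using heights_mset[OF assms(1)] by (simp add: peak_def)
qed

text \<open>
  Nothing leaves a sink, so the space at \<open>x\<close> splits off from the one at \<open>y\<close>.
\<close>

lemma sinks_support_split:
  assumes lq: "loopless_quiver G" and M: "indecomposable G M" and s: "sink G x" "sink G y" and "x \<noteq> y"
    and off: "\<And>z. z \<in> verts G \<Longrightarrow> z \<noteq> x \<Longrightarrow> z \<noteq> y \<Longrightarrow> rep_space M z = {0}"
  shows "rep_space M x = {0} \<or> rep_space M y = {0}"
proof -
  note rep = indecomposableD(1)[OF M]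
  have v: "x \<in> verts G" "y \<in> verts G" using s by (simp_all add: sink_iff)
  have "rep_space M x = {0} \<or> {0 :: ('b, 'c) vec} = {0} \<and> (\<forall>z\<in>verts G. z \<noteq> x \<longrightarrow> rep_space M z = {0})"
  proof (rule indecomposable_split_at_vertex[OF lq M v(1) vec.subspace_single_0 is_rep_subspace[OF rep v(1)] _ sum_with_zero(2)])
    show "{0} \<inter> rep_space M x = {0}" using is_rep_0[OF rep v(1)] by blast
    fix e u assume e: "e \<in> arcs G"
    have t: "tail G e \<in> verts G" "tail G e \<noteq> x" "tail G e \<noteq> y"
      using lq s e by (auto simp: loopless_quiver_def sink_iff)
    then show "tail G e = x \<Longrightarrow> rep_map M e u = 0" by blast
    assume "u \<in> rep_space M (tail G e)"
    then show "rep_map M e u \<in> {0}" using off[OF t] rep_map_0[OF lq rep e] by simp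
  qed
  then show ?thesis using v(2) \<open>x \<noteq> y\<close> by metis
qed

lemma annihilates_sink_support:
  assumes "annihilates G [x] M"
  shows "\<And>z. z \<in> verts G \<Longrightarrow> z \<noteq> x \<Longrightarrow> rep_space M z = {0}"
  using annihilates_supported[OF assms] by simp

text \<open>
  If \<open>x\<close> and \<open>y\<close> were two peaks, then \<open>S \<sim> C x y\<close> with both \<open>x\<close> and \<open>y\<close> sinks after \<open>C\<close>. The
  module reached after \<open>C\<close> is killed by reflecting at both, so it lives on \<open>{x, y}\<close>; being
  indecomposable it lives on one of them and is killed by that single reflection, against the
  minimality of \<open>S\<close>.
\<close>

lemma shortest_unique_peak:
  assumes G: "acyclic_quiver G" and M: "indecomposable G M" and S: "shortest_annihilating G S M"
    and px: "peak G (mset S) x" and py: "peak G (mset S) y"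
  shows "x = y"
proof (rule ccontr)
  assume ne: "x \<noteq> y"
  have lq: "loopless_quiver G" using G by (simp add: acyclic_quiver_def)
  have annS: "annihilates G S M" and admS: "admissible G S"
    using S by (simp_all add: shortest_annihilating_def annihilates_def)
  note rep = indecomposableD(1)[OF M]
  have xS: "x \<in># mset S" and yS: "y \<in># mset S" and hx: "heights G (mset S - {#x#})" and hy: "heights G (mset S - {#y#})"
    using px py by (simp_all add: peak_def)
  obtain m where mS: "mset S = add_mset x (add_mset y m)"
    using xS yS ne by (metis insert_noteq_member multi_member_split)
  then have mx: "mset S - {#x#} = add_mset y m" and my: "mset S - {#y#} = add_mset x m"
    by (simp_all add: add_mset_commute[of x])
  have "m = add_mset y m \<inter># add_mset x m"
    using ne by (intro multiset_eqI) (auto simp: min_def)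
  then have "heights G m" using heights_inter[OF hx hy] mx my by simp
  then obtain C where C: "admissible G C" "mset C = m" using realize[OF G] by blast
  have step: "admissible G (C @ [z])" if hz: "heights G (add_mset z m)" for z
  proof -
    obtain U where U: "admissible G (C @ U)" "mset (C @ U) = add_mset z m"
      using extend_to[OF G C(1) hz] C(2) by auto
    then have "mset U = {#z#}" using C(2) by simp
    then show ?thesis using U(1) by simp
  qed
  have ax: "admissible G (C @ [x])" and ay: "admissible G (C @ [y])" using step hx hy mx my by simp_all
  have axy: "admissible G (C @ [x] @ [y])"
  proof -
    obtain U where U: "admissible G ((C @ [x]) @ U)" "mset ((C @ [x]) @ U) = mset S"
      using extend_to[OF G ax heights_mset[OF lq admS]] C(2) mS by auto
    then have "mset U = {#y#}" using C(2) mS by simp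
    then show ?thesis using U(1) by simp
  qed
  have "annihilates G (C @ [x] @ [y]) M"
    using annihilates_cong_mset[OF lq axy admS, of M] annS C(2) mS by simp
  then have kxy: "annihilates (fold reflect (C @ [x]) G) [y] (reflect_rep_seq G (C @ [x]) M)"
    using annihilates_append[of G "C @ [x]" "[y]" M] by simp
  have nann: "\<not> annihilates G C M" "\<not> annihilates G (C @ [x]) M" "\<not> annihilates G (C @ [y]) M"
    using C(2) mS by (intro proper_not_annihilates[OF G rep S]; simp add: subset_mset.less_le subseteq_mset_def)+
  let ?G = "fold reflect C G" and ?M = "reflect_rep_seq G C M"
  have ind: "indecomposable ?G ?M" by (rule indecomposable_reflect_rep_seq[OF lq C(1) M nann(1)])
  have sx: "sink ?G x" and sy: "sink ?G y" using ax ay by (simp_all add: admissible_append)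
  have off: "rep_space ?M z = {0}" if "z \<in> verts ?G" "z \<noteq> x" "z \<noteq> y" for z
    using annihilates_sink_support[OF kxy, of z] that
    by (simp add: reflect_rep_seq_append rep_space_reflect_rep)
  have "\<not> annihilates ?G [a] ?M" if "a = x \<or> a = y" for a
    using nann C(1) that by (auto simp: annihilates_append)
  moreover have "annihilates ?G [a] ?M" if b: "rep_space ?M b = {0}" and "a = x \<and> b = y \<or> a = y \<and> b = x" for a b
  proof -
    have sa: "sink ?G a" using sx sy that by auto
    note lqC = loopless_fold_reflect[OF lq, of C]
    have z0: "rep_space ?M z = {0}" if "z \<in> verts ?G" "z \<noteq> a" for z
      using off[OF that(1)] b \<open>a = x \<and> b = y \<or> a = y \<and> b = x\<close> that(2) by metis
    then show ?thesis
      using zero_rep_reflect_concentrated[OF lqC sa indecomposableD(1)[OF ind]] sa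
      by (simp add: annihilates_Cons annihilates_Nil)
  qed
  ultimately show False using sinks_support_split[OF loopless_fold_reflect[OF lq] ind sx sy ne off] by blast
qed

section \<open>Principal sequences\<close>

text \<open>
  Of the vertices with more than \<open>i\<close> occurrences outside \<open>H\<close>, take one that no arrow enters from
  another. Its count is \<open>Suc i\<close>, the vertices with an arrow into it have smaller counts because
  \<open>H\<close> is closed along arrows, and its other neighbours have at most \<open>Suc i\<close> by the condition on
  neighbours; so lowering its count preserves the inequalities.
\<close>

lemma peak_outside_up_closed:
  assumes G: "acyclic_quiver G" and m: "heights G m"
    and H: "\<And>e. e \<in> arcs G \<Longrightarrow> tail G e \<in> H \<Longrightarrow> head G e \<in> H"
    and above: "\<And>z. Suc i < count m z \<Longrightarrow> z \<in> H"
    and nbr: "\<And>z w. Suc i < count m z \<Longrightarrow> adjacent G z w \<Longrightarrow> w \<in> H"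
    and ex: "i < count m z" "z \<notin> H"
  shows "\<exists>p. peak G m p \<and> count m p = Suc i \<and> p \<notin> H"
proof -
  define X where "X = {z. i < count m z \<and> z \<notin> H}"
  have "X \<subseteq> set_mset m" by (auto simp: X_def count_greater_zero_iff[symmetric] simp del: count_greater_zero_iff)
  then have "finite X" by (rule finite_subset) simp
  moreover have "X \<noteq> {}" using ex by (auto simp: X_def)
  ultimately obtain p where p: "p \<in> X" and pmin: "\<And>e. e \<in> arcs G \<Longrightarrow> head G e = p \<Longrightarrow> tail G e \<notin> X"
    using acyclic_extremal[OF G] by metis
  have cp: "count m p = Suc i" "p \<notin> H" using p above[of p] by (force simp: X_def)+
  have lq: "loopless_quiver G" using G by (simp add: acyclic_quiver_def)
  have "heights G (m - {#p#})"
    unfolding heights_def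
  proof (intro conjI ballI)
    show "set_mset (m - {#p#}) \<subseteq> verts G" using m by (auto simp: heights_def dest: in_diffD)
    fix e assume e: "e \<in> arcs G"
    have ne: "tail G e \<noteq> head G e" using lq e by (simp add: loopless_quiver_def)
    have he: "count m (tail G e) \<le> count m (head G e)" "count m (head G e) \<le> Suc (count m (tail G e))"
      using m e by (auto simp: heights_def)
    have t: "count m (tail G e) \<le> i" if h: "head G e = p"
    proof (rule ccontr)
      assume "\<not> ?thesis"
      moreover have "tail G e \<notin> H" using H[OF e] h cp(2) by blast
      ultimately have "tail G e \<in> X" by (simp add: X_def)
      then show False using pmin[OF e h] by blast
    qed
    have hd: "count m (head G e) \<le> Suc i" if t: "tail G e = p"
    proof (rule ccontr)
      assume "\<not> ?thesis"
      moreover have "adjacent G (head G e) p" using e t by (auto simp: adjacent_iff)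
      ultimately show False using nbr[of "head G e" p] cp(2) by auto
    qed
    show "count (m - {#p#}) (tail G e) \<le> count (m - {#p#}) (head G e)"
      using he t cp(1) ne by (cases "head G e = p"; cases "tail G e = p") auto
    show "count (m - {#p#}) (head G e) \<le> Suc (count (m - {#p#}) (tail G e))"
      using he hd cp(1) ne by (cases "head G e = p"; cases "tail G e = p") auto
  qed
  moreover have "p \<in># m" using cp(1) by (metis count_eq_zero_iff nat.distinct(1))
  ultimately show ?thesis using cp by (auto simp: peak_def)
qed

definition truncate :: "'v multiset \<Rightarrow> nat \<Rightarrow> 'v multiset" where
  "truncate m n = m \<inter># repeat_mset n (mset_set (set_mset m))"

lemma count_truncate [simp]: "count (truncate m n) z = min (count m z) n"
  by (cases "z \<in># m") (auto simp: truncate_def not_in_iff)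

lemma heights_truncate: "heights G m \<Longrightarrow> heights G (truncate m n)"
  unfolding heights_def count_truncate by (auto simp: truncate_def)

text \<open>
  Cutting the multiplicities off at \<open>1, \<dots>, n\<close> gives an ascending chain of vectors of heights,
  and the successive differences are sets of vertices. For large \<open>n\<close> this is the canonical form.
\<close>

lemma layered_form:
  assumes G: "acyclic_quiver G" and m: "heights G m"
  shows "\<exists>Ss. length Ss = n \<and> admissible G (concat Ss) \<and> mset (concat Ss) = truncate m n \<and>
    (\<forall>i<n. distinct (Ss ! i) \<and> set (Ss ! i) = {z. i < count m z})"
proof (induction n)
  case 0
  have "truncate m 0 = {#}" by (rule multiset_eqI) simp
  then show ?case by simp
next
  case (Suc n)
  then obtain Ss where Ss: "length Ss = n" "admissible G (concat Ss)" "mset (concat Ss) = truncate m n"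
    "\<forall>i<n. distinct (Ss ! i) \<and> set (Ss ! i) = {z. i < count m z}" by blast
  have "mset (concat Ss) \<subseteq># truncate m (Suc n)" using Ss(3) by (auto simp: subseteq_mset_def)
  then obtain U where U: "admissible G (concat Ss @ U)" "mset (concat Ss @ U) = truncate m (Suc n)"
    using extend_to[OF G Ss(2) heights_truncate[OF m]] by blast
  have cU: "count (mset U) z = (if n < count m z then 1 else 0)" for z
    using arg_cong[OF U(2), of "\<lambda>m. count m z"] arg_cong[OF Ss(3), of "\<lambda>m. count m z"] by auto
  have "distinct U" unfolding distinct_count_atmost_1 using cU by (metis count_mset count_mset_0_iff)
  moreover have "z \<in> set U \<longleftrightarrow> n < count m z" for z using cU[of z] by (metis count_mset_0_iff zero_neq_one)
  ultimately show ?case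
    using Ss U by (intro exI[of _ "Ss @ [U]"]) (auto simp: nth_append less_Suc_eq)
qed

lemma up_closed_heights:
  assumes m: "heights G m"
  shows "up_closed G {z. i < count m z}"
  unfolding up_closed_def
proof (intro conjI ballI allI impI subsetI)
  fix z assume z: "z \<in> {z. i < count m z}"
  then have "z \<in># m" by (auto simp: count_greater_zero_iff[symmetric] simp del: count_greater_zero_iff)
  then show "z \<in> verts G" using m by (auto simp: heights_def)
next
  fix x y assume x: "x \<in> {z. i < count m z}" and r: "x \<rightarrow>\<^sup>*\<^bsub>G\<^esub> y"
  from r have "(x, y) \<in> rtrancl_on (verts G) (arcs_ends G)" by (simp add: reachable_def)
  then show "y \<in> {z. i < count m z}"
  proof (induction rule: rtrancl_on_induct)
    case (step y z)
    then obtain e where "e \<in> arcs G" "tail G e = y" "head G e = z" by (auto simp: arcs_ends_conv)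
    then show ?case using m step.IH unfolding heights_def by force
  qed (use x in auto)
qed

text \<open>
  The supports of the canonical form are the level sets of the multiplicities. Were one of them
  larger than the set demanded by principality, \<open>peak_outside_up_closed\<close> would produce a peak
  outside that set whose multiplicity is the index of the level. But the only peak is \<open>x\<close>, which
  has the highest multiplicity and lies in the set demanded of the highest level.
\<close>

lemma unique_peak_principal:
  assumes G: "acyclic_quiver G" and S: "admissible G S"
    and px: "peak G (mset S) x" and uniq: "\<And>y. peak G (mset S) y \<Longrightarrow> y = x"
  shows "principal G S"
proof -
  have lq: "loopless_quiver G" using G by (simp add: acyclic_quiver_def)
  let ?m = "mset S"
  have m: "heights G ?m" by (rule heights_mset[OF lq S])
  have xv: "x \<in> verts G" using px m by (auto simp: peak_def heights_def)
  have xm: "x \<in># ?m" using px by (simp add: peak_def)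
  define r where "r = Max (count ?m ` set S)"
  have ne: "set S \<noteq> {}" using xm by auto
  have le_r: "count ?m z \<le> r" for z
  proof (cases "z \<in> set S")
    case True
    then show ?thesis unfolding r_def by (intro Max_ge) auto
  next
    case False
    then have "count ?m z = 0" by (metis count_mset_0_iff)
    then show ?thesis by linarith
  qed
  have "r \<in> count ?m ` set S" unfolding r_def using ne by (intro Max_in) auto
  then obtain z0 where z0: "z0 \<in> set S" "count ?m z0 = r" by blast
  then have r0: "0 < r" by (metis count_greater_zero_iff set_mset_mset)
  have wf: "head G e \<in> verts G" if "e \<in> arcs G" for e using lq that by (simp add: loopless_quiver_def)
  \<comment> \<open>The highest level contains a peak, which can only be \<open>x\<close>.\<close>
  have x_top: "count ?m x = r"
  proof -
    have "\<exists>p. peak G ?m p \<and> count ?m p = Suc (r - 1) \<and> p \<notin> {}"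
      using le_r r0 z0 by (intro peak_outside_up_closed[OF G m, where z = z0]) (auto simp: not_less[symmetric])
    then show ?thesis using uniq r0 by auto
  qed
  obtain Ss where Ss: "length Ss = r" "admissible G (concat Ss)" "mset (concat Ss) = truncate ?m r"
    and lev: "\<And>i. i < r \<Longrightarrow> distinct (Ss ! i) \<and> set (Ss ! i) = {z. i < count ?m z}"
    using layered_form[OF G m, of r] by blast
  have "truncate ?m r = ?m" by (rule multiset_eqI) (use le_r in \<open>simp add: min_def\<close>)
  then have eqv: "seq_equiv G S (concat Ss)" using Ss S by (simp add: seq_equiv_iff[OF lq])
  have drop: "set (concat (drop i Ss)) = {z. i < count ?m z}" if i: "i < r" for i
  proof -
    have "drop i Ss = map ((!) Ss) [i..<r]"
      using Ss(1) by (metis add.left_neutral drop_map drop_upt map_nth)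
    then have "set (concat (drop i Ss)) = (\<Union>j\<in>{i..<r}. set (Ss ! j))" by simp
    also have "\<dots> = {z. i < count ?m z}" using lev i by fastforce
    finally show ?thesis .
  qed
  have "canonical_form G S Ss"
    unfolding canonical_form_def
  proof (intro conjI allI impI eqv)
    show "Ss \<noteq> []" using Ss(1) r0 by auto
    fix i assume "i < length Ss"
    then have i: "i < r" using Ss(1) by simp
    show "distinct (Ss ! i)" "set (Ss ! i) = set (concat (drop i Ss))" using lev[OF i] drop[OF i] by simp_all
    have "x \<in> set (Ss ! i)" using lev[OF i] i x_top by simp
    then show "Ss ! i \<noteq> []" by auto
  qed
  moreover have "set (last Ss) = {y. x \<rightarrow>\<^sup>*\<^bsub>G\<^esub> y}"
  proof -
    have "last Ss = Ss ! (r - 1)" using Ss(1) r0 by (metis last_conv_nth list.size(3) less_irrefl)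
    then have "set (last Ss) = {z. r - 1 < count ?m z}" using lev[of "r - 1"] r0 by simp
    moreover have "r - 1 < count ?m x" using x_top r0 by linarith
    then have "y \<in> {z. r - 1 < count ?m z}" if "x \<rightarrow>\<^sup>*\<^bsub>G\<^esub> y" for y
      using up_closed_heights[OF m, of "r - 1"] that unfolding up_closed_def by blast
    moreover have "x \<rightarrow>\<^sup>*\<^bsub>G\<^esub> z" if z: "r - 1 < count ?m z" for z
    proof (rule ccontr)
      assume n: "\<not> x \<rightarrow>\<^sup>*\<^bsub>G\<^esub> z"
      have closed: "x \<rightarrow>\<^sup>*\<^bsub>G\<^esub> head G e" if "e \<in> arcs G" "x \<rightarrow>\<^sup>*\<^bsub>G\<^esub> tail G e" for e
        using that wf unfolding reachable_def
        by (auto simp: arcs_ends_conv intro: rtrancl_on_into_rtrancl_on)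
      have "\<exists>p. peak G ?m p \<and> count ?m p = Suc (r - 1) \<and> p \<notin> {y. x \<rightarrow>\<^sup>*\<^bsub>G\<^esub> y}"
        using le_r r0 z n closed
        by (intro peak_outside_up_closed[OF G m, where z = z]) (auto simp: not_less[symmetric])
      then obtain p where "peak G ?m p" "\<not> x \<rightarrow>\<^sup>*\<^bsub>G\<^esub> p" by blast
      moreover have "x \<rightarrow>\<^sup>*\<^bsub>G\<^esub> x" using xv by (simp add: reachable_def)
      ultimately show False using uniq by blast
    qed
    ultimately show ?thesis by blast
  qed
  moreover have "set (Ss ! i) = up_closed G hull (set (Ss ! Suc i) \<union> {y. \<exists>x\<in>set (Ss ! Suc i). adjacent G x y})"
    if i: "Suc i < length Ss" for i
  proof -
    have i': "i < r" "Suc i < r" using i Ss(1) by simp_all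
    let ?L = "{z. i < count ?m z}" and ?L' = "{z. Suc i < count ?m z}"
    let ?B = "?L' \<union> {y. \<exists>x\<in>?L'. adjacent G x y}"
    have adj: "i < count ?m y" if "Suc i < count ?m z" "adjacent G z y" for y z
      using that m unfolding adjacent_iff heights_def by force
    have "up_closed G hull ?B \<subseteq> ?L"
      using adj by (intro hull_minimal up_closed_heights[OF m]) auto
    moreover have "?L \<subseteq> up_closed G hull ?B"
    proof (rule ccontr)
      assume "\<not> ?thesis"
      then obtain z where z: "i < count ?m z" "z \<notin> up_closed G hull ?B" by auto
      have BH: "?B \<subseteq> up_closed G hull ?B" by (rule hull_subset)
      \<comment> \<open>The hull is an intersection of up-closed sets, hence closed along arrows.\<close>
      have closed: "head G e \<in> up_closed G hull ?B" if e: "e \<in> arcs G" "tail G e \<in> up_closed G hull ?B" for e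
        unfolding hull_def
      proof (rule InterI)
        fix T assume "T \<in> {t. up_closed G t \<and> ?B \<subseteq> t}"
        then have T: "up_closed G T" "tail G e \<in> T" using e(2) unfolding hull_def by auto
        have "tail G e \<rightarrow>\<^sup>*\<^bsub>G\<^esub> head G e"
          using e(1) lq unfolding reachable_def loopless_quiver_def
          by (auto simp: arcs_ends_conv intro!: rtrancl_on_into_rtrancl_on[of "tail G e" "tail G e"])
        then show "head G e \<in> T" using T unfolding up_closed_def by blast
      qed
      have "\<exists>p. peak G ?m p \<and> count ?m p = Suc i \<and> p \<notin> up_closed G hull ?B"
        by (rule peak_outside_up_closed[OF G m closed _ _ z]) (use BH in auto)
      then obtain p where "peak G ?m p" "count ?m p = Suc i" by blast
      then show False using uniq x_top i' by auto
    qed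
    ultimately show ?thesis using lev[OF i'(1)] lev[OF i'(2)] by simp
  qed
  ultimately show ?thesis using S xv unfolding principal_def by blast
qed

section \<open>Modules concentrated at a sink\<close>

text \<open>
  At a sink any linear map between the two spaces is a morphism from a module concentrated
  there.
\<close>

lemma nonzero_hom_from_sink_support:
  assumes lq: "loopless_quiver G" and s: "sink G x" and M: "is_rep G M" and N: "is_rep G N"
    and off: "\<And>z. z \<in> verts G \<Longrightarrow> z \<noteq> x \<Longrightarrow> rep_space M z = {0}"
    and Mx: "rep_space M x \<noteq> {0}" and Nx: "rep_space N x \<noteq> {0}"
  shows "nonzero_hom G M N"
proof -
  have x: "x \<in> verts G" using s by (simp add: sink_iff)
  note subM = is_rep_subspace[OF M] and subN = is_rep_subspace[OF N]
  obtain v where v: "v \<in> rep_space M x" "v \<noteq> 0" using Mx vec.subspace_0[OF subM[OF x]] by blast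
  obtain w where w: "w \<in> rep_space N x" "w \<noteq> 0" using Nx vec.subspace_0[OF subN[OF x]] by blast
  obtain f where f: "(\<forall>u v. f (u + v) = f u + f v) \<and> (\<forall>c v. f (vec_scale c v) = vec_scale c (f v)) \<and>
      (\<forall>u. f u \<in> vec.span {w}) \<and> f v = w"
    using linear_map_to_line[OF v(2), of w] by metis
  have span: "vec.span {w} \<subseteq> rep_space N x" using vec.span_minimal[OF _ subN[OF x]] w(1) by blast
  define \<phi> where "\<phi> = (\<lambda>z u. if z = x then f u else 0)"
  have "rep_hom G M N \<phi>"
    unfolding rep_hom_def
  proof (intro conjI ballI)
    fix z assume z: "z \<in> verts G"
    show "linear_between (rep_space M z) (rep_space N z) (\<phi> z)"
      using f span vec.subspace_0[OF subN[OF z]]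
      by (intro linear_betweenI) (auto simp: \<phi>_def)
  next
    fix e u assume e: "e \<in> arcs G" and u: "u \<in> rep_space M (tail G e)"
    have t: "tail G e \<noteq> x" "tail G e \<in> verts G" using s e lq by (auto simp: sink_iff loopless_quiver_def)
    then have u0: "u = 0" using off u by blast
    have M0: "rep_map M e 0 = 0" by (rule rep_map_0[OF lq M e])
    have N0: "rep_map N e 0 = 0" by (rule rep_map_0[OF lq N e])
    have "f (vec_scale 0 0) = vec_scale 0 (f 0)" using f by blast
    then have "f 0 = 0" by (simp only: vec.scale_zero_left)
    then show "\<phi> (head G e) (rep_map M e u) = rep_map N e (\<phi> (tail G e) u)"
      using t(1) M0 N0 unfolding u0 by (simp add: \<phi>_def)
  qed
  moreover have "\<phi> x v \<noteq> 0" using f w by (simp add: \<phi>_def)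
  ultimately show ?thesis using v x by (auto simp: nonzero_hom_def zero_hom_def)
qed

definition simple_rep :: "'v \<Rightarrow> ('v, 'e, 'k::field) rep" where
  "simple_rep x = \<lparr> rep_space = (\<lambda>_. {0})(x := vec.span {\<lambda>l. if l = [] then 1 else 0}), rep_map = (\<lambda>_ _. 0) \<rparr>"

lemma indecomposable_simple_rep:
  assumes x: "x \<in> verts G"
  shows "indecomposable G (simple_rep x :: ('v, 'e, 'k::field) rep)"
proof -
  let ?d = "\<lambda>l :: 'e list. if l = [] then 1 else (0::'k)"
  let ?L = "simple_rep x :: ('v, 'e, 'k) rep"
  have d0: "?d \<noteq> 0" by (auto simp: fun_eq_iff)
  have Lx: "rep_space ?L x = vec.span {?d}" and Lz: "\<And>z. z \<noteq> x \<Longrightarrow> rep_space ?L z = {0}"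
    by (simp_all add: simple_rep_def)
  have z0: "(0 :: ('e, 'k) vec) \<in> rep_space ?L z" for z by (cases "z = x") (simp_all add: Lx Lz vec.span_zero)
  have "finite_dimensional (rep_space ?L z)" for z
  proof (cases "z = x")
    case True
    then show ?thesis unfolding finite_dimensional_def by (intro exI[of _ "{?d}"]) (simp add: Lx)
  next
    case False
    then show ?thesis unfolding finite_dimensional_def by (intro exI[of _ "{}"]) (simp add: Lz)
  qed
  moreover have "linear_between (rep_space ?L a) (rep_space ?L b) (rep_map ?L e)" for a b e
  proof -
    have "rep_map ?L e = (\<lambda>_. 0)" by (simp add: simple_rep_def)
    then show ?thesis using z0 by (intro linear_betweenI) simp_all
  qed
  ultimately have rep: "is_rep G ?L" unfolding is_rep_def by blast
  have "?d \<in> rep_space ?L x" by (simp add: Lx vec.span_base)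
  then have nz: "\<not> zero_rep G ?L" using x d0 by (auto simp: zero_rep_def)
  show ?thesis
  proof (rule indecomposableI[OF rep nz])
    fix U W
    assume U: "subrep G ?L U" and W: "subrep G ?L W" and "\<And>z. z \<in> verts G \<Longrightarrow> U z \<inter> W z = {0}"
    then have int: "U x \<inter> W x = {0}" using x by blast
    have off: "A z = {0}" if A: "subrep G ?L A" and z: "z \<in> verts G" "z \<noteq> x" for A z
      using subrepD(2)[OF A z(1)] vec.subspace_0[OF subrepD(1)[OF A z(1)]] Lz[OF z(2)] by blast
    have full: "A x = {0} \<or> ?d \<in> A x" if A: "subrep G ?L A" for A
    proof (cases "A x = {0}")
      case False
      have sA: "vec.subspace (A x)" by (rule subrepD(1)[OF A x])
      obtain a where a: "a \<in> A x" "a \<noteq> 0" using False vec.subspace_0[OF sA] by blast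
      have "a \<in> vec.span {?d}" using subrepD(2)[OF A x a(1)] by (simp add: Lx)
      then obtain c where c: "a = vec_scale c ?d" unfolding vec.span_singleton by blast
      then have c0: "c \<noteq> 0" using a(2) by auto
      have "vec_scale (inverse c) a \<in> A x" by (rule vec.subspace_scale[OF sA a(1)])
      moreover have "vec_scale (inverse c) a = ?d" using c c0 by (auto simp: vec_scale_def fun_eq_iff)
      ultimately show ?thesis by metis
    qed blast
    have "U x = {0} \<or> W x = {0}" using full[OF U] full[OF W] int d0 by blast
    then show "(\<forall>z\<in>verts G. U z = {0}) \<or> (\<forall>z\<in>verts G. W z = {0})"
      using off[OF U] off[OF W] by metis
  qed
qed

lemma simple_rep_annihilates:
  assumes lq: "loopless_quiver G" and s: "sink G x"
  shows "annihilates G [x] (simple_rep x :: ('v, 'e, 'k::field) rep)"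
proof -
  let ?L = "simple_rep x :: ('v, 'e, 'k) rep"
  have "indecomposable G ?L" using s by (intro indecomposable_simple_rep) (simp add: sink_iff)
  then have "zero_rep (reflect x G) (reflect_rep G x ?L)"
    by (intro zero_rep_reflect_concentrated[OF lq s] indecomposableD(1)) (simp_all add: simple_rep_def)
  then show ?thesis using s by (simp add: annihilates_Cons annihilates_Nil)
qed

section \<open>Chains of nonzero morphisms\<close>

definition indec_hom ::
    "('v, 'e) pre_digraph \<Rightarrow> ('v, 'e, 'k::field) rep \<Rightarrow> ('v, 'e, 'k) rep \<Rightarrow> bool" where
  "indec_hom G M N \<longleftrightarrow> indecomposable G M \<and> indecomposable G N \<and> nonzero_hom G M N"

lemma rep_iso_id: "rep_iso G M M (\<lambda>x v. v)"
  by (simp add: rep_iso_def rep_hom_def linear_between_def bij_betw_def inj_on_def)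

lemma rep_iso_compose:
  assumes lq: "loopless_quiver G" and "rep_iso G L M \<phi>" "rep_iso G M N \<psi>"
  shows "rep_iso G L N (\<lambda>x. \<psi> x \<circ> \<phi> x)"
  unfolding rep_iso_def
proof (intro conjI ballI)
  show "rep_hom G L N (\<lambda>x. \<psi> x \<circ> \<phi> x)"
    using assms(2,3) by (intro rep_hom_compose[OF lq, of L M]) (simp_all add: rep_iso_def)
  fix x assume "x \<in> verts G"
  then show "bij_betw (\<psi> x \<circ> \<phi> x) (rep_space L x) (rep_space N x)"
    using assms(2,3) by (intro bij_betw_trans[of _ _ "rep_space M x"]) (simp_all add: rep_iso_def)
qed

lemma nonzero_before_iso:
  assumes iso: "rep_iso G M N \<theta>" and M: "is_rep G M" and \<phi>: "rep_hom G L M \<phi>" "\<not> zero_hom G L \<phi>"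
  shows "\<not> zero_hom G L (\<lambda>x. \<theta> x \<circ> \<phi> x)"
proof -
  obtain x v where xv: "x \<in> verts G" "v \<in> rep_space L x" "\<phi> x v \<noteq> 0" using \<phi>(2) by (auto simp: zero_hom_def)
  have \<theta>: "rep_hom G M N \<theta>" using iso by (simp add: rep_iso_def)
  have "inj_on (\<theta> x) (rep_space M x)" using iso xv(1) by (auto simp: rep_iso_def bij_betw_def)
  moreover have "\<phi> x v \<in> rep_space M x" using rep_hom_into[OF \<phi>(1) xv(1,2)] .
  moreover have "0 \<in> rep_space M x" using is_rep_0[OF M xv(1)] .
  ultimately have "\<theta> x (\<phi> x v) \<noteq> \<theta> x 0" using xv(3) by (auto dest: inj_onD)
  then have "\<theta> x (\<phi> x v) \<noteq> 0" using rep_hom_zero[OF \<theta> M xv(1)] by simp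
  then show ?thesis using xv by (auto simp: zero_hom_def)
qed

text \<open>
  Isomorphisms in the chain are composed with an adjacent morphism, which keeps it nonzero and
  does not change whether it is an isomorphism.
\<close>

lemma chain_iso_or_nonzero_noniso:
  assumes lq: "loopless_quiver G" and M: "indecomposable G M" and chain: "(indec_hom G)\<^sup>*\<^sup>* M N"
  shows "(\<exists>\<theta>. rep_iso G M N \<theta>) \<or> (nonzero_noniso G)\<^sup>+\<^sup>+ M N"
  using chain
proof (induction rule: rtranclp_induct)
  case base
  then show ?case using rep_iso_id by blast
next
  case (step N' N)
  have ind: "indecomposable G N'" "indecomposable G N" and hom: "nonzero_hom G N' N"
    using step.hyps(2) by (simp_all add: indec_hom_def)
  obtain \<phi> where \<phi>: "rep_hom G N' N \<phi>" "\<not> zero_hom G N' \<phi>" using hom by (auto simp: nonzero_hom_def)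
  from step.IH show ?case
  proof
    assume "\<exists>\<theta>. rep_iso G M N' \<theta>"
    then obtain \<theta> where \<theta>: "rep_iso G M N' \<theta>" by blast
    let ?\<psi> = "\<lambda>x. \<phi> x \<circ> \<theta> x"
    have "rep_hom G M N ?\<psi>" using rep_hom_compose[OF lq _ \<phi>(1)] \<theta> by (simp add: rep_iso_def)
    moreover have "\<not> zero_hom G M ?\<psi>" by (rule nonzero_after_iso[OF \<theta> \<phi>(2)])
    ultimately show ?thesis
    proof (cases "rep_iso G M N ?\<psi>")
      case False
      then have "nonzero_noniso G M N"
        using M ind \<open>rep_hom G M N ?\<psi>\<close> \<open>\<not> zero_hom G M ?\<psi>\<close> unfolding nonzero_noniso_def by blast
      then show ?thesis by blast
    qed blast
  next
    assume less: "(nonzero_noniso G)\<^sup>+\<^sup>+ M N'"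
    show ?thesis
    proof (cases "rep_iso G N' N \<phi>")
      case False
      then have "nonzero_noniso G N' N" using ind \<phi> unfolding nonzero_noniso_def by blast
      with less show ?thesis by (meson tranclp.trancl_into_trancl)
    next
      case iso: True
      obtain L where L: "(nonzero_noniso G)\<^sup>*\<^sup>* M L" "nonzero_noniso G L N'"
        using less by (metis tranclpD tranclp.cases tranclp_into_rtranclp rtranclp.rtrancl_refl)
      obtain \<psi> where \<psi>: "rep_hom G L N' \<psi>" "\<not> zero_hom G L \<psi>" "\<not> rep_iso G L N' \<psi>" and indL: "indecomposable G L"
        using L(2) unfolding nonzero_noniso_def by blast
      let ?\<chi> = "\<lambda>x. \<phi> x \<circ> \<psi> x"
      have "rep_hom G L N ?\<chi>" by (rule rep_hom_compose[OF lq \<psi>(1) \<phi>(1)])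
      moreover have "\<not> zero_hom G L ?\<chi>"
        by (rule nonzero_before_iso[OF iso indecomposableD(1)[OF ind(1)] \<psi>(1,2)])
      moreover have "\<not> rep_iso G L N ?\<chi>"
      proof
        assume *: "rep_iso G L N ?\<chi>"
        have "bij_betw (\<psi> x) (rep_space L x) (rep_space N' x)" if x: "x \<in> verts G" for x
        proof -
          have "bij_betw (\<phi> x \<circ> \<psi> x) (rep_space L x) (rep_space N x)" "bij_betw (\<phi> x) (rep_space N' x) (rep_space N x)"
            using * iso x by (auto simp: rep_iso_def)
          moreover have "\<psi> x ` rep_space L x \<subseteq> rep_space N' x" using rep_hom_into[OF \<psi>(1) x] by blast
          ultimately show ?thesis using bij_betw_comp_iff2 by blast
        qed
        then show False using \<psi>(1,3) by (simp add: rep_iso_def)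
      qed
      ultimately have "nonzero_noniso G L N" using indL ind unfolding nonzero_noniso_def by blast
      with L(1) show ?thesis by (meson rtranclp_into_tranclp1)
    qed
  qed
qed

lemma iso_class_eq:
  assumes lq: "loopless_quiver G" and M: "is_rep G M" and iso: "rep_iso G M N \<theta>"
  shows "iso_class G M = iso_class G N"
proof -
  obtain \<theta>' where \<theta>': "rep_iso G N M \<theta>'" using rep_iso_inverse[OF lq M iso] by blast
  show ?thesis
    unfolding iso_class_def using rep_iso_compose[OF lq] iso \<theta>' by blast
qed

lemma chain_class_le:
  assumes lq: "loopless_quiver G" and M: "indecomposable G M" "preprojective G M"
    and N: "indecomposable G N" "preprojective G N" and chain: "(indec_hom G)\<^sup>*\<^sup>* M N"
  shows "class_le G (iso_class G M) (iso_class G N)"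
proof -
  have "M \<in> iso_class G M" "N \<in> iso_class G N"
    using indecomposableD(1) M(1) N(1) rep_iso_id unfolding iso_class_def by blast+
  then have "class_less G (iso_class G M) (iso_class G N) \<or> iso_class G M = iso_class G N"
    using chain_iso_or_nonzero_noniso[OF lq M(1) chain] iso_class_eq[OF lq indecomposableD(1)[OF M(1)]]
    unfolding class_less_def by blast
  moreover have "iso_class G M \<in> preprojective_vertices G" "iso_class G N \<in> preprojective_vertices G"
    using M N unfolding preprojective_vertices_def by blast+
  ultimately show ?thesis by (simp add: class_le_def)
qed

lemma iso_class_annihilates:
  assumes lq: "loopless_quiver G" and X: "indecomposable G X" and M: "indecomposable G M"
    and mem: "X \<in> iso_class G M"
  shows "annihilates G S X \<longleftrightarrow> annihilates G S M"
proof -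
  obtain \<phi> where "rep_iso G M X \<phi>" using mem by (auto simp: iso_class_def)
  then have "nonzero_hom G M X" "nonzero_hom G X M"
    using rep_iso_nonzero_homs[OF lq indecomposableD[OF M] indecomposableD(1)[OF X]] by blast+
  then show ?thesis using nonzero_hom_annihilates[OF lq] X M by blast
qed

lemma class_le_annihilates:
  assumes lq: "loopless_quiver G" and M: "indecomposable G M" and N: "indecomposable G N"
    and le: "class_le G (iso_class G M) (iso_class G N)" and S: "annihilates G S N"
  shows "annihilates G S M"
proof -
  from le consider "class_less G (iso_class G M) (iso_class G N)" | "iso_class G M = iso_class G N"
    by (auto simp: class_le_def)
  then show ?thesis
  proof cases
    case 1
    then obtain X Y where XY: "X \<in> iso_class G M" "Y \<in> iso_class G N" "(nonzero_noniso G)\<^sup>+\<^sup>+ X Y"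
      unfolding class_less_def by blast
    have "indecomposable G X \<and> indecomposable G Y \<and> (annihilates G S Y \<longrightarrow> annihilates G S X)"
      using XY(3)
    proof (induction rule: tranclp_induct)
      case (base Y)
      then show ?case using nonzero_hom_annihilates[OF lq, of X Y S]
        unfolding nonzero_noniso_def nonzero_hom_def by blast
    next
      case (step Y Z)
      then show ?case using nonzero_hom_annihilates[OF lq, of Y Z S]
        unfolding nonzero_noniso_def nonzero_hom_def by blast
    qed
    then show ?thesis using iso_class_annihilates[OF lq _ M XY(1)] iso_class_annihilates[OF lq _ N XY(2)] S by blast
  next
    case 2
    have "M \<in> iso_class G M" using indecomposableD(1)[OF M] rep_iso_id unfolding iso_class_def by blast
    then show ?thesis using 2 iso_class_annihilates[OF lq M N] S by blast
  qed
qed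

section \<open>From an inequality of sequences to a chain of morphisms\<close>

lemma acyclic_quiver_of_quiver:
  assumes "quiver G"
  shows "acyclic_quiver G"
proof -
  interpret quiver G by fact
  have "acyclic (arcs_ends G)"
  proof (rule acyclicI, rule allI, rule notI)
    fix x assume "(x, x) \<in> (arcs_ends G)\<^sup>+"
    then obtain p where "awalk x p x" "p \<noteq> []" using reachable1_awalk by blast
    then have "closed_w p" by (auto simp: closed_w_def)
    then show False using closed_w_imp_cycle no_oriented_cycle by blast
  qed
  then show ?thesis using no_loops by (auto simp: acyclic_quiver_def loopless_quiver_def)
qed

text \<open>
  The last term of a shortest annihilating sequence is the same for all equivalent sequences.
\<close>

lemma shortest_last:
  assumes G: "acyclic_quiver G" and M: "indecomposable G M" and S: "shortest_annihilating G S M"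
  obtains A x where "S = A @ [x]" "admissible G (A @ [x])" "peak G (mset S) x"
    "\<And>y. peak G (mset S) y \<Longrightarrow> y = x"
proof -
  have lq: "loopless_quiver G" using G by (simp add: acyclic_quiver_def)
  have annS: "annihilates G S M" and admS: "admissible G S"
    using S by (simp_all add: shortest_annihilating_def annihilates_def)
  have "S \<noteq> []" using annS indecomposableD(2)[OF M] by (auto simp: annihilates_Nil)
  then obtain A x where Ax: "S = A @ [x]" by (metis append_butlast_last_id)
  have "peak G (mset S) x" using peak_last[OF lq] admS Ax by blast
  then show ?thesis using that Ax admS shortest_unique_peak[OF G M S] by blast
qed

lemma shortest_principal:
  assumes "acyclic_quiver G" "indecomposable G M" "shortest_annihilating G S M"
  shows "principal G S"
proof -
  obtain A x where Ax: "S = A @ [x]" "admissible G (A @ [x])" "peak G (mset S) x"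
    "\<And>y. peak G (mset S) y \<Longrightarrow> y = x"
    using shortest_last[OF assms] by blast
  have "admissible G S" using Ax(1,2) by simp
  then show ?thesis by (rule unique_peak_principal[OF assms(1) _ Ax(3,4)])
qed

text \<open>
  A sequence with a unique peak \<open>x\<close> is the least one in which \<open>x\<close> occurs that often: its meet
  with \<open>m\<close>, if proper, would lack the last occurrence of \<open>x\<close>.
\<close>

lemma unique_peak_least:
  assumes G: "acyclic_quiver G" and S: "admissible G S"
    and uniq: "\<And>y. peak G (mset S) y \<Longrightarrow> y = x"
    and R: "heights G m" and le: "count (mset S) x \<le> count m x"
  shows "mset S \<subseteq># m"
proof (rule ccontr)
  assume n: "\<not> mset S \<subseteq># m"
  have lq: "loopless_quiver G" using G by (simp add: acyclic_quiver_def)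
  obtain B where B: "admissible G B" "mset B = mset S \<inter># m"
    using realize[OF G heights_inter[OF heights_mset[OF lq S] R]] by blast
  then obtain U where U: "admissible G (B @ U)" "mset (B @ U) = mset S"
    using extend_to[OF G B(1) heights_mset[OF lq S]] subset_mset.inf.cobounded1 by metis
  have "U \<noteq> []" using U(2) B(2) n by (metis append_Nil2 subset_mset.inf.cobounded2)
  then obtain U' y where U': "U = U' @ [y]" by (metis append_butlast_last_id)
  have "peak G (mset S) y" using U U' by (intro peak_last[OF lq, of "B @ U'"]) simp_all
  then have "y = x" by (rule uniq)
  then have "count (mset B) x < count (mset S) x"
    using arg_cong[OF U(2), of "\<lambda>m. count m x"] U' by simp
  then show False using B(2) le by simp
qed

text \<open>
  Some peak \<open>z\<close> of \<open>T\<close> lies above the \<open>c\<close>-th occurrence of \<open>x\<close>, in the sense that a sequence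
  below \<open>T\<close> with all occurrences of \<open>z\<close> contains that occurrence too. To find it, take a longest
  \<open>B\<close> below \<open>T\<close> with fewer than \<open>c\<close> occurrences of \<open>x\<close>, and let \<open>z\<close> be the last term in an
  extension of \<open>B\<close> to \<open>T\<close>.
\<close>

lemma peak_above_vertex:
  assumes G: "acyclic_quiver G" and T: "admissible G T" and x: "0 < c" "c \<le> count (mset T) x"
  obtains C z where "admissible G (C @ [z])" "mset (C @ [z]) = mset T"
    "\<And>m. heights G m \<Longrightarrow> m \<subseteq># mset T \<Longrightarrow> count m z = count (mset T) z \<Longrightarrow> c \<le> count m x"
proof -
  have lq: "loopless_quiver G" using G by (simp add: acyclic_quiver_def)
  let ?P = "\<lambda>B. admissible G B \<and> mset B \<subseteq># mset T \<and> count (mset B) x < c"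
  have P0: "?P []" using x by simp
  have bound: "\<forall>B. ?P B \<longrightarrow> length B < Suc (length T)"
    by (metis le_imp_less_Suc size_mset size_mset_mono)
  obtain B where B: "?P B" and max: "\<And>B'. ?P B' \<Longrightarrow> length B' \<le> length B"
    using Lattices_Big.ex_has_greatest_nat[of ?P, OF P0 bound] by blast
  obtain D where D: "admissible G (B @ D)" "mset (B @ D) = mset T"
    using extend_to[OF G _ heights_mset[OF lq T]] B by blast
  have "D \<noteq> []" using B D(2) x by (metis append_Nil2 not_less)
  then obtain D' z where D': "D = D' @ [z]" by (metis append_butlast_last_id)
  show ?thesis
  proof (rule that[of "B @ D'" z])
    show "admissible G ((B @ D') @ [z])" "mset ((B @ D') @ [z]) = mset T" using D D' by simp_all
    fix m assume m: "heights G m" "m \<subseteq># mset T" "count m z = count (mset T) z"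
    show "c \<le> count m x"
    proof (rule ccontr)
      assume n: "\<not> c \<le> count m x"
      have hB: "heights G (mset B)" using heights_mset[OF lq] B by blast
      obtain J where J: "admissible G J" "mset J = m \<union># mset B"
        using realize[OF G heights_union[OF m(1) hB]] by blast
      have "count (mset J) x < c" using J(2) B n by simp
      moreover have "mset J \<subseteq># mset T" using J(2) B m(2) by (simp add: subseteq_mset_def)
      ultimately have "?P J" using J(1) by blast
      then have "length J \<le> length B" by (rule max)
      then have "size (m \<union># mset B) \<le> size (mset B)" using J(2) by (metis size_mset)
      moreover have "mset B \<subseteq># m \<union># mset B" by simp
      ultimately have "m \<union># mset B = mset B" by (metis mset_subset_size not_le subset_mset.less_le)
      then have "count (m \<union># mset B) z = count (mset B) z" by (rule arg_cong)
      then have "count m z \<le> count (mset B) z" by simp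
      moreover have "count (mset B) z < count (mset T) z"
        using arg_cong[OF D(2), of "\<lambda>m. count m z"] D' by simp
      ultimately show False using m(3) by simp
    qed
  qed
qed

lemma killed_by_sink:
  assumes V: "indecomposable G V" and ann: "annihilates G [x] V"
  shows "z \<in> verts G \<Longrightarrow> z \<noteq> x \<Longrightarrow> rep_space V z = {0}" and "rep_space V x \<noteq> {0}"
proof -
  show off: "z \<in> verts G \<Longrightarrow> z \<noteq> x \<Longrightarrow> rep_space V z = {0}" for z
    by (rule annihilates_sink_support[OF ann])
  show "rep_space V x \<noteq> {0}"
    using off indecomposableD(2)[OF V] unfolding zero_rep_def by metis
qed

lemma annihilates_after:
  assumes "admissible G C"
  shows "annihilates G (C @ D) M \<longleftrightarrow> annihilates (fold reflect C G) D (reflect_rep_seq G C M)"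
  using assms by (simp add: annihilates_append)

text \<open>
  Before the last reflection both modules are concentrated at the same sink.
\<close>

lemma nonzero_hom_of_equal_sequences:
  assumes G: "acyclic_quiver G" and M: "indecomposable G M" and N: "indecomposable G N"
    and SM: "shortest_annihilating G S M" and SN: "shortest_annihilating G T N"
    and eq: "mset S = mset T"
  shows "nonzero_hom G M N"
proof -
  have lq: "loopless_quiver G" using G by (simp add: acyclic_quiver_def)
  have annS: "annihilates G S M" and annT: "annihilates G T N"
    using SM SN by (simp_all add: shortest_annihilating_def)
  obtain A x where Ax: "S = A @ [x]" "admissible G (A @ [x])"
    by (rule shortest_last[OF G M SM]) blast
  have A: "admissible G A" and s: "sink (fold reflect A G) x" using Ax(2) by (simp_all add: admissible_append)
  have proper: "mset A \<subset># mset S" unfolding Ax(1) by simp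
  have annN: "annihilates G (A @ [x]) N"
    using annihilates_cong_mset[OF lq _ Ax(2), of T N] annT Ax(1) eq by (simp add: annihilates_def)
  have na: "\<not> annihilates G A M" "\<not> annihilates G A N"
    using proper_not_annihilates[OF G indecomposableD(1)[OF M] SM proper]
      proper_not_annihilates[OF G indecomposableD(1)[OF N] SN, of A] proper eq by simp_all
  note lqA = loopless_fold_reflect[OF lq, of A]
  note MA = indecomposable_reflect_rep_seq[OF lq A M na(1)] and NA = indecomposable_reflect_rep_seq[OF lq A N na(2)]
  have kill: "annihilates (fold reflect A G) [x] (reflect_rep_seq G A M)"
    "annihilates (fold reflect A G) [x] (reflect_rep_seq G A N)"
    using annihilates_after[OF A, of "[x]" M] annihilates_after[OF A, of "[x]" N] annS[unfolded Ax(1)] annN by blast+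
  have "nonzero_hom (fold reflect A G) (reflect_rep_seq G A M) (reflect_rep_seq G A N)"
    by (rule nonzero_hom_from_sink_support[OF lqA s indecomposableD(1)[OF MA] indecomposableD(1)[OF NA]
          killed_by_sink[OF MA kill(1)] killed_by_sink(2)[OF NA kill(2)]])
  then show ?thesis by (rule unreflect_nonzero_hom_seq[OF lq A M indecomposableD(1)[OF N] na(1)])
qed

text \<open>
  If \<open>V\<close> vanished at \<open>z\<close>, the reflection at \<open>z\<close> would place the full sum of the neighbouring
  spaces there. The reflected module is concentrated at \<open>y\<close>. For \<open>z \<noteq> y\<close> that sum is therefore
  zero, and so is the space at the neighbour \<open>y\<close>; for \<open>z = y\<close> all neighbouring spaces are zero,
  and so is their sum. In both cases the reflected module would be zero.
\<close>

lemma penultimate_support: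
  assumes lq: "loopless_quiver G" and V: "indecomposable G V"
    and adm: "admissible G [z, y]" and ann: "annihilates G [z, y] V" and nann: "\<not> annihilates G [z] V"
    and adj: "z \<noteq> y \<Longrightarrow> adjacent G z y"
  shows "rep_space V z \<noteq> {0}"
proof
  assume Vz: "rep_space V z = {0}"
  have s: "sink G z" using adm by simp
  have zv: "z \<in> verts G" using s by (simp add: sink_iff)
  note rep = indecomposableD(1)[OF V]
  let ?W = "reflect_rep G z V"
  have nz: "\<not> zero_rep (reflect z G) ?W" using nann s by (simp add: annihilates_Cons annihilates_Nil)
  have W: "indecomposable (reflect z G) ?W" by (rule indecomposable_reflect_rep[OF lq s V nz])
  have kill: "annihilates (reflect z G) [y] ?W" using ann annihilates_Cons[of G z "[y]" V] by simp
  have off: "rep_space ?W w = {0}" if "w \<in> verts G" "w \<noteq> y" for w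
    using killed_by_sink(1)[OF W kill, of w] that by simp
  have Wy: "rep_space ?W y \<noteq> {0}" by (rule killed_by_sink(2)[OF W kill])
  show False
  proof (cases "z = y")
    case True
    have "rep_space V (tail G e) = {0}" if e: "e \<in> in_arcs G z" for e
      using off[OF in_arcsD(4)[OF lq e]] in_arcsD(3)[OF lq e] True by (simp add: rep_space_reflect_rep)
    then have "neighbour_sum G z V = {0}" by (rule direct_sum_zero)
    moreover have "0 \<in> rep_space ?W z" using is_rep_0[OF indecomposableD(1)[OF W]] zv by simp
    ultimately have "rep_space ?W z = {0}" by (auto simp: rep_space_reflect_rep)
    then show False using Wy True by simp
  next
    case False
    obtain e where e: "e \<in> arcs G" "tail G e = y" "head G e = z"
      using adj[OF False] s by (auto simp: adjacent_iff sink_iff)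
    then have ein: "e \<in> in_arcs G z" by (simp add: in_arcs_def)
    have yv: "y \<in> verts G" using in_arcsD(4)[OF lq ein] e(2) by simp
    have "rep_space V y \<noteq> {0}" using Wy False by (simp add: rep_space_reflect_rep)
    then obtain v where v: "v \<in> rep_space V (tail G e)" "v \<noteq> 0"
      using is_rep_0[OF rep yv] e(2) by blast
    have t: "tuple {e} (\<lambda>_. v) \<in> neighbour_sum G z V"
      by (rule single_in_neighbour_sum[OF lq rep ein v(1)])
    then have "incoming G z V (tuple {e} (\<lambda>_. v)) \<in> rep_space V z"
      by (rule linear_betweenD(1)[OF linear_incoming[OF lq rep zv]])
    then have "incoming G z V (tuple {e} (\<lambda>_. v)) = 0" using Vz by simp
    then have "tuple {e} (\<lambda>_. v) \<in> rep_space ?W z" using t by (simp add: rep_space_reflect_rep)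
    then have "tuple {e} (\<lambda>_. v) = 0" using off[OF zv False] by simp
    then have "component e (tuple {e} (\<lambda>_. v)) = 0" by (simp only: component_simps)
    then show False using v(2) by simp
  qed
qed

text \<open>
  Descent on the length of \<open>T\<close>: unless the two sequences agree, there is an indecomposable \<open>X\<close>
  with a nonzero morphism to \<open>N\<close> and with a shortest sequence between \<open>S\<close> and \<open>T\<close>, strictly
  below \<open>T\<close>.
\<close>

lemma chain_of_seq_le:
  assumes G: "acyclic_quiver G" and M: "indecomposable G M" and SM: "shortest_annihilating G S M"
  shows "indecomposable G N \<Longrightarrow> shortest_annihilating G T N \<Longrightarrow> mset S \<subseteq># mset T \<Longrightarrow> (indec_hom G)\<^sup>*\<^sup>* M N"
proof (induction "length T" arbitrary: N T rule: less_induct)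
  case less
  note N = less.prems(1) and SN = less.prems(2) and sub = less.prems(3)
  have lq: "loopless_quiver G" using G by (simp add: acyclic_quiver_def)
  have annS: "annihilates G S M" and annT: "annihilates G T N"
    using SM SN by (simp_all add: shortest_annihilating_def)
  have admS: "admissible G S" and admT: "admissible G T" using annS annT by (simp_all add: annihilates_def)
  obtain x where px: "peak G (mset S) x" and ux: "\<And>w. peak G (mset S) w \<Longrightarrow> w = x"
    by (rule shortest_last[OF G M SM]) blast
  obtain y where uy: "\<And>w. peak G (mset T) w \<Longrightarrow> w = y"
    by (rule shortest_last[OF G N SN]) blast
  show ?case
  proof (cases "mset S = mset T")
    case True
    have "nonzero_hom G M N" by (rule nonzero_hom_of_equal_sequences[OF G M N SM SN True])
    then have "indec_hom G M N" using M N by (simp add: indec_hom_def)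
    then show ?thesis by (rule r_into_rtranclp)
  next
    case False
    obtain U where U: "admissible G (S @ U)" "mset (S @ U) = mset T"
      using extend_to[OF G admS heights_mset[OF lq admT] sub] by blast
    have "U \<noteq> []" using U(2) False by auto
    then obtain U' w where U': "U = U' @ [w]" by (metis append_butlast_last_id)
    have "peak G (mset T) w" using U U' by (intro peak_last[OF lq, of "S @ U'"]) simp_all
    then have wy: "w = y" by (rule uy)
    let ?R = "S @ U'"
    have R: "admissible G ?R" "mset T = add_mset y (mset ?R)"
      using U U' wy by (simp_all add: admissible_append)
    have c: "0 < count (mset S) x" "count (mset S) x \<le> count (mset ?R) x"
      using px by (simp_all add: peak_def)
    \<comment> \<open>After removing the last term \<open>y\<close> of \<open>T\<close>, choose a peak above the last \<open>x\<close> of \<open>S\<close>.\<close>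
    obtain C z where Cz: "admissible G (C @ [z])" "mset (C @ [z]) = mset ?R"
      and above: "\<And>m. heights G m \<Longrightarrow> m \<subseteq># mset ?R \<Longrightarrow> count m z = count (mset ?R) z \<Longrightarrow> count (mset S) x \<le> count m x"
      by (rule peak_above_vertex[OF G R(1) c]) blast
    have "mset (C @ [z]) \<subseteq># mset T" unfolding Cz(2) R(2) by simp
    then obtain D where D: "admissible G ((C @ [z]) @ D)" "mset ((C @ [z]) @ D) = mset T"
      using extend_to[OF G Cz(1) heights_mset[OF lq admT]] by blast
    have "mset (C @ [z]) + mset D = mset T" using D(2) by (simp only: mset_append)
    moreover have "mset T = mset (C @ [z]) + {#y#}" unfolding Cz(2) R(2) by simp
    ultimately have "mset D = {#y#}" by simp
    then have Dy: "D = [y]" by simp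
    have Czy: "admissible G (C @ [z, y])" and mT: "mset (C @ [z, y]) = mset T" using D Dy by simp_all
    have C: "admissible G C" and s: "sink (fold reflect C G) z" using Cz(1) by (simp_all add: admissible_append)
    have adj: "adjacent G z y" if "z \<noteq> y"
    proof (rule ccontr)
      assume "\<not> adjacent G z y"
      then have "admissible G ((C @ [y]) @ [z])" using admissible_swap[of G C z y "[]"] Czy by simp
      then have "peak G (mset T) z" by (rule peak_last[OF lq]) (use mT in \<open>simp add: add_mset_commute\<close>)
      then show False using uy that by blast
    qed
    let ?G = "fold reflect C G" and ?N = "reflect_rep_seq G C N"
    note lqC = loopless_fold_reflect[OF lq, of C]
    have proper: "mset C \<subset># mset T" "mset (C @ [z]) \<subset># mset T" unfolding mT[symmetric]
      by (auto simp: subset_mset.less_le subseteq_mset_def)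
    have na: "\<not> annihilates G C N" "\<not> annihilates G (C @ [z]) N"
      using proper_not_annihilates[OF G indecomposableD(1)[OF N] SN] proper by blast+
    have NC: "indecomposable ?G ?N" by (rule indecomposable_reflect_rep_seq[OF lq C N na(1)])
    have "annihilates G (C @ [z, y]) N" using annihilates_cong_mset[OF lq Czy admT mT, of N] annT by blast
    then have kzy: "annihilates ?G [z, y] ?N" using annihilates_after[OF C, of "[z, y]" N] by blast
    have nz: "\<not> annihilates ?G [z] ?N" using na(2) annihilates_after[OF C, of "[z]" N] by blast
    have "admissible ?G [z, y]" using Czy by (simp add: admissible_append)
    then have Nz: "rep_space ?N z \<noteq> {0}"
      using adj by (intro penultimate_support[OF lqC NC _ kzy nz]) simp_all
    \<comment> \<open>The simple module at \<open>z\<close> maps to the reflected \<open>N\<close>; lifting it back gives \<open>X\<close>.\<close>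
    let ?L = "simple_rep z :: ('a, 'b, 'c) rep"
    have zv: "z \<in> verts ?G" using s by (simp add: sink_iff)
    have L: "indecomposable ?G ?L" by (rule indecomposable_simple_rep[OF zv])
    have kill: "annihilates ?G [z] ?L" by (rule simple_rep_annihilates[OF lqC s])
    have hom: "nonzero_hom ?G ?L ?N"
      by (rule nonzero_hom_from_sink_support[OF lqC s indecomposableD(1)[OF L] indecomposableD(1)[OF NC]
            killed_by_sink[OF L kill] Nz])
    obtain X where X: "indecomposable G X" "nonzero_hom G X N"
      and ann: "\<And>D. annihilates G (C @ D) X \<longleftrightarrow> annihilates ?G D ?L"
      using lift_along_reflections[OF lq C indecomposableD(1)[OF N] L hom] by blast
    have kX: "annihilates G (C @ [z]) X" using ann[of "[z]"] kill by simp
    have nX: "\<not> annihilates G C X" using ann[of "[]"] indecomposableD(2)[OF L] by (simp add: annihilates_Nil)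
    note repX = indecomposableD(1)[OF X(1)]
    obtain SX where SX: "shortest_annihilating G SX X" using shortest_annihilating_exists[OF G kX] by blast
    have annX: "annihilates G SX X" using SX by (simp add: shortest_annihilating_def)
    then have admX: "admissible G SX" by (simp add: annihilates_def)
    have leX: "mset SX \<subseteq># mset (C @ [z])" by (rule shortest_is_least[OF G repX SX kX])
    \<comment> \<open>The last occurrence of \<open>z\<close> belongs to \<open>SX\<close>, since \<open>C\<close> does not annihilate \<open>X\<close>.\<close>
    have "count (mset SX) z = count (mset ?R) z"
    proof (rule ccontr)
      assume ne: "count (mset SX) z \<noteq> count (mset ?R) z"
      have "count (mset SX) a \<le> count (mset C) a" for a
      proof (cases "a = z")
        case True
        have "count (mset SX) z \<le> count (mset (C @ [z])) z" using leX by (simp only: subseteq_mset_def)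
        then have "count (mset SX) z < count (mset (C @ [z])) z"
          using ne Cz(2) by (metis le_neq_implies_less)
        then show ?thesis unfolding True by simp
      next
        case False
        have "count (mset SX) a \<le> count (mset (C @ [z])) a" using leX by (simp only: subseteq_mset_def)
        also have "\<dots> = count (mset C) a" using False by simp
        finally show ?thesis .
      qed
      then have "mset SX \<subseteq># mset C" unfolding subseteq_mset_def by (rule allI)
      then show False using annihilates_mono[OF G repX annX C] nX by blast
    qed
    then have "count (mset S) x \<le> count (mset SX) x"
      using above[OF heights_mset[OF lq admX]] leX Cz(2) by simp
    with ux have subX: "mset S \<subseteq># mset SX" by (rule unique_peak_least[OF G admS _ heights_mset[OF lq admX]])
    have "size (mset SX) \<le> size (mset (C @ [z]))" using leX by (rule size_mset_mono)
    also have "\<dots> < size (mset T)" using proper(2) by (rule mset_subset_size)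
    finally have "length SX < length T" by simp
    from less.hyps[OF this X(1) SX subX] have "(indec_hom G)\<^sup>*\<^sup>* M X" .
    moreover have "indec_hom G X N" using X N by (simp add: indec_hom_def)
    ultimately show ?thesis by (rule rtranclp.rtrancl_into_rtrancl)
  qed
qed

theorem proposition3p7:
  fixes G :: "('v, 'e) pre_digraph"
    and M N :: "('v, 'e, 'k::field) rep"
    and S_M S_N :: "'v list"
  assumes "quiver G"
    and "indecomposable G M" and "preprojective G M"
    and "indecomposable G N" and "preprojective G N"
    and "shortest_annihilating G S_M M"
    and "shortest_annihilating G S_N N"
  shows "class_le G (iso_class G M) (iso_class G N) \<longleftrightarrow> principal_le G S_M S_N"
proof
  have G: "acyclic_quiver G" using assms(1) by (rule acyclic_quiver_of_quiver)
  then have lq: "loopless_quiver G" by (simp add: acyclic_quiver_def)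
  note M = assms(2) and N = assms(4) and SM = assms(6) and SN = assms(7)
  have annM: "annihilates G S_M M" and annN: "annihilates G S_N N"
    using SM SN by (simp_all add: shortest_annihilating_def)
  {
    assume "class_le G (iso_class G M) (iso_class G N)"
    then have "annihilates G S_N M" by (rule class_le_annihilates[OF lq M N _ annN])
    then have "mset S_M \<subseteq># mset S_N" by (rule shortest_is_least[OF G indecomposableD(1)[OF M] SM])
    then have "seq_le G S_M S_N" using annM annN by (simp add: seq_le_iff[OF G] annihilates_def)
    then show "principal_le G S_M S_N"
      using shortest_principal[OF G M SM] shortest_principal[OF G N SN] by (simp add: principal_le_def)
  next
    assume "principal_le G S_M S_N"
    then have "mset S_M \<subseteq># mset S_N" by (simp add: principal_le_def seq_le_iff[OF G])
    then have "(indec_hom G)\<^sup>*\<^sup>* M N" by (rule chain_of_seq_le[OF G M SM N SN])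
    then show "class_le G (iso_class G M) (iso_class G N)"
      by (rule chain_class_le[OF lq M assms(3) N assms(5)])
  }
qed

end
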